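(* Let $H$ be an iterated Hopf Ore extension (IHOE) of $\Bbbk$. Then every left (resp. right) coideal subalgebra $A$ of $H$ is an iterated Ore extension of $\Bbbk$. More precisely, there exists a chain $$\Bbbk=A_0\subset A_1\subset\cdots\subset A_m=A$$ of left (resp. right) coideal subalgebras of $H$, with $m=\operatorname{GKdim}A$, such that $A_i$ is an Ore extension of $A_{i-1}$ for each $1\le i\le m$.
   Context: $\Bbbk$ is a field of characteristic zero; all algebras, Hopf algebras and tensor products are over $\Bbbk$. $\operatorname{GKdim}$ is the Gelfand–Kirillov dimension. A left (resp. right) coideal subalgebra of a Hopf algebra $H$ is a subalgebra $A\subseteq H$ with $\Delta_H(A)\subseteq H\otimes A$ (resp. $\Delta_H(A)\subseteq A\otimes H$). Ore extension: an algebra $H$ containing an algebra $R$ as a subalgebra is an Ore extension of $R$ if there are $X\in H$, an algebra automorphism $\sigma$ of $R$ and a $\sigma$-derivation $\delta$ of $R$ such that $H$ is a free left $R$-module with basis $\{1,X,X^2,\dots\}$ and $Xr=\sigma(r)X+\delta(r)$ for all $r\in R$. An iterated Ore extension of $R$ is an algebra obtained from $R$ by a finite chain of successive Ore extensions. IHOE: an $n$-step iterated Hopf Ore extension of a Hopf algebra $R$ is a Hopf algebra $H$ with a chain of Hopf subalgebras $R=H_0\subset H_1\subset\cdots\subset H_n=H$ such that, as an algebra, $H_i$ is an Ore extension of $H_{i-1}$ for $1\le i\le n$. $H$ is an IHOE of $R$ if it is an $n$-step one for some integer $n\ge 0$. *)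

theory Defs
  imports Complex_Main "HOL-Library.Poly_Mapping" "HOL-Library.Extended_Real"
    "HOL-Library.Liminf_Limsup"
begin

section \<open>Algebras over a field, subalgebras\<close>

text \<open>The underlying ring of an algebra is a whole type of class \<open>ring_1\<close>. The axiom
  \<open>0 \<noteq> 1\<close> of that class excludes only the zero ring, which carries no Hopf algebra structure
  because the counit is unital.\<close>

locale k_algebra = vector_space scale
  for scale :: "'k::field \<Rightarrow> 'h::ring_1 \<Rightarrow> 'h" +
  assumes scale_mult_left: "scale c x * y = scale c (x * y)"
    and scale_mult_right: "x * scale c y = scale c (x * y)"

definition subalgebra :: "('k::field \<Rightarrow> 'h::ring_1 \<Rightarrow> 'h) \<Rightarrow> 'h set \<Rightarrow> bool" where
  "subalgebra scale A \<longleftrightarrow>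
     module.subspace scale A \<and> 1 \<in> A \<and> (\<forall>x\<in>A. \<forall>y\<in>A. x * y \<in> A)"

definition base_field :: "('k::field \<Rightarrow> 'h::ring_1 \<Rightarrow> 'h) \<Rightarrow> 'h set" where
  "base_field scale = range (\<lambda>c. scale c 1)"


section \<open>Tensor products\<close>

text \<open>The tensor product \<open>H \<otimes> H\<close> is the free vector space on \<open>H \<times> H\<close> modulo the subspace
  spanned by the bilinearity relations. Since the scalar action is a term-level parameter, the
  quotient is not formed as a type: elements of \<open>H \<otimes> H\<close> are given by formal linear combinations
  (\<open>Poly_Mapping\<close>), and equality in \<open>H \<otimes> H\<close> is congruence modulo that subspace. The same
  applies to \<open>H \<otimes> H \<otimes> H\<close> with the trilinearity relations.\<close>

definition free_scale :: "'k::field \<Rightarrow> ('b \<Rightarrow>\<^sub>0 'k) \<Rightarrow> ('b \<Rightarrow>\<^sub>0 'k)" where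
  "free_scale c = Poly_Mapping.map (\<lambda>x. c * x)"

lemma lookup_free_scale: "Poly_Mapping.lookup (free_scale c f) p = c * Poly_Mapping.lookup f p"
  by (simp add: free_scale_def Poly_Mapping.map.rep_eq when_def)

lemma vector_space_free_scale: "vector_space (free_scale :: 'k::field \<Rightarrow> ('b \<Rightarrow>\<^sub>0 'k) \<Rightarrow> _)"
  by unfold_locales
    (auto intro!: poly_mapping_eqI simp: lookup_free_scale lookup_add algebra_simps)

definition lin_ext :: "('k::field \<Rightarrow> 'v::ab_group_add \<Rightarrow> 'v) \<Rightarrow> ('b \<Rightarrow> 'v) \<Rightarrow> ('b \<Rightarrow>\<^sub>0 'k) \<Rightarrow> 'v" where
  "lin_ext scale \<phi> f = (\<Sum>p\<in>Poly_Mapping.keys f. scale (Poly_Mapping.lookup f p) (\<phi> p))"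

abbreviation pure :: "'b \<Rightarrow> ('b \<Rightarrow>\<^sub>0 'k::field)" where
  "pure p \<equiv> Poly_Mapping.single p 1"

definition tensor_rel :: "('k::field \<Rightarrow> 'h::ring_1 \<Rightarrow> 'h) \<Rightarrow> (('h \<times> 'h) \<Rightarrow>\<^sub>0 'k) set" where
  "tensor_rel scale = module.span free_scale
     ({pure (x + x', y) - pure (x, y) - pure (x', y) | x x' y. True} \<union>
      {pure (x, y + y') - pure (x, y) - pure (x, y') | x y y'. True} \<union>
      {pure (scale c x, y) - free_scale c (pure (x, y)) | c x y. True} \<union>
      {pure (x, scale c y) - free_scale c (pure (x, y)) | c x y. True})"

definition tensor_eq ::
    "('k::field \<Rightarrow> 'h::ring_1 \<Rightarrow> 'h) \<Rightarrow> (('h \<times> 'h) \<Rightarrow>\<^sub>0 'k) \<Rightarrow> (('h \<times> 'h) \<Rightarrow>\<^sub>0 'k) \<Rightarrow> bool" where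
  "tensor_eq scale u v \<longleftrightarrow> u - v \<in> tensor_rel scale"

definition tensor3_rel :: "('k::field \<Rightarrow> 'h::ring_1 \<Rightarrow> 'h) \<Rightarrow> (('h \<times> 'h \<times> 'h) \<Rightarrow>\<^sub>0 'k) set" where
  "tensor3_rel scale = module.span free_scale
     ({pure (x + x', y, z) - pure (x, y, z) - pure (x', y, z) | x x' y z. True} \<union>
      {pure (x, y + y', z) - pure (x, y, z) - pure (x, y', z) | x y y' z. True} \<union>
      {pure (x, y, z + z') - pure (x, y, z) - pure (x, y, z') | x y z z'. True} \<union>
      {pure (scale c x, y, z) - free_scale c (pure (x, y, z)) | c x y z. True} \<union>
      {pure (x, scale c y, z) - free_scale c (pure (x, y, z)) | c x y z. True} \<union>
      {pure (x, y, scale c z) - free_scale c (pure (x, y, z)) | c x y z. True})"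

definition tensor3_eq ::
    "('k::field \<Rightarrow> 'h::ring_1 \<Rightarrow> 'h) \<Rightarrow> (('h \<times> 'h \<times> 'h) \<Rightarrow>\<^sub>0 'k) \<Rightarrow> (('h \<times> 'h \<times> 'h) \<Rightarrow>\<^sub>0 'k) \<Rightarrow> bool" where
  "tensor3_eq scale u v \<longleftrightarrow> u - v \<in> tensor3_rel scale"

text \<open>The product of \<open>H \<otimes> H\<close>: \<open>(a \<otimes> b)(c \<otimes> d) = ac \<otimes> bd\<close>, extended bilinearly.\<close>

definition tensor_mult ::
    "(('h::ring_1 \<times> 'h) \<Rightarrow>\<^sub>0 'k::field) \<Rightarrow> (('h \<times> 'h) \<Rightarrow>\<^sub>0 'k) \<Rightarrow> (('h \<times> 'h) \<Rightarrow>\<^sub>0 'k)" where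
  "tensor_mult u v =
     lin_ext free_scale (\<lambda>(a, b). lin_ext free_scale (\<lambda>(c, d). pure (a * c, b * d)) v) u"

text \<open>Membership in \<open>A \<otimes> B\<close>, for subspaces \<open>A\<close>, \<open>B\<close> of \<open>H\<close>, where \<open>A \<otimes> B\<close> is identified
  as usual (we are over a field) with its image in \<open>H \<otimes> H\<close>.\<close>

definition in_tensor ::
    "('k::field \<Rightarrow> 'h::ring_1 \<Rightarrow> 'h) \<Rightarrow> 'h set \<Rightarrow> 'h set \<Rightarrow> (('h \<times> 'h) \<Rightarrow>\<^sub>0 'k) \<Rightarrow> bool" where
  "in_tensor scale A B t \<longleftrightarrow> (\<exists>u. Poly_Mapping.keys u \<subseteq> A \<times> B \<and> tensor_eq scale u t)"


section \<open>Hopf algebras\<close>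

text \<open>\<open>\<Delta> x\<close> is a formal linear combination representing the comultiplication of \<open>x\<close>; hence the
  axioms on \<open>\<Delta>\<close> are equations in \<open>H \<otimes> H\<close> or \<open>H \<otimes> H \<otimes> H\<close>, i.e. congruences, and which
  representative \<open>\<Delta> x\<close> is chosen is immaterial.\<close>

locale hopf_algebra = k_algebra scale
  for scale :: "'k::field \<Rightarrow> 'h::ring_1 \<Rightarrow> 'h" +
  fixes \<Delta> :: "'h \<Rightarrow> (('h \<times> 'h) \<Rightarrow>\<^sub>0 'k)"
    and \<epsilon> :: "'h \<Rightarrow> 'k"
    and S :: "'h \<Rightarrow> 'h"
  assumes comult_add: "tensor_eq scale (\<Delta> (x + y)) (\<Delta> x + \<Delta> y)"
    and comult_scale: "tensor_eq scale (\<Delta> (scale c x)) (free_scale c (\<Delta> x))"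
    and comult_mult: "tensor_eq scale (\<Delta> (x * y)) (tensor_mult (\<Delta> x) (\<Delta> y))"
    and comult_one: "tensor_eq scale (\<Delta> 1) (pure (1, 1))"
    and counit_linear: "Vector_Spaces.linear scale (*) \<epsilon>"
    and counit_mult: "\<epsilon> (x * y) = \<epsilon> x * \<epsilon> y"
    and counit_one: "\<epsilon> 1 = 1"
    and coassoc: "tensor3_eq scale
      (lin_ext free_scale (\<lambda>(a, b). lin_ext free_scale (\<lambda>(c, d). pure (c, d, b)) (\<Delta> a)) (\<Delta> x))
      (lin_ext free_scale (\<lambda>(a, b). lin_ext free_scale (\<lambda>(c, d). pure (a, c, d)) (\<Delta> b)) (\<Delta> x))"
    and counit_left: "lin_ext scale (\<lambda>(a, b). scale (\<epsilon> a) b) (\<Delta> x) = x"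
    and counit_right: "lin_ext scale (\<lambda>(a, b). scale (\<epsilon> b) a) (\<Delta> x) = x"
    and antipode_linear: "Vector_Spaces.linear scale scale S"
    and antipode_left: "lin_ext scale (\<lambda>(a, b). S a * b) (\<Delta> x) = scale (\<epsilon> x) 1"
    and antipode_right: "lin_ext scale (\<lambda>(a, b). a * S b) (\<Delta> x) = scale (\<epsilon> x) 1"

definition hopf_subalgebra ::
    "('k::field \<Rightarrow> 'h::ring_1 \<Rightarrow> 'h) \<Rightarrow> ('h \<Rightarrow> (('h \<times> 'h) \<Rightarrow>\<^sub>0 'k)) \<Rightarrow> ('h \<Rightarrow> 'h) \<Rightarrow> 'h set \<Rightarrow> bool" where
  "hopf_subalgebra scale \<Delta> S K \<longleftrightarrow>
     subalgebra scale K \<and> (\<forall>x\<in>K. in_tensor scale K K (\<Delta> x)) \<and> (\<forall>x\<in>K. S x \<in> K)"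

definition left_coideal_subalgebra ::
    "('k::field \<Rightarrow> 'h::ring_1 \<Rightarrow> 'h) \<Rightarrow> ('h \<Rightarrow> (('h \<times> 'h) \<Rightarrow>\<^sub>0 'k)) \<Rightarrow> 'h set \<Rightarrow> bool" where
  "left_coideal_subalgebra scale \<Delta> A \<longleftrightarrow>
     subalgebra scale A \<and> (\<forall>a\<in>A. in_tensor scale UNIV A (\<Delta> a))"

definition right_coideal_subalgebra ::
    "('k::field \<Rightarrow> 'h::ring_1 \<Rightarrow> 'h) \<Rightarrow> ('h \<Rightarrow> (('h \<times> 'h) \<Rightarrow>\<^sub>0 'k)) \<Rightarrow> 'h set \<Rightarrow> bool" where
  "right_coideal_subalgebra scale \<Delta> A \<longleftrightarrow>
     subalgebra scale A \<and> (\<forall>a\<in>A. in_tensor scale A UNIV (\<Delta> a))"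


section \<open>Ore extensions\<close>

definition algebra_automorphism_on ::
    "('k::field \<Rightarrow> 'h::ring_1 \<Rightarrow> 'h) \<Rightarrow> 'h set \<Rightarrow> ('h \<Rightarrow> 'h) \<Rightarrow> bool" where
  "algebra_automorphism_on scale R \<sigma> \<longleftrightarrow>
     bij_betw \<sigma> R R \<and> \<sigma> 1 = 1 \<and>
     (\<forall>r\<in>R. \<forall>s\<in>R. \<sigma> (r + s) = \<sigma> r + \<sigma> s \<and> \<sigma> (r * s) = \<sigma> r * \<sigma> s) \<and>
     (\<forall>c. \<forall>r\<in>R. \<sigma> (scale c r) = scale c (\<sigma> r))"

definition skew_derivation_on ::
    "('k::field \<Rightarrow> 'h::ring_1 \<Rightarrow> 'h) \<Rightarrow> 'h set \<Rightarrow> ('h \<Rightarrow> 'h) \<Rightarrow> ('h \<Rightarrow> 'h) \<Rightarrow> bool" where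
  "skew_derivation_on scale R \<sigma> \<delta> \<longleftrightarrow>
     \<delta> ` R \<subseteq> R \<and>
     (\<forall>r\<in>R. \<forall>s\<in>R. \<delta> (r + s) = \<delta> r + \<delta> s \<and> \<delta> (r * s) = \<sigma> r * \<delta> s + \<delta> r * s) \<and>
     (\<forall>c. \<forall>r\<in>R. \<delta> (scale c r) = scale c (\<delta> r))"

text \<open>\<open>B\<close> is a free left \<open>R\<close>-module with basis \<open>1, X, X\<^sup>2, \<dots>\<close>: every element of \<open>B\<close> is a left
  \<open>R\<close>-combination of the powers of \<open>X\<close> for exactly one finitely supported family of
  coefficients in \<open>R\<close>.\<close>

definition free_on_powers :: "'h::ring_1 set \<Rightarrow> 'h set \<Rightarrow> 'h \<Rightarrow> bool" where
  "free_on_powers R B X \<longleftrightarrow>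
     (\<forall>b\<in>B. \<exists>!r :: nat \<Rightarrow>\<^sub>0 'h. (\<forall>i. Poly_Mapping.lookup r i \<in> R) \<and>
        b = (\<Sum>i\<in>Poly_Mapping.keys r. Poly_Mapping.lookup r i * X ^ i))"

text \<open>The algebra \<open>B\<close> is an Ore extension of its subalgebra \<open>R\<close>; both are subalgebras of an
  ambient algebra.\<close>

definition ore_extension ::
    "('k::field \<Rightarrow> 'h::ring_1 \<Rightarrow> 'h) \<Rightarrow> 'h set \<Rightarrow> 'h set \<Rightarrow> bool" where
  "ore_extension scale R B \<longleftrightarrow>
     subalgebra scale R \<and> subalgebra scale B \<and> R \<subseteq> B \<and>
     (\<exists>X\<in>B. \<exists>\<sigma> \<delta>.
        algebra_automorphism_on scale R \<sigma> \<and> skew_derivation_on scale R \<sigma> \<delta> \<and>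
        free_on_powers R B X \<and> (\<forall>r\<in>R. X * r = \<sigma> r * X + \<delta> r))"

definition iterated_ore_extension ::
    "('k::field \<Rightarrow> 'h::ring_1 \<Rightarrow> 'h) \<Rightarrow> 'h set \<Rightarrow> 'h set \<Rightarrow> bool" where
  "iterated_ore_extension scale R B \<longleftrightarrow>
     (\<exists>(n::nat) K. K 0 = R \<and> K n = B \<and> (\<forall>i<n. ore_extension scale (K i) (K (Suc i))))"

text \<open>The full Hopf algebra \<open>H\<close> is an IHOE of its Hopf subalgebra \<open>R\<close>.\<close>

definition ihoe_of ::
    "('k::field \<Rightarrow> 'h::ring_1 \<Rightarrow> 'h) \<Rightarrow> ('h \<Rightarrow> (('h \<times> 'h) \<Rightarrow>\<^sub>0 'k)) \<Rightarrow> ('h \<Rightarrow> 'h) \<Rightarrow> 'h set \<Rightarrow> bool" where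
  "ihoe_of scale \<Delta> S R \<longleftrightarrow>
     (\<exists>(n::nat) K. K 0 = R \<and> K n = UNIV \<and>
        (\<forall>i\<le>n. hopf_subalgebra scale \<Delta> S (K i)) \<and>
        (\<forall>i<n. K i \<subset> K (Suc i) \<and> ore_extension scale (K i) (K (Suc i))))"


section \<open>Gelfand--Kirillov dimension\<close>

text \<open>The subspace \<open>k + V + V\<^sup>2 + \<dots> + V\<^sup>n\<close>.\<close>

definition power_span :: "('k::field \<Rightarrow> 'h::ring_1 \<Rightarrow> 'h) \<Rightarrow> 'h set \<Rightarrow> nat \<Rightarrow> 'h set" where
  "power_span scale V n = module.span scale {prod_list ws | ws. set ws \<subseteq> V \<and> length ws \<le> n}"

text \<open>The supremum, over the finite-dimensional subspaces \<open>V\<close> of \<open>A\<close>, of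
  \<open>limsup log\<^sub>n dim (k + V + \<dots> + V\<^sup>n)\<close>.\<close>

definition GKdim :: "('k::field \<Rightarrow> 'h::ring_1 \<Rightarrow> 'h) \<Rightarrow> 'h set \<Rightarrow> ereal" where
  "GKdim scale A =
     (SUP V \<in> {V. V \<subseteq> A \<and> (\<exists>B. finite B \<and> V = module.span scale B)}.
        limsup (\<lambda>n. ereal (log (real n) (real (vector_space.dim scale (power_span scale V n))))))"

end

(*
  Let K_0 < ... < K_N be the Hopf subalgebras of the IHOE and X_i the Ore variables. Comparing degrees
  in both sides of coassociativity shows Delta(X_i) = X_i (x) 1 + 1 (x) X_i + w with w in
  K_i (x) K_i. Hence, for f = eps o (coefficient of X_i^n), the map L_f = (f (x) id) Delta sends an
  element of degree n to its leading coefficient r, and sends r X_i^(n+1) + ... to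
  (n+1) r X_i + K_i. A left coideal subalgebra A is stable under all L_f. So, if
  A cap K_i differs from A cap K_(i+1), the b such that b X_i + s is in A for some s in K_i form a
  nonzero coideal in characteristic zero; taking leading coefficients repeatedly one sees that it
  contains 1, so that A contains some Y = X_i + s, and A cap K_(i+1) is the Ore extension of
  A cap K_i by Y. The automorphism sigma restricts to A since sigma = L_(eps sigma) and
  sigma^(-1) = L_(eps sigma^(-1)). Giving the variables Y rapidly increasing weights yields a
  filtration of A with dim F_n <= (n+1)^m, and monomials in the Y give the lower bound for GKdim.
  The right case is the left case for the opposite comultiplication.
*)

theory Submission
  imports Defs
begin

section \<open>Formal linear combinations\<close>

text \<open>Formal combinations of pairs are therefore made into an honest ring in which the tensor
  relations form an ideal; identities hold modulo that ideal and are tested by applying functionals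
  to one factor. One abstract notion of degree then serves \<open>H\<close> and
  \<open>H \<otimes> H\<close> alike. Degrees add only over domains, and a tensor product of domains
  need not be a domain; so the domain property is carried up the Ore chain twice, for
  \<open>K i\<close> and for \<open>H \<otimes> K i\<close>, the second time starting from
  \<open>H \<otimes> k = H\<close>. The antipode enters through grouplike elements: it makes them
  invertible, and an iterated Ore extension of the field has no units but scalars. This is what
  normalizes the coefficients of \<open>X \<otimes> 1\<close> and \<open>1 \<otimes> X\<close> in
  the comultiplication of a variable to \<open>1\<close>.\<close>

lemma poly_mapping_add_induct [case_names zero add]:
  fixes f :: "'b \<Rightarrow>\<^sub>0 'k::comm_monoid_add"
  assumes "P 0" and "\<And>p c f. P f \<Longrightarrow> P (Poly_Mapping.single p c + f)"
  shows "P f"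
proof (induction f rule: update_induct)
  case const
  show ?case by (rule assms(1))
next
  case (update f a b)
  have "Poly_Mapping.update a b f = Poly_Mapping.single a b + f"
    using update(1)
    by (intro poly_mapping_eqI)
       (auto simp: lookup_update lookup_add lookup_single when_def in_keys_iff)
  then show ?case using assms(2)[OF update(3)] by simp
qed

context vector_space
begin

lemma lin_ext_superset:
  assumes "finite A" "Poly_Mapping.keys f \<subseteq> A"
  shows "lin_ext scale \<phi> f = (\<Sum>p\<in>A. scale (Poly_Mapping.lookup f p) (\<phi> p))"
  unfolding lin_ext_def using assms
  by (intro sum.mono_neutral_left) (auto simp: in_keys_iff)

lemma lin_ext_zero [simp]: "lin_ext scale \<phi> 0 = 0"
  by (simp add: lin_ext_def)

lemma lin_ext_single [simp]: "lin_ext scale \<phi> (Poly_Mapping.single p c) = scale c (\<phi> p)"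
  by (subst lin_ext_superset[of "{p}"]) (auto simp: lookup_single)

lemma lin_ext_add [simp]: "lin_ext scale \<phi> (f + g) = lin_ext scale \<phi> f + lin_ext scale \<phi> g"
proof -
  let ?A = "Poly_Mapping.keys f \<union> Poly_Mapping.keys g"
  have "Poly_Mapping.keys (f + g) \<subseteq> ?A" by (rule keys_add)
  then show ?thesis
    using lin_ext_superset[of ?A f \<phi>] lin_ext_superset[of ?A g \<phi>]
      lin_ext_superset[of ?A "f + g" \<phi>]
    by (simp add: lookup_add scale_left_distrib sum.distrib)
qed

lemma lin_ext_uminus [simp]: "lin_ext scale \<phi> (- f) = - lin_ext scale \<phi> f"
  by (metis (no_types) add.inverse_inverse add.left_inverse add_eq_0_iff lin_ext_add lin_ext_zero)

lemma lin_ext_diff [simp]: "lin_ext scale \<phi> (f - g) = lin_ext scale \<phi> f - lin_ext scale \<phi> g"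
  using lin_ext_add[of \<phi> f "- g"] by simp

lemma lin_ext_free_scale [simp]:
  "lin_ext scale \<phi> (free_scale c f) = scale c (lin_ext scale \<phi> f)"
proof -
  have "Poly_Mapping.keys (free_scale c f) \<subseteq> Poly_Mapping.keys f"
    by (auto simp: in_keys_iff lookup_free_scale)
  then show ?thesis
    using lin_ext_superset[of "Poly_Mapping.keys f" f \<phi>]
      lin_ext_superset[of "Poly_Mapping.keys f" "free_scale c f" \<phi>]
    by (simp add: lookup_free_scale scale_sum_right )
qed

lemma lin_ext_fun_scale:
  "lin_ext scale (\<lambda>p. scale c (\<phi> p)) f = scale c (lin_ext scale \<phi> f)"
  by (simp add: lin_ext_def scale_sum_right mult.commute)

end

lemma free_scale_single [simp]:
  "free_scale c (Poly_Mapping.single p d) = Poly_Mapping.single p (c * d :: 'k::field)"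
  by (intro poly_mapping_eqI) (auto simp: lookup_free_scale lookup_single when_def)

lemma free_scale_add [simp]: "free_scale c (f + g) = free_scale c f + free_scale (c::'k::field) g"
  by (intro poly_mapping_eqI) (auto simp: lookup_free_scale lookup_add algebra_simps)

section \<open>The tensor square as a ring modulo an ideal\<close>

text \<open>Pairs with componentwise multiplication, written additively: the convolution product of
  formal combinations of them is then the product of \<open>H \<otimes> H\<close>.\<close>

datatype 'h pmon = PM (pfst: 'h) (psnd: 'h)

instantiation pmon :: (monoid_mult) monoid_add
begin
definition "0 = PM 1 1"
definition "p + q = PM (pfst p * pfst q) (psnd p * psnd q)"
instance by standard (auto simp: zero_pmon_def plus_pmon_def mult.assoc)
end

lemma PM_add [simp]: "PM a b + PM c d = PM (a * c) (b * d)"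
  by (simp add: plus_pmon_def)

definition pu :: "'h::ring_1 \<Rightarrow> 'h \<Rightarrow> ('h pmon \<Rightarrow>\<^sub>0 'k::field)" where
  "pu a b = Poly_Mapping.single (PM a b) 1"

lemma pu_mult [simp]: "pu a b * pu c d = pu (a * c) (b * d)"
  by (simp add: pu_def mult_single)

lemma pu_one [simp]: "pu 1 1 = 1"
  by (simp add: pu_def flip: zero_pmon_def)

lemma pu_power: "pu a b ^ n = pu (a ^ n) (b ^ n)"
  by (induction n) simp_all

definition functional :: "('k::field \<Rightarrow> 'h::ring_1 \<Rightarrow> 'h) \<Rightarrow> ('h \<Rightarrow> 'k) \<Rightarrow> bool" where
  "functional scale f \<longleftrightarrow> (\<forall>x y. f (x + y) = f x + f y) \<and> (\<forall>c x. f (scale c x) = c * f x)"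

text \<open>The slices are \<open>sl f = f \<otimes> id\<close> and \<open>sr g = id \<otimes> g\<close>. The ideal \<open>zt\<close> is the kernel of the
  projection to \<open>H \<otimes> H\<close>, and \<open>TS A B\<close> is the preimage of \<open>A \<otimes> B\<close>.\<close>

definition sl :: "('k::field \<Rightarrow> 'h::ring_1 \<Rightarrow> 'h) \<Rightarrow> ('h \<Rightarrow> 'k) \<Rightarrow> ('h pmon \<Rightarrow>\<^sub>0 'k) \<Rightarrow> 'h" where
  "sl scale f t = lin_ext scale (\<lambda>p. scale (f (pfst p)) (psnd p)) t"

definition sr :: "('k::field \<Rightarrow> 'h::ring_1 \<Rightarrow> 'h) \<Rightarrow> ('h \<Rightarrow> 'k) \<Rightarrow> ('h pmon \<Rightarrow>\<^sub>0 'k) \<Rightarrow> 'h" where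
  "sr scale g t = lin_ext scale (\<lambda>p. scale (g (psnd p)) (pfst p)) t"

definition zt :: "('k::field \<Rightarrow> 'h::ring_1 \<Rightarrow> 'h) \<Rightarrow> ('h pmon \<Rightarrow>\<^sub>0 'k) set" where
  "zt scale = {t. \<forall>f. functional scale f \<longrightarrow> sl scale f t = 0}"

inductive_set TS :: "('k::field \<Rightarrow> 'h::ring_1 \<Rightarrow> 'h) \<Rightarrow> 'h set \<Rightarrow> 'h set \<Rightarrow> ('h pmon \<Rightarrow>\<^sub>0 'k) set"
  for scale A B where
  TS_zt: "t \<in> zt scale \<Longrightarrow> t \<in> TS scale A B"
| TS_step: "a \<in> A \<Longrightarrow> b \<in> B \<Longrightarrow> t \<in> TS scale A B \<Longrightarrow> pu a b + t \<in> TS scale A B"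

lemma functionalD:
  assumes "functional scale f"
  shows "f (x + y) = f x + f y" "f (scale c x) = c * f x" "f 0 = 0" "f (- x) = - f x"
    "f (x - y) = f x - f y"
proof -
  show *: "f (x + y) = f x + f y" "f (scale c x) = c * f x" for x y c
    using assms by (auto simp: functional_def)
  show 0: "f 0 = 0" using *(2)[of 0 0] *(1)[of 0 0] by (metis add_cancel_right_right)
  show **: "f (- x) = - f x" for x using *(1)[of x "- x"] 0 by (simp add: eq_neg_iff_add_eq_0 add.commute)
  show "f (x - y) = f x - f y" using *(1)[of x "- y"] ** by simp
qed

lemma functional_sum: "functional scale f \<Longrightarrow> f (sum h I) = (\<Sum>i\<in>I. f (h i))"
  by (induction I rule: infinite_finite_induct) (simp_all add: functionalD(1,3))

lemma functional_lin_ext: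
  "functional scale g \<Longrightarrow> g (lin_ext scale \<phi> t) = (\<Sum>p\<in>Poly_Mapping.keys t. Poly_Mapping.lookup t p * g (\<phi> p))"
  by (simp add: lin_ext_def functional_sum functionalD(2))

section \<open>Functionals, slices and the ideal of tensor relations\<close>

context k_algebra
begin

abbreviation "fnl \<equiv> functional scale"
abbreviation "SL \<equiv> sl scale"
abbreviation "SR \<equiv> sr scale"
abbreviation "Z \<equiv> zt scale"
abbreviation "TT \<equiv> TS scale"

lemma sl_simps [simp]:
  "SL f 0 = 0" "SL f (s + t) = SL f s + SL f t" "SL f (s - t) = SL f s - SL f t"
  "SL f (- s) = - SL f s" "SL f (pu a b) = scale (f a) b"
  "SL f (Poly_Mapping.single (PM a b) c) = scale c (scale (f a) b)"
  by (simp_all add: sl_def pu_def)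

lemma sr_simps [simp]:
  "SR f 0 = 0" "SR f (s + t) = SR f s + SR f t" "SR f (s - t) = SR f s - SR f t"
  "SR f (- s) = - SR f s" "SR f (pu a b) = scale (f b) a"
  "SR f (Poly_Mapping.single (PM a b) c) = scale c (scale (f b) a)"
  by (simp_all add: sr_def pu_def)

text \<open>Both sides are the value of \<open>f \<otimes> g\<close> at \<open>t\<close>; they
  differ in which factor is evaluated first.\<close>

lemma fnl_sl_sr: "fnl f \<Longrightarrow> fnl g \<Longrightarrow> g (SL f t) = f (SR g t)"
  unfolding sl_def sr_def
  by (simp add: functional_lin_ext functionalD(2) mult.commute)

text \<open>The values of \<open>h\<close> off \<open>W\<close> are arbitrary, so \<open>h\<close>
  may be built from a \<open>THE\<close> term or an \<open>inv_into\<close> that makes sense on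
  \<open>W\<close> alone. A linear map is rebuilt from the values of \<open>h\<close> on a basis of
  \<open>W\<close>.\<close>

lemma fnl_extend:
  assumes W: "subspace W"
    and add: "\<And>x y. x \<in> W \<Longrightarrow> y \<in> W \<Longrightarrow> h (x + y) = h x + h y"
    and scl: "\<And>c x. x \<in> W \<Longrightarrow> h (scale c x) = c * h x"
  shows "\<exists>f. fnl f \<and> (\<forall>x\<in>W. f x = h x)"
proof -
  interpret vs: vector_space "(*) :: 'k \<Rightarrow> 'k \<Rightarrow> 'k"
    by unfold_locales (auto simp: algebra_simps)
  interpret vp: vector_space_pair scale "(*) :: 'k \<Rightarrow> 'k \<Rightarrow> 'k" ..
  obtain B where B: "B \<subseteq> W" "independent B" "W \<subseteq> span B"
    using basis_exists[of W] by metis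
  define f where "f = vp.construct B h"
  have lin: "Vector_Spaces.linear scale (*) f" unfolding f_def by (rule vp.linear_construct[OF B(2)])
  then interpret lf: Vector_Spaces.linear scale "(*)" f .
  have fnl: "fnl f" by (simp add: functional_def lf.add lf.scale)
  have BW: "span B \<subseteq> W" using span_minimal[OF B(1) W] .
  have "f x = h x \<and> x \<in> W" if "x \<in> span B" for x
    using that
  proof (induction rule: span_induct_alt)
    case base
    have "h 0 = 0" using scl[of 0 0] W by (simp add: subspace_0)
    then show ?case using W by (simp add: lf.zero subspace_0)
  next
    case (step c x y)
    have "f x = h x" unfolding f_def using vp.construct_basis[OF B(2) step(1)] .
    moreover have "scale c x \<in> W" "x \<in> W" using step(1) B(1) W by (auto simp: subspace_scale)
    ultimately show ?case using step W by (simp add: lf.add lf.scale add scl subspace_add)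
  qed
  then show ?thesis using fnl B(3) by (meson subsetD)
qed

text \<open>On the direct sum of \<open>W\<close> and the line through \<open>x\<close> the
  coefficient of \<open>x\<close> is linear; the functional is an extension of it.\<close>

lemma fnl_separates:
  assumes W: "subspace W" and x: "x \<notin> W"
  shows "\<exists>f. fnl f \<and> f x = 1 \<and> (\<forall>w\<in>W. f w = 0)"
proof -
  define V where "V = {w + scale c x | w c. w \<in> W}"
  have uniq: "c = d" if "w + scale c x = v + scale d x" "w \<in> W" "v \<in> W" for w v c d
  proof (rule ccontr)
    assume "c \<noteq> d"
    have "scale (c - d) x = v - w" using that by (simp add: scale_left_diff_distrib algebra_simps)
    then have "scale (1 / (c - d)) (v - w) = x" using \<open>c \<noteq> d\<close>
      by (metis divide_self_if mult.commute right_minus_eq scale_one scale_scale times_divide_eq_left mult_1)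
    moreover have "scale (1 / (c - d)) (v - w) \<in> W" using that W by (intro subspace_scale subspace_diff)
    ultimately show False using x by simp
  qed
  define h where "h y = (THE c. \<exists>w\<in>W. y = w + scale c x)" for y
  have h: "h (w + scale c x) = c" if "w \<in> W" for w c
    unfolding h_def using that uniq by (intro the_equality) auto
  have V: "subspace V"
  proof (rule subspaceI)
    show "0 \<in> V" unfolding V_def using subspace_0[OF W] by (auto intro!: exI[of _ 0])
    show "y + z \<in> V" if "y \<in> V" "z \<in> V" for y z
    proof -
      obtain w c v d where "y = w + scale c x" "w \<in> W" "z = v + scale d x" "v \<in> W"
        using \<open>y \<in> V\<close> \<open>z \<in> V\<close> unfolding V_def by auto
      then have "y + z = (w + v) + scale (c + d) x" "w + v \<in> W"
        using W by (auto simp: scale_left_distrib subspace_add)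
      then show ?thesis unfolding V_def by blast
    qed
    show "scale e y \<in> V" if "y \<in> V" for e y
    proof -
      obtain w c where "y = w + scale c x" "w \<in> W" using \<open>y \<in> V\<close> unfolding V_def by auto
      then have "scale e y = scale e w + scale (e * c) x" "scale e w \<in> W"
        using W by (auto simp: scale_right_distrib subspace_scale)
      then show ?thesis unfolding V_def by blast
    qed
  qed
  have "\<exists>f. fnl f \<and> (\<forall>x\<in>V. f x = h x)"
  proof (rule fnl_extend[OF V])
    show "h (y + z) = h y + h z" if "y \<in> V" "z \<in> V" for y z
    proof -
      obtain w c v d where *: "y = w + scale c x" "w \<in> W" "z = v + scale d x" "v \<in> W"
        using \<open>y \<in> V\<close> \<open>z \<in> V\<close> unfolding V_def by auto
      then have "y + z = (w + v) + scale (c + d) x" "w + v \<in> W"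
        using W by (auto simp: scale_left_distrib subspace_add)
      then show ?thesis using * h by metis
    qed
    show "h (scale e y) = e * h y" if "y \<in> V" for e y
    proof -
      obtain w c where *: "y = w + scale c x" "w \<in> W" using \<open>y \<in> V\<close> unfolding V_def by auto
      then have "scale e y = scale e w + scale (e * c) x" "scale e w \<in> W"
        using W by (auto simp: scale_right_distrib subspace_scale)
      then show ?thesis using * h by metis
    qed
  qed
  then obtain f where f: "fnl f" "\<And>x. x \<in> V \<Longrightarrow> f x = h x" by auto
  have inV: "w + scale c x \<in> V" if "w \<in> W" for w c
    using that unfolding V_def by blast
  have "w \<in> V" "h w = 0" if "w \<in> W" for w
    using h[OF that, of 0] inV[OF that, of 0] by simp_all
  moreover have "x \<in> V" "h x = 1"
    using h[OF subspace_0[OF W], of 1] inV[OF subspace_0[OF W], of 1] by simp_all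
  ultimately show ?thesis using f by auto
qed

lemma fnl_eqI: "(\<And>f. fnl f \<Longrightarrow> f x = f y) \<Longrightarrow> x = y"
  using fnl_separates[of "{0}" "x - y"] functionalD(5)
  by (metis cancel_comm_monoid_add_class.diff_cancel right_minus_eq singletonD subspace_single_0 zero_neq_one)

text \<open>Vanishing of all slices on either side means that every \<open>f \<otimes> g\<close>
  kills \<open>t\<close>, because functionals separate points.\<close>

lemma zt_iff_sr: "t \<in> Z \<longleftrightarrow> (\<forall>g. fnl g \<longrightarrow> SR g t = 0)"
proof
  assume "t \<in> Z"
  show "\<forall>g. fnl g \<longrightarrow> SR g t = 0"
  proof (intro allI impI fnl_eqI)
    fix g f assume "fnl g" "fnl f"
    then show "f (SR g t) = f 0" using \<open>t \<in> Z\<close> fnl_sl_sr[of f g t] by (simp add: zt_def functionalD(3))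
  qed
next
  assume *: "\<forall>g. fnl g \<longrightarrow> SR g t = 0"
  show "t \<in> Z" unfolding zt_def
  proof (intro CollectI allI impI fnl_eqI)
    fix g f assume "fnl f" "fnl g"
    then show "g (SL f t) = g 0" using * fnl_sl_sr[of f g t] by (simp add: functionalD(3))
  qed
qed

lemma zt_zero [simp]: "0 \<in> Z" by (simp add: zt_def)
lemma zt_add: "s \<in> Z \<Longrightarrow> t \<in> Z \<Longrightarrow> s + t \<in> Z" by (simp add: zt_def)
lemma zt_uminus: "s \<in> Z \<Longrightarrow> - s \<in> Z" by (simp add: zt_def)
lemma zt_diff: "s \<in> Z \<Longrightarrow> t \<in> Z \<Longrightarrow> s - t \<in> Z" by (simp add: zt_def)

lemma sl_single_mult:
  "SL f (Poly_Mapping.single (PM a b) c * t) = scale c (b * SL (\<lambda>x. f (a * x)) t)"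
proof (induction t rule: poly_mapping_add_induct)
  case (add p d t)
  then show ?case
    by (cases p) (simp add: mult_single algebra_simps scale_mult_right scale_right_distrib)
qed simp

lemma sl_mult_single:
  "SL f (t * Poly_Mapping.single (PM a b) c) = scale c (SL (\<lambda>x. f (x * a)) t * b)"
proof (induction t rule: poly_mapping_add_induct)
  case (add p d t)
  then show ?case
    by (cases p) (simp add: mult_single algebra_simps scale_mult_left scale_right_distrib)
qed simp

lemma sl_pu_mult: "SL f (pu a b * t) = b * SL (\<lambda>x. f (a * x)) t"
  by (simp add: pu_def sl_single_mult)

lemma sl_mult_pu: "SL f (t * pu a b) = SL (\<lambda>x. f (x * a)) t * b"
  by (simp add: pu_def sl_mult_single)

lemma fnl_mult_left: "fnl f \<Longrightarrow> fnl (\<lambda>x. f (a * x))"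
  by (simp add: functional_def distrib_left scale_mult_right)

lemma fnl_mult_right: "fnl f \<Longrightarrow> fnl (\<lambda>x. f (x * a))"
  by (simp add: functional_def distrib_right scale_mult_left)

text \<open>Multiplication by one pure tensor replaces the slicing functional by a translate, which
  is a functional again, and multiplies the slice; so slices that vanish keep vanishing.\<close>

lemma zt_mult_left: "t \<in> Z \<Longrightarrow> s * t \<in> Z"
proof (induction s rule: poly_mapping_add_induct)
  case (add p c s)
  have "Poly_Mapping.single p c * t \<in> Z" using add(2)
    by (cases p) (simp add: zt_def sl_single_mult fnl_mult_left)
  then show ?case using add by (simp add: distrib_right zt_add)
qed simp

lemma zt_mult_right: "t \<in> Z \<Longrightarrow> t * s \<in> Z"
proof (induction s rule: poly_mapping_add_induct)
  case (add p c s)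
  have "t * Poly_Mapping.single p c \<in> Z" using add(2)
    by (cases p) (simp add: zt_def sl_mult_single fnl_mult_right)
  then show ?case using add by (simp add: distrib_left zt_add)
qed simp

lemma zt_single: "Poly_Mapping.single (PM a b) c - pu (scale c a) b \<in> Z"
  by (simp add: zt_def functionalD(2))

lemma zt_pu_add_left: "pu (a + a') b - pu a b - pu a' b \<in> Z"
  by (simp add: zt_def functionalD(1) scale_left_distrib)

lemma zt_pu_add_right: "pu a (b + b') - pu a b - pu a b' \<in> Z"
  by (simp add: zt_def scale_right_distrib)

lemma zt_pu_zero: "pu a 0 \<in> Z" "pu 0 b \<in> Z"
  by (simp_all add: zt_def functionalD(3))

lemma zt_pu_scale: "pu (scale c a) b - pu a (scale c b) \<in> Z"
  by (simp add: zt_def functionalD(2) mult.commute)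

section \<open>Tensor products of subspaces\<close>

lemma TS_pu: "a \<in> A \<Longrightarrow> b \<in> B \<Longrightarrow> pu a b \<in> TT A B"
  using TS_step[of a A b B 0 scale] TS_zt[of 0 scale] by simp

lemma TS_zero [simp]: "0 \<in> TT A B"
  by (simp add: TS_zt)

lemma TS_add: "s \<in> TT A B \<Longrightarrow> t \<in> TT A B \<Longrightarrow> s + t \<in> TT A B"
proof (induction s rule: TS.induct)
  case (TS_zt s)
  from TS_zt(2,1) show ?case
  proof (induction t rule: TS.induct)
    case (TS_zt t) then show ?case by (intro TS.TS_zt zt_add)
  next
    case (TS_step a b t)
    then have "pu a b + (s + t) \<in> TT A B" by (intro TS.TS_step)
    then show ?case by (simp add: algebra_simps)
  qed
next
  case (TS_step a b s)
  then have "pu a b + (s + t) \<in> TT A B" by (intro TS.TS_step)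
  then show ?case by (simp add: algebra_simps)
qed

lemma TS_cong: "t \<in> TT A B \<Longrightarrow> s - t \<in> Z \<Longrightarrow> s \<in> TT A B"
  using TS_add[OF TS_zt[of "s - t" scale A B], of t] by simp

lemma TS_uminus:
  assumes A: "subspace A" and "t \<in> TT A B" shows "- t \<in> TT A B"
  using assms(2)
proof (induction t rule: TS.induct)
  case (TS_zt t) then show ?case by (intro TS.TS_zt zt_uminus)
next
  case (TS_step a b t)
  have "- pu a b - pu (- a) b \<in> Z"
    by (simp add: zt_def functionalD(4))
  moreover have "pu (- a) b \<in> TT A B" using A TS_step by (intro TS_pu subspace_neg)
  ultimately have "- pu a b \<in> TT A B" using TS_cong by blast
  then have "- pu a b + - t \<in> TT A B" using TS_step by (intro TS_add)
  then show ?case by simp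
qed

lemma TS_diff: "subspace A \<Longrightarrow> s \<in> TT A B \<Longrightarrow> t \<in> TT A B \<Longrightarrow> s - t \<in> TT A B"
  using TS_add[of s A B "- t"] TS_uminus by simp

lemma TS_mono: "t \<in> TT A B \<Longrightarrow> A \<subseteq> A' \<Longrightarrow> B \<subseteq> B' \<Longrightarrow> t \<in> TT A' B'"
  by (induction rule: TS.induct) (auto intro: TS.intros)

lemma TS_single:
  assumes "subspace A" "a \<in> A" "b \<in> B" shows "Poly_Mapping.single (PM a b) c \<in> TT A B"
  using assms TS_cong[OF TS_pu zt_single] by (simp add: subspace_scale)

lemma TS_mult:
  assumes "s \<in> TT A B" "t \<in> TT C D"
    and AC: "\<And>a c. a \<in> A \<Longrightarrow> c \<in> C \<Longrightarrow> a * c \<in> E"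
    and BD: "\<And>b d. b \<in> B \<Longrightarrow> d \<in> D \<Longrightarrow> b * d \<in> F"
  shows "s * t \<in> TT E F"
  using assms(1)
proof (induction s rule: TS.induct)
  case (TS_zt s) then show ?case by (intro TS.TS_zt zt_mult_right)
next
  case (TS_step a b s)
  have "pu a b * t \<in> TT E F" using assms(2)
  proof (induction t rule: TS.induct)
    case (TS_zt t) then show ?case by (intro TS.TS_zt zt_mult_left)
  next
    case (TS_step c d t)
    then have "pu (a * c) (b * d) + pu a b * t \<in> TT E F"
      using \<open>a \<in> A\<close> \<open>b \<in> B\<close> AC BD by (intro TS.TS_step) auto
    then show ?case by (simp add: distrib_left)
  qed
  then show ?case using TS_step by (simp add: distrib_right TS_add)
qed

lemma sl_in:
  assumes B: "subspace B" and "fnl f" and "t \<in> TT A B" shows "SL f t \<in> B"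
  using assms(3)
  by (induction rule: TS.induct) (use B \<open>fnl f\<close> in \<open>auto simp: zt_def subspace_0 subspace_add subspace_scale\<close>)

lemma sr_in:
  assumes A: "subspace A" and "fnl f" and "t \<in> TT A B" shows "SR f t \<in> A"
  using assms(3)
  by (induction rule: TS.induct) (use A \<open>fnl f\<close> in \<open>auto simp: zt_iff_sr subspace_0 subspace_add subspace_scale\<close>)

lemma sl_eq_0:
  assumes "fnl f" "\<And>a. a \<in> A \<Longrightarrow> f a = 0" and "t \<in> TT A B" shows "SL f t = 0"
  using assms(3) by (induction rule: TS.induct) (use assms(1,2) in \<open>auto simp: zt_def\<close>)

lemma fnl_representation:
  assumes "independent E" "span E = UNIV"
  shows "fnl (\<lambda>x. representation E x e)"
  using assms by (simp add: functional_def representation_add representation_scale)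

text \<open>Expand the left factors in a basis adapted to \<open>A\<close>: the coefficients of the basis vectors
  outside \<open>A\<close> vanish, since all right slices lie in \<open>A\<close>.\<close>

lemma tensor_expand:
  assumes A: "subspace A" and t: "\<And>g. fnl g \<Longrightarrow> SR g t \<in> A"
  obtains E e where "finite E" "E \<subseteq> A" "\<And>x. x \<in> E \<Longrightarrow> fnl (e x)"
    "t - (\<Sum>x\<in>E. pu x (SL (e x) t)) \<in> Z"
proof -
  obtain B0 where B0: "B0 \<subseteq> A" "independent B0" "A \<subseteq> span B0"
    using basis_exists[of A] by metis
  define B where "B = extend_basis B0"
  have B: "B0 \<subseteq> B" "independent B" "span B = UNIV"
    unfolding B_def using extend_basis_superset[OF B0(2)] independent_extend_basis[OF B0(2)] span_extend_basis[OF B0(2)] by simp_all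
  define e where "e b x = representation B x b" for b x
  have e: "fnl (e b)" for b unfolding e_def using fnl_representation[OF B(2,3)] .
  define E where "E = (\<Union>p\<in>Poly_Mapping.keys t. {b. representation B (pfst p) b \<noteq> 0})"
  have finE: "finite E" unfolding E_def using finite_representation by auto
  have EB: "E \<subseteq> B" unfolding E_def using representation_ne_zero by blast
  have expand: "pfst p = (\<Sum>b\<in>E. scale (e b (pfst p)) b)" if "p \<in> Poly_Mapping.keys t" for p
  proof -
    have "pfst p = (\<Sum>b | representation B (pfst p) b \<noteq> 0. scale (representation B (pfst p) b) b)"
      using sum_nonzero_representation_eq[OF B(2), of "pfst p"] B(3) by simp
    also have "\<dots> = (\<Sum>b\<in>E. scale (e b (pfst p)) b)"
      using that finE unfolding e_def E_def by (intro sum.mono_neutral_left) auto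
    finally show ?thesis .
  qed
  have main: "t - (\<Sum>x\<in>E. pu x (SL (e x) t)) \<in> Z"
    unfolding zt_def
  proof (intro CollectI allI impI)
    fix f assume f: "fnl f"
    have "SL f t = (\<Sum>p\<in>Poly_Mapping.keys t. \<Sum>b\<in>E. scale (Poly_Mapping.lookup t p) (scale (f b) (scale (e b (pfst p)) (psnd p))))"
      unfolding sl_def lin_ext_def
    proof (rule sum.cong)
      fix p assume p: "p \<in> Poly_Mapping.keys t"
      have "f (pfst p) = (\<Sum>b\<in>E. e b (pfst p) * f b)"
        by (subst expand[OF p]) (simp add: functional_sum[OF f] functionalD(2)[OF f])
      then show "scale (Poly_Mapping.lookup t p) (scale (f (pfst p)) (psnd p)) =
        (\<Sum>b\<in>E. scale (Poly_Mapping.lookup t p) (scale (f b) (scale (e b (pfst p)) (psnd p))))"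
        by (simp add: scale_sum_left scale_sum_right mult_ac)
    qed simp
    also have "\<dots> = (\<Sum>b\<in>E. scale (f b) (SL (e b) t))"
      unfolding sl_def lin_ext_def
      by (subst sum.swap) (simp add: scale_sum_right mult_ac)
    also have "\<dots> = SL f (\<Sum>x\<in>E. pu x (SL (e x) t))"
      using finE by (induction E) auto
    finally show "SL f (t - (\<Sum>x\<in>E. pu x (SL (e x) t))) = 0" by simp
  qed
  have out: "SL (e b) t = 0" if "b \<in> E" "b \<notin> A" for b
  proof (rule fnl_eqI)
    fix g assume g: "fnl g"
    have "e b a = 0" if "a \<in> span B0" for a
    proof -
      have "representation B a = representation B0 a"
        by (rule representation_extend[OF B(2) that B(1)])
      moreover have "b \<notin> B0" using \<open>b \<notin> A\<close> B0 by auto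
      ultimately show ?thesis unfolding e_def using representation_ne_zero[of B0 a b] by auto
    qed
    then have "e b (SR g t) = 0" using t[OF g] B0(3) by auto
    then show "g (SL (e b) t) = g 0" using fnl_sl_sr[OF e g, of b t] by (simp add: functionalD(3)[OF g])
  qed
  have "(\<Sum>x\<in>E. pu x (SL (e x) t)) - (\<Sum>x\<in>E \<inter> A. pu x (SL (e x) t)) = (\<Sum>x\<in>E - A. pu x (SL (e x) t))"
    using finE by (subst sum.Int_Diff[of E _ A]) auto
  also have "\<dots> \<in> Z"
  proof -
    have "(\<Sum>x\<in>D. pu x (SL (e x) t)) \<in> Z" if "finite D" "D \<subseteq> E - A" for D
      using that by (induction D) (auto intro!: zt_add simp: out zt_pu_zero)
    then show ?thesis using finE by blast
  qed
  finally have "t - (\<Sum>x\<in>E \<inter> A. pu x (SL (e x) t)) \<in> Z"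
    using zt_add[OF main] by fastforce
  then show thesis using that[of "E \<inter> A" e] finE e by auto
qed

lemma TS_sum: "(\<And>i. i \<in> I \<Longrightarrow> h i \<in> TT A B) \<Longrightarrow> sum h I \<in> TT A B"
  by (induction I rule: infinite_finite_induct) (auto intro: TS_add)

text \<open>This amounts to \<open>(A \<otimes> H) \<inter> (H \<otimes> B) = A \<otimes> B\<close>
  over a field: in the expansion of \<open>tensor_expand\<close> the left factors lie in
  \<open>A\<close> and the right factors are slices.\<close>

lemma TS_memI:
  assumes A: "subspace A" and "\<And>g. fnl g \<Longrightarrow> SR g t \<in> A" "\<And>f. fnl f \<Longrightarrow> SL f t \<in> B"
  shows "t \<in> TT A B"
proof -
  obtain E e where E: "finite E" "E \<subseteq> A" "\<And>x. x \<in> E \<Longrightarrow> fnl (e x)"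
    "t - (\<Sum>x\<in>E. pu x (SL (e x) t)) \<in> Z"
    by (rule tensor_expand[OF A assms(2)]) auto
  have "(\<Sum>x\<in>E. pu x (SL (e x) t)) \<in> TT A B"
    using E assms(3) by (intro TS_sum TS_pu) auto
  then show ?thesis using E(4) TS_cong by blast
qed

text \<open>A tensor outside \<open>H \<otimes> B\<close> is thereby exposed by a single functional,
  which is how degrees in \<open>H \<otimes> H\<close> are turned into degrees of elements of
  \<open>H\<close>.\<close>

lemma TS_UNIV_iff:
  assumes B: "subspace B"
  shows "t \<in> TT UNIV B \<longleftrightarrow> (\<forall>f. fnl f \<longrightarrow> SL f t \<in> B)"
  using TS_memI[of UNIV t B] sl_in[OF B] by (auto simp: subspace_UNIV)

end

section \<open>Degrees in Ore extensions\<close>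

text \<open>Degrees with respect to \<open>X\<close> modulo an ideal \<open>I\<close>: \<open>G n\<close> consists of the elements of degree less
  than \<open>n\<close>. With \<open>I = 0\<close> this covers an Ore extension of \<open>R\<close> in \<open>H\<close>, with \<open>I = zt\<close> and variable
  \<open>1 \<otimes> X\<close> the corresponding extension of \<open>H \<otimes> R\<close>.\<close>

locale degree_filtration =
  fixes I R :: "'a::ring_1 set" and G :: "nat \<Rightarrow> 'a set" and X :: 'a
  assumes G_0: "G 0 = I" and G_1: "G (Suc 0) = R"
    and I_left: "x \<in> I \<Longrightarrow> a * x \<in> I" and I_right: "x \<in> I \<Longrightarrow> x * a \<in> I"
    and G_zero: "0 \<in> G n" and G_diff: "x \<in> G n \<Longrightarrow> y \<in> G n \<Longrightarrow> x - y \<in> G n"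
    and G_Suc: "G n \<subseteq> G (Suc n)"
    and R_G: "r \<in> R \<Longrightarrow> x \<in> G n \<Longrightarrow> r * x \<in> G n"
    and G_X: "x \<in> G n \<Longrightarrow> x * X \<in> G (Suc n)"
    and leading: "x \<in> G (Suc n) \<Longrightarrow> \<exists>r\<in>R. x - r * X ^ n \<in> G n"
    and free: "r \<in> R \<Longrightarrow> r * X ^ n \<in> G n \<Longrightarrow> r \<in> I"
    and twist: "r \<in> R \<Longrightarrow> \<exists>r'\<in>R. X * r - r' * X \<in> R \<and> (r' \<in> I \<longrightarrow> r \<in> I)"
    and prime: "x \<in> R \<Longrightarrow> y \<in> R \<Longrightarrow> x * y \<in> I \<Longrightarrow> x \<in> I \<or> y \<in> I"
begin

lemma G_mono: "m \<le> n \<Longrightarrow> G m \<subseteq> G n"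
  by (rule lift_Suc_mono_le[of G]) (use G_Suc in auto)

lemma G_add: "x \<in> G n \<Longrightarrow> y \<in> G n \<Longrightarrow> x + y \<in> G n"
  using G_diff[of x n "0 - y"] G_diff[of 0 n y] G_zero by simp

lemma G_X_power: "x \<in> G n \<Longrightarrow> x * X ^ q \<in> G (n + q)"
  by (induction q) (auto dest: G_X simp: power_Suc2 simp flip: mult.assoc simp del: power_Suc)

lemma R_X_power: "r \<in> R \<Longrightarrow> r * X ^ q \<in> G (Suc q)"
  using G_X_power[of r "Suc 0" q] by (simp add: G_1)

lemma X_G: "x \<in> G n \<Longrightarrow> X * x \<in> G (Suc n)"
proof (induction n arbitrary: x)
  case 0
  then show ?case using G_0 I_left G_Suc by blast
next
  case (Suc n)
  obtain r where r: "r \<in> R" "x - r * X ^ n \<in> G n" using leading[OF Suc.prems] by blast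
  obtain r' where r': "r' \<in> R" "X * r - r' * X \<in> R" using twist[OF r(1)] by blast
  have "r' * X ^ Suc n \<in> G (Suc (Suc n))" using R_X_power[OF r'(1)] .
  moreover have "(X * r - r' * X) * X ^ n \<in> G (Suc (Suc n))"
    using R_X_power[OF r'(2), of n] G_Suc by blast
  moreover have "X * (x - r * X ^ n) \<in> G (Suc (Suc n))"
    using Suc.IH[OF r(2)] G_Suc by blast
  moreover have "X * x = r' * X ^ Suc n + (X * r - r' * X) * X ^ n + X * (x - r * X ^ n)"
    by (simp add: algebra_simps)
  ultimately show ?case by (simp only: G_add)
qed

lemma X_power_G: "x \<in> G n \<Longrightarrow> X ^ p * x \<in> G (n + p)"
  by (induction p) (auto dest: X_G simp: mult.assoc)

text \<open>\<open>s'\<close> is the image of \<open>s\<close> under \<open>p\<close> applications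
  of the twist; the implication modulo \<open>I\<close> survives each of them and later keeps
  leading coefficients from vanishing.\<close>

lemma X_power_twist: "s \<in> R \<Longrightarrow> \<exists>s'\<in>R. X ^ p * s - s' * X ^ p \<in> G p \<and> (s' \<in> I \<longrightarrow> s \<in> I)"
proof (induction p)
  case 0
  then show ?case using G_zero[of 0] by (intro bexI[of _ s]) auto
next
  case (Suc p)
  then obtain s1 where s1: "s1 \<in> R" "X ^ p * s - s1 * X ^ p \<in> G p" "s1 \<in> I \<longrightarrow> s \<in> I" by blast
  obtain s2 where s2: "s2 \<in> R" "X * s1 - s2 * X \<in> R" "s2 \<in> I \<longrightarrow> s1 \<in> I" using twist[OF s1(1)] by blast
  have "X ^ Suc p * s - s2 * X ^ Suc p = X * (X ^ p * s - s1 * X ^ p) + (X * s1 - s2 * X) * X ^ p"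
    by (simp add: algebra_simps)
  also have "\<dots> \<in> G (Suc p)" by (intro G_add X_G s1 R_X_power s2)
  finally show ?case using s1 s2 by blast
qed

text \<open>\<open>G m\<close> bounds the degree strictly and \<open>G (Suc q)\<close> weakly, so
  the product has degree below \<open>m + q\<close>. In this lopsided form the induction on
  \<open>m\<close> starts with \<open>x\<close> in the ideal \<open>I\<close>.\<close>

lemma G_mult: "x \<in> G m \<Longrightarrow> y \<in> G (Suc q) \<Longrightarrow> x * y \<in> G (m + q)"
proof (induction m arbitrary: x)
  case 0
  then show ?case using G_0 I_right[of x y] G_mono[of 0 q] by auto
next
  case (Suc m)
  obtain r where r: "r \<in> R" "x - r * X ^ m \<in> G m" using leading[OF Suc.prems(1)] by blast
  have "r * (X ^ m * y) \<in> G (Suc (m + q))"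
    using R_G[OF r(1) X_power_G[OF Suc.prems(2), of m]] by (simp add: add.commute)
  moreover have "(x - r * X ^ m) * y \<in> G (Suc (m + q))" using Suc.IH[OF r(2) Suc.prems(2)] G_Suc by blast
  moreover have "x * y = r * (X ^ m * y) + (x - r * X ^ m) * y" by (simp add: algebra_simps)
  ultimately show ?case by (simp add: G_add)
qed

text \<open>The leading coefficient of the product is \<open>r * s'\<close>, with \<open>s'\<close>
  the twist of \<open>s\<close> past \<open>X ^ p\<close>; it is not in \<open>I\<close> since
  \<open>r\<close> and \<open>s'\<close> are not and \<open>I\<close> is prime on
  \<open>R\<close>.\<close>

lemma degree_mult:
  assumes x: "x \<in> G (Suc p)" "x \<notin> G p" and y: "y \<in> G (Suc q)" "y \<notin> G q"
  shows "x * y \<in> G (Suc (p + q))" "x * y \<notin> G (p + q)"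
proof -
  show "x * y \<in> G (Suc (p + q))" using G_mult[OF x(1) y(1)] by simp
  have nI: "r \<notin> I" if "z \<notin> G n" "z - r * X ^ n \<in> G n" for z r n
  proof
    assume "r \<in> I"
    then have "r * X ^ n \<in> G n" using I_right G_0 G_mono[of 0 n] by blast
    then show False using G_add[OF that(2)] that(1) by fastforce
  qed
  obtain r where r: "r \<in> R" "x - r * X ^ p \<in> G p" using leading[OF x(1)] by blast
  obtain s where s: "s \<in> R" "y - s * X ^ q \<in> G q" using leading[OF y(1)] by blast
  obtain s' where s': "s' \<in> R" "X ^ p * s - s' * X ^ p \<in> G p" "s' \<in> I \<longrightarrow> s \<in> I"
    using X_power_twist[OF s(1)] by blast
  show "x * y \<notin> G (p + q)"
  proof
    assume *: "x * y \<in> G (p + q)"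
    have 1: "r * (X ^ p * (y - s * X ^ q)) \<in> G (p + q)"
      using R_G[OF r(1) X_power_G[OF s(2), of p]] by (simp add: add.commute)
    have 2: "(x - r * X ^ p) * y \<in> G (p + q)" using G_mult[OF r(2) y(1)] .
    have 3: "r * ((X ^ p * s - s' * X ^ p) * X ^ q) \<in> G (p + q)"
      using R_G[OF r(1) G_X_power[OF s'(2)]] .
    have "r * s' * X ^ (p + q) = x * y - r * (X ^ p * (y - s * X ^ q)) - (x - r * X ^ p) * y
        - r * ((X ^ p * s - s' * X ^ p) * X ^ q)"
      by (simp add: algebra_simps power_add)
    also have "\<dots> \<in> G (p + q)" using * 1 2 3 by (intro G_diff)
    finally have "r * s' \<in> I"
      using free[of "r * s'" "p + q"] R_G[OF r(1), of s' "Suc 0"] s'(1) G_1 by simp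
    then show False using prime[OF r(1) s'(1)] nI[OF x(2) r(2)] nI[OF y(2) s(2)] s'(3) by blast
  qed
qed

lemma degree_power:
  assumes "x \<in> G (Suc p)" "x \<notin> G p" "1 \<in> R" "1 \<notin> I"
  shows "x ^ n \<in> G (Suc (n * p)) \<and> x ^ n \<notin> G (n * p)"
proof (induction n)
  case 0
  then show ?case using assms G_0 G_1 by simp
next
  case (Suc n)
  then show ?case using degree_mult[OF assms(1,2), of "x ^ n" "n * p"] by simp
qed

lemma exists_degree:
  assumes "x \<in> G n" "x \<notin> I"
  obtains p where "p < n" "x \<in> G (Suc p)" "x \<notin> G p"
proof -
  define m where "m = (LEAST m. x \<in> G m)"
  have m: "x \<in> G m" "m \<le> n" unfolding m_def using assms(1) by (auto intro: LeastI Least_le)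
  have "m \<noteq> 0" using m(1) assms(2) G_0 by metis
  then obtain p where p: "m = Suc p" using not0_implies_Suc by blast
  have "x \<notin> G p" using not_less_Least[of p "\<lambda>m. x \<in> G m"] p m_def by auto
  then show thesis using that[of p] m p by auto
qed

text \<open>Two elements outside \<open>I\<close> have degrees, and these add, so the product has a
  degree as well.\<close>

lemma prime_union:
  assumes "x \<in> G m" "y \<in> G n" "x * y \<in> I"
  shows "x \<in> I \<or> y \<in> I"
proof (rule ccontr)
  assume "\<not> ?thesis"
  then obtain p q where "x \<in> G (Suc p)" "x \<notin> G p" "y \<in> G (Suc q)" "y \<notin> G q"
    using assms exists_degree by metis
  from degree_mult[OF this] show False using assms(3) G_0 G_mono[of 0 "p + q"] by auto
qed

end

context k_algebra
begin

definition prime_set :: "'h set \<Rightarrow> bool" where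
  "prime_set R \<longleftrightarrow> (\<forall>x\<in>R. \<forall>y\<in>R. x * y = 0 \<longrightarrow> x = 0 \<or> y = 0)"

text \<open>Being a domain does not pass to tensor products, so \<open>H \<otimes> R\<close> gets a
  condition of its own next to \<open>prime_set\<close>.\<close>

definition prime_tensor :: "'h set \<Rightarrow> bool" where
  "prime_tensor R \<longleftrightarrow> (\<forall>x\<in>TT UNIV R. \<forall>y\<in>TT UNIV R. x * y \<in> Z \<longrightarrow> x \<in> Z \<or> y \<in> Z)"

lemma subalgebraD:
  assumes "subalgebra scale R"
  shows "subspace R" "0 \<in> R" "1 \<in> R" "x \<in> R \<Longrightarrow> y \<in> R \<Longrightarrow> x + y \<in> R" "x \<in> R \<Longrightarrow> y \<in> R \<Longrightarrow> x - y \<in> R"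
    "x \<in> R \<Longrightarrow> y \<in> R \<Longrightarrow> x * y \<in> R" "x \<in> R \<Longrightarrow> scale c x \<in> R" "x \<in> R \<Longrightarrow> - x \<in> R"
  using assms unfolding subalgebra_def
  by (auto simp: subspace_0 subspace_add subspace_diff subspace_scale subspace_neg)

lemma subalgebra_power: "subalgebra scale R \<Longrightarrow> x \<in> R \<Longrightarrow> x ^ n \<in> R"
  by (induction n) (auto intro: subalgebraD)

end

section \<open>A single Ore extension, and its tensor product with the ambient algebra\<close>

locale ore_step = k_algebra scale for scale :: "'k::field \<Rightarrow> 'h::ring_1 \<Rightarrow> 'h" +
  fixes R B :: "'h set" and X :: 'h and \<sigma> \<delta> :: "'h \<Rightarrow> 'h"
  assumes R: "subalgebra scale R" and B: "subalgebra scale B" and RB: "R \<subseteq> B" and XB: "X \<in> B"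
    and aut: "algebra_automorphism_on scale R \<sigma>" and der: "skew_derivation_on scale R \<sigma> \<delta>"
    and fr: "free_on_powers R B X" and comm: "r \<in> R \<Longrightarrow> X * r = \<sigma> r * X + \<delta> r"
begin

definition "G n = {\<Sum>j<n. c j * X ^ j | c. \<forall>j. c j \<in> R}"

lemmas RD = subalgebraD[OF R]
lemmas BD = subalgebraD[OF B]

lemma GI: "(\<And>j. j < n \<Longrightarrow> c j \<in> R) \<Longrightarrow> (\<Sum>j<n. c j * X ^ j) \<in> G n"
  unfolding G_def
  by (intro CollectI exI[of _ "\<lambda>j. if j < n then c j else 0"]) (auto intro!: sum.cong simp: RD)

lemma GE: "x \<in> G n \<Longrightarrow> \<exists>c. (\<forall>j. c j \<in> R) \<and> x = (\<Sum>j<n. c j * X ^ j)"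
  unfolding G_def by blast

text \<open>Freeness is a uniqueness statement about finitely supported families; here
  \<open>c\<close>, padded with zeros, is compared with the zero family as a second expansion of
  \<open>0\<close>.\<close>

lemma sum_zero_imp:
  assumes c: "\<And>j. j < n \<Longrightarrow> c j \<in> R" and 0: "(\<Sum>j<n. c j * X ^ j) = 0" and "j < n"
  shows "c j = 0"
proof -
  define q where "q = Abs_poly_mapping (\<lambda>j. if j < n then c j else 0)"
  have lq: "Poly_Mapping.lookup q = (\<lambda>j. if j < n then c j else 0)"
    unfolding q_def by (rule Abs_poly_mapping_inverse) (auto intro: finite_subset[of _ "{..<n}"])
  have kq: "Poly_Mapping.keys q \<subseteq> {..<n}" by (auto simp: in_keys_iff lq split: if_splits)
  have "(\<Sum>i\<in>Poly_Mapping.keys q. Poly_Mapping.lookup q i * X ^ i) = (\<Sum>i<n. Poly_Mapping.lookup q i * X ^ i)"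
    using kq by (intro sum.mono_neutral_left) (auto simp: in_keys_iff)
  also have "\<dots> = 0" using 0 by (simp add: lq)
  finally have "(\<forall>i. Poly_Mapping.lookup q i \<in> R) \<and> 0 = (\<Sum>i\<in>Poly_Mapping.keys q. Poly_Mapping.lookup q i * X ^ i)"
    using c by (simp add: lq RD)
  moreover have "(\<forall>i. Poly_Mapping.lookup (0::nat \<Rightarrow>\<^sub>0 'h) i \<in> R) \<and>
      0 = (\<Sum>i\<in>Poly_Mapping.keys (0::nat \<Rightarrow>\<^sub>0 'h). Poly_Mapping.lookup 0 i * X ^ i)"
    by (simp add: RD)
  ultimately have "q = 0"
    using fr BD(2) unfolding free_on_powers_def by blast
  then show ?thesis using lq assms(3) by (metis lookup_zero)
qed

lemma G_subspace: "subspace (G n)"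
proof (rule subspaceI)
  show "0 \<in> G n" using GI[of n "\<lambda>_. 0"] by (simp add: RD)
  show "x + y \<in> G n" if xy: "x \<in> G n" "y \<in> G n" for x y
  proof -
    obtain c where c: "\<And>j. c j \<in> R" "x = (\<Sum>j<n. c j * X ^ j)" using GE[OF xy(1)] by blast
    obtain d where d: "\<And>j. d j \<in> R" "y = (\<Sum>j<n. d j * X ^ j)" using GE[OF xy(2)] by blast
    show ?thesis using GI[of n "\<lambda>j. c j + d j"] c d by (simp add: RD distrib_right sum.distrib)
  qed
  show "scale a x \<in> G n" if "x \<in> G n" for a x
  proof -
    obtain c where c: "\<And>j. c j \<in> R" "x = (\<Sum>j<n. c j * X ^ j)" using GE[OF \<open>x \<in> G n\<close>] by blast
    show ?thesis using GI[of n "\<lambda>j. scale a (c j)"] c by (simp add: RD scale_mult_left scale_sum_right)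
  qed
qed

lemma G0: "G 0 = {0}" using RD(2) by (auto simp: G_def)
lemma G1: "G (Suc 0) = R"
proof
  show "G (Suc 0) \<subseteq> R" using GE by fastforce
  show "R \<subseteq> G (Suc 0)"
  proof
    fix r assume "r \<in> R"
    then show "r \<in> G (Suc 0)" using GI[of "Suc 0" "\<lambda>_. r"] by simp
  qed
qed

lemma G_leading: "x \<in> G (Suc n) \<Longrightarrow> \<exists>r\<in>R. x - r * X ^ n \<in> G n"
proof -
  assume "x \<in> G (Suc n)"
  then obtain c where c: "\<And>j. c j \<in> R" "x = (\<Sum>j<Suc n. c j * X ^ j)" using GE by blast
  then have "x - c n * X ^ n = (\<Sum>j<n. c j * X ^ j)" by simp
  then show ?thesis using GI[of n c] c(1) by metis
qed

lemma B_G: assumes "b \<in> B" shows "\<exists>n. b \<in> G n"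
proof -
  obtain r :: "nat \<Rightarrow>\<^sub>0 'h" where r: "\<And>i. Poly_Mapping.lookup r i \<in> R"
      "b = (\<Sum>i\<in>Poly_Mapping.keys r. Poly_Mapping.lookup r i * X ^ i)"
    using assms fr unfolding free_on_powers_def by (meson ex1_implies_ex)
  obtain n where n: "Poly_Mapping.keys r \<subseteq> {..<n}"
    using finite_nat_iff_bounded[of "Poly_Mapping.keys r"] by auto
  have "b = (\<Sum>i<n. Poly_Mapping.lookup r i * X ^ i)"
    unfolding r(2) using n by (intro sum.mono_neutral_left) (auto simp: in_keys_iff)
  then show ?thesis using GI[of n "Poly_Mapping.lookup r"] r(1) by auto
qed

lemma sg_R: "r \<in> R \<Longrightarrow> \<sigma> r \<in> R" and dl_R: "r \<in> R \<Longrightarrow> \<delta> r \<in> R"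
  using aut der unfolding algebra_automorphism_on_def skew_derivation_on_def bij_betw_def by auto

lemma sg_add: "r \<in> R \<Longrightarrow> s \<in> R \<Longrightarrow> \<sigma> (r + s) = \<sigma> r + \<sigma> s"
  and sg_mult: "r \<in> R \<Longrightarrow> s \<in> R \<Longrightarrow> \<sigma> (r * s) = \<sigma> r * \<sigma> s"
  and sg_scale: "r \<in> R \<Longrightarrow> \<sigma> (scale c r) = scale c (\<sigma> r)"
  and sg_one: "\<sigma> 1 = 1" and sg_bij: "bij_betw \<sigma> R R"
  using aut unfolding algebra_automorphism_on_def by auto

lemma sg_0: "\<sigma> 0 = 0" using sg_add[of 0 0] RD(2) by simp

lemma sg_inj: "r \<in> R \<Longrightarrow> \<sigma> r = 0 \<Longrightarrow> r = 0"
  using sg_bij sg_0 RD(2) unfolding bij_betw_def inj_on_def by metis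

lemma G_Suc_mono: "G n \<subseteq> G (Suc n)"
proof
  fix x assume "x \<in> G n"
  then obtain c where c: "\<And>j. c j \<in> R" "x = (\<Sum>j<n. c j * X ^ j)" using GE by blast
  then show "x \<in> G (Suc n)" using GI[of "Suc n" "\<lambda>j. if j < n then c j else 0"] by (auto simp: RD)
qed

lemma G_mult_X: assumes "x \<in> G n" shows "x * X \<in> G (Suc n)"
proof -
  obtain c where c: "\<And>j. c j \<in> R" "x = (\<Sum>j<n. c j * X ^ j)" using GE[OF assms] by blast
  have "(\<Sum>j<Suc n. (case j of 0 \<Rightarrow> 0 | Suc i \<Rightarrow> c i) * X ^ j) = x * X"
    unfolding sum.lessThan_Suc_shift c(2)
    by (simp add: sum_distrib_right mult.assoc flip: power_Suc2)
  moreover have "(case j of 0 \<Rightarrow> 0 | Suc i \<Rightarrow> c i) \<in> R" for j using c(1) RD(2) by (cases j) auto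
  ultimately show ?thesis using GI[of "Suc n" "\<lambda>j. case j of 0 \<Rightarrow> 0 | Suc i \<Rightarrow> c i"] by auto
qed

lemma R_mult_G: assumes "r \<in> R" "x \<in> G n" shows "r * x \<in> G n"
proof -
  obtain c where c: "\<And>j. c j \<in> R" "x = (\<Sum>j<n. c j * X ^ j)" using GE[OF assms(2)] by blast
  then show ?thesis using GI[of n "\<lambda>j. r * c j"] assms(1) by (simp add: sum_distrib_left mult.assoc RD)
qed

lemma G_free: assumes "r \<in> R" "r * X ^ n \<in> G n" shows "r = 0"
proof -
  obtain c where c: "\<And>j. c j \<in> R" "r * X ^ n = (\<Sum>j<n. c j * X ^ j)" using GE[OF assms(2)] by blast
  have "(\<Sum>j<Suc n. (if j < n then - c j else r) * X ^ j) = 0"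
    using c(2) by (simp add: sum_negf)
  from sum_zero_imp[OF _ this, of n] show ?thesis using c(1) assms(1) RD by simp
qed

lemma degree_G:
  assumes "prime_set R"
  shows "degree_filtration {0} R G X"
proof
  show "\<exists>r'\<in>R. X * r - r' * X \<in> R \<and> (r' \<in> {0} \<longrightarrow> r \<in> {0})" if "r \<in> R" for r
    using that comm sg_R dl_R sg_inj by (intro bexI[of _ "\<sigma> r"]) auto
qed (use assms G0 G1 G_subspace G_Suc_mono R_mult_G G_mult_X G_leading G_free
   in \<open>auto simp: prime_set_def subspace_0 subspace_diff\<close>)

lemma prime_B: assumes "prime_set R" shows "prime_set B"
  unfolding prime_set_def
proof (intro ballI impI)
  fix x y assume "x \<in> B" "y \<in> B" "x * y = 0"
  then show "x = 0 \<or> y = 0"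
    using degree_filtration.prime_union[OF degree_G[OF assms]] B_G by (metis singleton_iff)
qed

lemma tensor_leading:
  assumes "t \<in> TT UNIV (G (Suc n))"
  shows "\<exists>r\<in>TT UNIV R. t - r * pu 1 X ^ n \<in> TT UNIV (G n)"
  using assms
proof (induction rule: TS.induct)
  case (TS_zt t)
  then show ?case by (intro bexI[of _ 0]) (auto intro: TS.TS_zt)
next
  case (TS_step a b t)
  then obtain r where r: "r \<in> TT UNIV R" "t - r * pu 1 X ^ n \<in> TT UNIV (G n)" by blast
  obtain c where c: "c \<in> R" "b - c * X ^ n \<in> G n" using G_leading[OF TS_step(2)] by blast
  have "pu a b - pu a (c * X ^ n) - pu a (b - c * X ^ n) \<in> Z"
    using zt_pu_add_right[of a "c * X ^ n" "b - c * X ^ n"] by simp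
  then have "pu a b - pu a (c * X ^ n) \<in> TT UNIV (G n)"
    using TS_cong[OF TS_pu] c(2) by blast
  then have "(pu a b - pu a (c * X ^ n)) + (t - r * pu 1 X ^ n) \<in> TT UNIV (G n)"
    using r(2) by (rule TS_add)
  moreover have "(pu a b - pu a (c * X ^ n)) + (t - r * pu 1 X ^ n) = pu a b + t - (pu a c + r) * pu 1 X ^ n"
    by (simp add: distrib_right pu_power)
  moreover have "pu a c + r \<in> TT UNIV R" using c r by (intro TS.TS_step) auto
  ultimately show ?case by metis
qed

text \<open>\<open>t'\<close> stands for \<open>(id \<otimes> \<sigma>) t\<close>. Since
  \<open>\<sigma>\<close> is controlled on \<open>R\<close> alone, \<open>t'\<close> is built along
  the generation of \<open>t\<close>; the clause on slices records enough to conclude later that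
  \<open>t'\<close> in \<open>Z\<close> forces \<open>t\<close> into \<open>Z\<close>.\<close>

lemma tensor_twist:
  assumes "t \<in> TT UNIV R"
  shows "\<exists>t'\<in>TT UNIV R. pu 1 X * t - t' * pu 1 X \<in> TT UNIV R \<and> (\<forall>f. fnl f \<longrightarrow> SL f t' = \<sigma> (SL f t))"
  using assms
proof (induction rule: TS.induct)
  case (TS_zt t)
  then show ?case by (intro bexI[of _ 0]) (auto intro!: TS.TS_zt zt_mult_left simp: zt_def[of scale] sg_0)
next
  case (TS_step a b t)
  then obtain t' where t': "t' \<in> TT UNIV R" "pu 1 X * t - t' * pu 1 X \<in> TT UNIV R"
    "\<And>f. fnl f \<Longrightarrow> SL f t' = \<sigma> (SL f t)" by blast
  have "pu a (\<sigma> b * X + \<delta> b) - pu a (\<sigma> b * X) - pu a (\<delta> b) \<in> Z" by (rule zt_pu_add_right)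
  then have "pu a (X * b) - pu a (\<sigma> b * X) \<in> TT UNIV R"
    using TS_cong[OF TS_pu[of a UNIV "\<delta> b" R]] dl_R[OF TS_step(2)] comm[OF TS_step(2)] by auto
  then have "(pu a (X * b) - pu a (\<sigma> b * X)) + (pu 1 X * t - t' * pu 1 X) \<in> TT UNIV R"
    using t'(2) by (rule TS_add)
  moreover have "(pu a (X * b) - pu a (\<sigma> b * X)) + (pu 1 X * t - t' * pu 1 X)
      = pu 1 X * (pu a b + t) - (pu a (\<sigma> b) + t') * pu 1 X"
    by (simp add: algebra_simps)
  moreover have "pu a (\<sigma> b) + t' \<in> TT UNIV R" using t' sg_R TS_step by (intro TS.TS_step) auto
  moreover have "SL f (pu a (\<sigma> b) + t') = \<sigma> (SL f (pu a b + t))" if "fnl f" for f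
    using t'(3)[OF that] sl_in[OF RD(1) that TS_step(3)] TS_step(2)
    by (simp add: sg_add sg_scale RD)
  ultimately show ?case by metis
qed

text \<open>Freeness and injectivity of the twist are checked slice by slice, where they are those
  of \<open>X\<close> and \<open>\<sigma>\<close> over \<open>R\<close>; vanishing of all slices is
  membership in \<open>Z\<close>.\<close>

lemma degree_tensor:
  assumes "prime_tensor R"
  shows "degree_filtration Z (TT UNIV R) (\<lambda>n. TT UNIV (G n)) (pu 1 X)"
proof
  show "TT UNIV (G 0) = Z"
    by (auto simp: G0 TS_UNIV_iff zt_def)
  show "r \<in> Z" if "r \<in> TT UNIV R" "r * pu 1 X ^ n \<in> TT UNIV (G n)" for r n
    unfolding zt_def
  proof (intro CollectI allI impI)
    fix f assume f: "fnl f"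
    have "SL f (r * pu 1 X ^ n) \<in> G n" by (rule sl_in[OF G_subspace f that(2)])
    then have "SL f r * X ^ n \<in> G n" by (simp add: pu_power sl_mult_pu)
    then show "SL f r = 0" using G_free sl_in[OF RD(1) f that(1)] by blast
  qed
  show "\<exists>r'\<in>TT UNIV R. pu 1 X * r - r' * pu 1 X \<in> TT UNIV R \<and> (r' \<in> Z \<longrightarrow> r \<in> Z)"
    if "r \<in> TT UNIV R" for r
  proof -
    obtain t' where t': "t' \<in> TT UNIV R" "pu 1 X * r - t' * pu 1 X \<in> TT UNIV R"
      "\<And>f. fnl f \<Longrightarrow> SL f t' = \<sigma> (SL f r)" using tensor_twist[OF \<open>r \<in> TT UNIV R\<close>] by blast
    have "r \<in> Z" if "t' \<in> Z"
      using that t'(3) sg_inj sl_in[OF RD(1) _ \<open>r \<in> TT UNIV R\<close>] unfolding zt_def by auto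
    then show ?thesis using t' by blast
  qed
  show "TT UNIV (G n) \<subseteq> TT UNIV (G (Suc n))" for n
    using TS_mono[of _ UNIV "G n" UNIV "G (Suc n)"] G_Suc_mono by blast
  show "r * x \<in> TT UNIV (G n)" if "r \<in> TT UNIV R" "x \<in> TT UNIV (G n)" for r x n
    using TS_mult[OF that] R_mult_G by simp
  show "x * pu 1 X \<in> TT UNIV (G (Suc n))" if "x \<in> TT UNIV (G n)" for x n
    using TS_mult[OF that TS_pu[of 1 UNIV X "{X}"]] G_mult_X by simp
qed (use assms G1 tensor_leading in \<open>auto simp: prime_tensor_def TS_diff subspace_UNIV zt_mult_left zt_mult_right\<close>)

lemma tensor_B_G: assumes "t \<in> TT UNIV B" shows "\<exists>n. t \<in> TT UNIV (G n)"
  using assms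
proof (induction rule: TS.induct)
  case (TS_zt t) then show ?case by (auto intro: TS.TS_zt)
next
  case (TS_step a b t)
  then obtain n where n: "t \<in> TT UNIV (G n)" by blast
  obtain m where m: "b \<in> G m" using B_G TS_step by blast
  have "G m \<subseteq> G (max m n)" "G n \<subseteq> G (max m n)"
    using lift_Suc_mono_le[of G] G_Suc_mono by simp_all
  then have "pu a b + t \<in> TT UNIV (G (max m n))"
    using TS_mono[OF n] m by (intro TS.TS_step) auto
  then show ?case by blast
qed

lemma prime_tensor_B: assumes "prime_tensor R" shows "prime_tensor B"
  unfolding prime_tensor_def
proof (intro ballI impI)
  fix x y assume "x \<in> TT UNIV B" "y \<in> TT UNIV B" "x * y \<in> Z"
  then show "x \<in> Z \<or> y \<in> Z"
    using degree_filtration.prime_union[OF degree_tensor[OF assms]] tensor_B_G by meson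
qed

end

section \<open>Chains of Ore extensions of the field: zero divisors and units\<close>

locale ore_chain = k_algebra scale for scale :: "'k::field \<Rightarrow> 'h::ring_1 \<Rightarrow> 'h" +
  fixes N :: nat and K :: "nat \<Rightarrow> 'h set" and X :: "nat \<Rightarrow> 'h" and sg dl :: "nat \<Rightarrow> 'h \<Rightarrow> 'h"
  assumes K_0: "K 0 = base_field scale" and K_N: "K N = UNIV"
    and ore: "i < N \<Longrightarrow> ore_step scale (K i) (K (Suc i)) (X i) (sg i) (dl i)"
begin

lemma base_subalgebra: "subalgebra scale (base_field scale)"
proof -
  have "subspace (range (\<lambda>c. scale c 1))"
    by (rule subspaceI) (auto simp: image_iff simp flip: scale_left_distrib intro: exI[of _ 0])
  then show ?thesis unfolding subalgebra_def base_field_def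
    by (auto simp: image_iff scale_mult_left intro: exI[of _ 1])
qed

lemma K_subalgebra: "i \<le> N \<Longrightarrow> subalgebra scale (K i)"
  using base_subalgebra K_0 ore_step.B[OF ore] by (cases i) auto

lemmas KD = subalgebraD[OF K_subalgebra]

lemma prime_K: "i \<le> N \<Longrightarrow> prime_set (K i)"
proof (induction i)
  case 0
  show ?case unfolding prime_set_def K_0 base_field_def by (auto simp: scale_mult_left)
next
  case (Suc i)
  then show ?case using ore_step.prime_B[OF ore, of i] by simp
qed

lemma no_zero_divisors: "(x::'h) * y = 0 \<Longrightarrow> x = 0 \<or> y = 0"
  using prime_K[of N] K_N unfolding prime_set_def by auto

lemma pu_in_zt: "pu x 1 \<in> Z \<Longrightarrow> x = 0"
  by (intro fnl_eqI) (auto simp: zt_def functionalD(3))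

lemma TS_base:
  assumes "t \<in> TT UNIV (base_field scale)"
  shows "\<exists>d. t - pu d 1 \<in> Z"
  using assms
proof (induction rule: TS.induct)
  case (TS_zt t)
  then show ?case using zt_diff[OF TS_zt zt_pu_zero(2)] by blast
next
  case (TS_step a b t)
  then obtain d where d: "t - pu d 1 \<in> Z" by blast
  obtain c where c: "b = scale c 1" using TS_step unfolding base_field_def by auto
  have "pu a b - pu (scale c a) 1 \<in> Z" using zt_uminus[OF zt_pu_scale[of c a 1]] c by simp
  moreover have "pu (scale c a) 1 + pu d 1 - pu (scale c a + d) 1 \<in> Z"
    using zt_uminus[OF zt_pu_add_left[of "scale c a" d 1]] by (simp add: algebra_simps)
  ultimately have "(pu a b - pu (scale c a) 1) + (t - pu d 1) + (pu (scale c a) 1 + pu d 1 - pu (scale c a + d) 1) \<in> Z"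
    using d by (intro zt_add)
  then have "pu a b + t - pu (scale c a + d) 1 \<in> Z" by (simp add: algebra_simps)
  then show ?case by blast
qed

lemma zt_mult_cong: "x - x' \<in> Z \<Longrightarrow> y - y' \<in> Z \<Longrightarrow> x * y - x' * y' \<in> Z"
  using zt_add[OF zt_mult_right[of "x - x'" y] zt_mult_left[of "y - y'" x']] by (simp add: algebra_simps)

text \<open>The base case is \<open>H \<otimes> k = H\<close>, so this second climb of the chain
  starts where the first one, \<open>prime_K\<close>, ended: with the whole of \<open>H\<close>
  being a domain.\<close>

lemma prime_tensor_K: "i \<le> N \<Longrightarrow> prime_tensor (K i)"
proof (induction i)
  case 0
  show ?case unfolding prime_tensor_def K_0
  proof (intro ballI impI)
    fix x y assume x: "x \<in> TT UNIV (base_field scale)" and y: "y \<in> TT UNIV (base_field scale)" and xy: "x * y \<in> Z"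
    obtain d e where d: "x - pu d 1 \<in> Z" and e: "y - pu e 1 \<in> Z" using TS_base x y by blast
    have "x * y - pu (d * e) 1 \<in> Z" using zt_mult_cong[OF d e] by simp
    then have "pu (d * e) 1 \<in> Z" using zt_diff[OF xy] by fastforce
    then have "d = 0 \<or> e = 0" using pu_in_zt no_zero_divisors by blast
    then show "x \<in> Z \<or> y \<in> Z"
      using zt_add[OF d zt_pu_zero(2)[of 1]] zt_add[OF e zt_pu_zero(2)[of 1]] by auto
  qed
next
  case (Suc i)
  then show ?case using ore_step.prime_tensor_B[OF ore, of i] by simp
qed

definition "GG i = ore_step.G (K i) (X i)"

lemma degree_K: "i < N \<Longrightarrow> degree_filtration {0} (K i) (GG i) (X i)"
  unfolding GG_def using ore_step.degree_G[OF ore prime_K] by simp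

lemma degree_TK: "i < N \<Longrightarrow> degree_filtration Z (TT UNIV (K i)) (\<lambda>n. TT UNIV (GG i n)) (pu 1 (X i))"
  unfolding GG_def using ore_step.degree_tensor[OF ore prime_tensor_K] by simp

text \<open>The degrees of \<open>x\<close> and \<open>y\<close> in \<open>X i\<close> add up to the
  degree \<open>0\<close> of \<open>1\<close>, so both factors drop from \<open>K (Suc i)\<close> to
  \<open>K i\<close>. The index \<open>N - j\<close> descends, and truncated subtraction makes the
  step trivial once \<open>j\<close> reaches \<open>N\<close>.\<close>

lemma unit_in_base:
  assumes "x * y = 1" shows "x \<in> base_field scale"
proof -
  have "x \<in> K (N - j) \<and> y \<in> K (N - j)" for j
  proof (induction j)
    case 0
    then show ?case using K_N by simp
  next
    case (Suc j)
    show ?case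
    proof (cases "j < N")
      case True
      define i where "i = N - Suc j"
      have i: "i < N" "N - j = Suc i" using True unfolding i_def by auto
      interpret o: ore_step scale "K i" "K (Suc i)" "X i" "sg i" "dl i" by (rule ore[OF i(1)])
      interpret d: degree_filtration "{0}" "K i" "GG i" "X i" by (rule degree_K[OF i(1)])
      have "x \<noteq> 0" "y \<noteq> 0" using assms by auto
      moreover have "\<exists>n. x \<in> GG i n" "\<exists>n. y \<in> GG i n"
        using o.B_G Suc i(2) unfolding GG_def by auto
      ultimately obtain p q where pq: "x \<in> GG i (Suc p)" "x \<notin> GG i p" "y \<in> GG i (Suc q)" "y \<notin> GG i q"
        using d.exists_degree by (metis singletonD)
      have "1 \<notin> GG i (p + q)" using d.degree_mult(2)[OF pq] assms by simp
      then have "p + q = 0" using d.G_mono[of "Suc 0" "p + q"] d.G_1 o.RD(3) by (metis not_less_eq_eq le0 not_gr_zero Suc_leI subsetD)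
      then show ?thesis using pq d.G_1 unfolding i_def by auto
    next
      case False
      then show ?thesis using Suc by simp
    qed
  qed
  from this[of N] show ?thesis using K_0 by simp
qed

end

section \<open>The comultiplication of the Ore variables\<close>

definition swap :: "('h pmon \<Rightarrow>\<^sub>0 'k::zero) \<Rightarrow> ('h pmon \<Rightarrow>\<^sub>0 'k)" where
  "swap = Poly_Mapping.map_key (\<lambda>p. PM (psnd p) (pfst p))"

lemma inj_flip: "inj (\<lambda>p. PM (psnd p) (pfst p))"
  by (rule injI) (metis pmon.expand pmon.sel)

lemma swap_simps [simp]:
  "swap 0 = 0" "swap (s + t) = swap s + swap (t :: _ \<Rightarrow>\<^sub>0 'k::ab_group_add)"
  "swap (Poly_Mapping.single (PM a b) c) = Poly_Mapping.single (PM b a) c"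
proof -
  show "swap 0 = 0" "swap (s + t) = swap s + swap t"
    unfolding swap_def by (intro poly_mapping_eqI; simp add: map_key.rep_eq inj_flip lookup_add)+
  show "swap (Poly_Mapping.single (PM a b) c) = Poly_Mapping.single (PM b a) c"
    unfolding swap_def using map_key_single[OF inj_flip, of "PM b a" c] by simp
qed

lemma swap_minus [simp]: "swap (s - t) = swap s - swap (t :: _ \<Rightarrow>\<^sub>0 'k::ab_group_add)"
  using swap_simps(2)[of "s - t" t] by (simp add: eq_diff_eq)

lemma swap_pu [simp]: "swap (pu a b) = pu b a"
  by (simp add: pu_def)

lemma swap_swap [simp]: "swap (swap t) = (t :: _ \<Rightarrow>\<^sub>0 'k::ab_group_add)"
proof (induction t rule: poly_mapping_add_induct)
  case (add p c t)
  then show ?case by (cases p) simp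
qed simp

lemma swap_mult [simp]:
  "swap (s * t) = swap s * swap (t :: ('h::monoid_mult pmon \<Rightarrow>\<^sub>0 'k::ring_1))"
proof (induction s rule: poly_mapping_add_induct)
  case (add p c s)
  have "swap (Poly_Mapping.single p c * t) = swap (Poly_Mapping.single p c) * swap t"
  proof (induction t rule: poly_mapping_add_induct)
    case (add q d t)
    then show ?case by (cases p; cases q) (simp add: distrib_left mult_single)
  qed simp
  then show ?case using add by (simp add: distrib_right)
qed simp

context k_algebra
begin

lemma sl_swap [simp]: "SL f (swap t) = SR f t"
proof (induction t rule: poly_mapping_add_induct)
  case (add p c t)
  then show ?case by (cases p) simp
qed simp

lemma sr_swap [simp]: "SR f (swap t) = SL f t"
  using sl_swap[of f "swap t"] by simp

lemma swap_zt [simp]: "swap t \<in> Z \<longleftrightarrow> t \<in> Z"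
  unfolding zt_iff_sr[of t] by (simp add: zt_def)

lemma swap_TS: "t \<in> TT A B \<Longrightarrow> swap t \<in> TT B A"
  by (induction rule: TS.induct) (auto intro: TS.intros)

end

lemma left_coefficient_diff:
  fixes a b x p q :: "'a::ring"
  assumes "a * x + p = b * x + q" shows "(b - a) * x = p - q"
proof -
  have "p = b * x + q - a * x" using assms by (simp add: eq_diff_eq add.commute)
  then show ?thesis by (simp add: algebra_simps)
qed

text \<open>What is kept of the Hopf structure is symmetric in the two tensor factors. An antipode
  would not be: the opposite comultiplication has one only if the given antipode is bijective, so
  its consequence \<open>grouplike_unit\<close> stands in for it. \<open>slices_commute\<close> is
  coassociativity with functionals in the outer factors. \<open>D_base\<close> and
  \<open>D_mult\<close> give homogeneity of \<open>\<Delta>\<close>, since a scalar acts as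
  multiplication by a multiple of \<open>1\<close>.\<close>

locale ore_bialgebra = ore_chain scale N K X sg dl
  for scale :: "'k::field \<Rightarrow> 'h::ring_1 \<Rightarrow> 'h" and N K X sg dl +
  fixes \<Delta> :: "'h \<Rightarrow> ('h pmon \<Rightarrow>\<^sub>0 'k)" and \<epsilon> :: "'h \<Rightarrow> 'k"
  assumes D_add: "\<Delta> (x + y) - (\<Delta> x + \<Delta> y) \<in> Z"
    and D_base: "\<Delta> (scale c 1) - pu (scale c 1) 1 \<in> Z"
    and D_mult: "\<Delta> (x * y) - \<Delta> x * \<Delta> y \<in> Z"
    and fnl_eps: "fnl \<epsilon>" and eps_mult: "\<epsilon> (x * y) = \<epsilon> x * \<epsilon> y" and eps_one: "\<epsilon> 1 = 1"
    and eps_left: "SL \<epsilon> (\<Delta> x) = x" and eps_right: "SR \<epsilon> (\<Delta> x) = x"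
    and slices_commute: "fnl f \<Longrightarrow> fnl g \<Longrightarrow> SL f (\<Delta> (SR g (\<Delta> x))) = SR g (\<Delta> (SL f (\<Delta> x)))"
    and grouplike_unit: "\<Delta> d - pu d d \<in> Z \<Longrightarrow> d \<noteq> 0 \<Longrightarrow> \<exists>d'. d * d' = 1"
    and K_coalgebra: "i \<le> N \<Longrightarrow> x \<in> K i \<Longrightarrow> \<Delta> x \<in> TT (K i) (K i)"
begin

text \<open>Results on right tensor factors now have mirror images on left ones: \<open>D_X\<close>
  and \<open>D_left_degree\<close> apply right-handed results to this instance.\<close>

lemma cop: "ore_bialgebra scale N K X sg dl (\<lambda>x. swap (\<Delta> x)) \<epsilon>"
proof unfold_locales
  show "swap (\<Delta> (x + y)) - (swap (\<Delta> x) + swap (\<Delta> y)) \<in> Z" for x y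
    using D_add[of x y] swap_zt[of "\<Delta> (x + y) - (\<Delta> x + \<Delta> y)"] by simp
  show "swap (\<Delta> (x * y)) - swap (\<Delta> x) * swap (\<Delta> y) \<in> Z" for x y
    using D_mult[of x y] swap_zt[of "\<Delta> (x * y) - (\<Delta> x * \<Delta> y)"] by simp
  show "swap (\<Delta> (scale c 1)) - pu (scale c 1) 1 \<in> Z" for c
  proof -
    have "swap (\<Delta> (scale c 1)) - pu 1 (scale c 1) \<in> Z"
      using D_base[of c] swap_zt[of "\<Delta> (scale c 1) - pu (scale c 1) 1"] by simp
    from zt_diff[OF this zt_pu_scale[of c 1 1]] show ?thesis by simp
  qed
  show "\<exists>d'. d * d' = 1" if "swap (\<Delta> d) - pu d d \<in> Z" "d \<noteq> 0" for d
    using grouplike_unit[of d] that swap_zt[of "\<Delta> d - pu d d"] by simp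
  show "swap (\<Delta> x) \<in> TT (K i) (K i)" if "i \<le> N" "x \<in> K i" for i x
    using that K_coalgebra swap_TS by blast
qed (use fnl_eps eps_mult eps_one eps_left eps_right slices_commute in auto)

definition "L f x = SL f (\<Delta> x)"

lemma L_add: "fnl f \<Longrightarrow> L f (x + y) = L f x + L f y"
  using D_add[of x y] unfolding L_def zt_def by (simp add: algebra_simps)

lemma D_scale: "\<Delta> (scale c x) - pu (scale c 1) 1 * \<Delta> x \<in> Z"
proof -
  have "\<Delta> (scale c 1 * x) - \<Delta> (scale c 1) * \<Delta> x \<in> Z" by (rule D_mult)
  moreover have "(\<Delta> (scale c 1) - pu (scale c 1) 1) * \<Delta> x \<in> Z" by (intro zt_mult_right D_base)
  ultimately show ?thesis using zt_add by (fastforce simp: algebra_simps scale_mult_left)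
qed

lemma L_scale: "fnl f \<Longrightarrow> L f (scale c x) = scale c (L f x)"
proof -
  assume f: "fnl f"
  have "SL f (\<Delta> (scale c x)) = SL (\<lambda>y. f (scale c 1 * y)) (\<Delta> x)"
    using D_scale[of c x] f unfolding zt_def by (simp add: sl_pu_mult)
  also have "(\<lambda>y. f (scale c 1 * y)) = (\<lambda>y. c * f y)"
    using functionalD(2)[OF f] by (simp add: scale_mult_left)
  also have "SL (\<lambda>y. c * f y) (\<Delta> x) = scale c (SL f (\<Delta> x))"
    unfolding sl_def by (simp flip: lin_ext_fun_scale)
  finally show ?thesis unfolding L_def .
qed

lemma fnl_L: "fnl f \<Longrightarrow> fnl g \<Longrightarrow> fnl (\<lambda>y. g (L f y))"
  unfolding functional_def[of scale "\<lambda>y. g (L f y)"]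
  by (simp add: L_add L_scale functionalD(1,2))

lemma L_zero: "fnl f \<Longrightarrow> L f 0 = 0"
  using L_scale[of f 0 0] by simp

lemma D_zero: "\<Delta> 0 \<in> Z"
  using L_zero unfolding zt_def L_def by simp

lemma L_eps [simp]: "L \<epsilon> x = x"
  unfolding L_def by (rule eps_left)

lemma D_nonzero: "x \<noteq> 0 \<Longrightarrow> \<Delta> x \<notin> Z"
  using eps_left[of x] fnl_eps unfolding zt_def by auto

text \<open>The functional on the right is the convolution product of \<open>f\<close> and
  \<open>g\<close>: slicing is an action of the dual algebra, which is coassociativity. In
  particular slices of slices of \<open>x\<close> are slices of \<open>x\<close>.\<close>

lemma L_L: assumes f: "fnl f" and g: "fnl g" shows "L g (L f x) = L (\<lambda>y. g (L f y)) x"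
proof (rule fnl_eqI)
  fix k assume k: "fnl k"
  have "k (L g (L f x)) = g (SR k (\<Delta> (L f x)))"
    unfolding L_def by (rule fnl_sl_sr[OF g k])
  also have "\<dots> = g (L f (SR k (\<Delta> x)))"
    unfolding L_def using slices_commute[OF f k] by simp
  also have "\<dots> = k (L (\<lambda>y. g (L f y)) x)"
    unfolding L_def[of "\<lambda>y. g (L f y)"] by (rule fnl_sl_sr[OF fnl_L[OF f g] k, symmetric])
  finally show "k (L g (L f x)) = k (L (\<lambda>y. g (L f y)) x)" .
qed

lemma D_one: "\<Delta> 1 - 1 \<in> Z"
  using D_base[of 1] by simp

lemma D_power: "\<Delta> (x ^ n) - \<Delta> x ^ n \<in> Z"
proof (induction n)
  case 0
  then show ?case using D_one by simp
next
  case (Suc n)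
  have "(\<Delta> (x * x ^ n) - \<Delta> x * \<Delta> (x ^ n)) + \<Delta> x * (\<Delta> (x ^ n) - \<Delta> x ^ n) \<in> Z"
    by (intro zt_add D_mult zt_mult_left Suc)
  then show ?case by (simp add: algebra_simps)
qed

lemma D_expand: "\<Delta> (r * x ^ p + y) - (\<Delta> r * \<Delta> x ^ p + \<Delta> y) \<in> Z"
proof -
  have "(\<Delta> (r * x ^ p + y) - (\<Delta> (r * x ^ p) + \<Delta> y)) + (\<Delta> (r * x ^ p) - \<Delta> r * \<Delta> (x ^ p))
    + \<Delta> r * (\<Delta> (x ^ p) - \<Delta> x ^ p) \<in> Z"
    by (intro zt_add D_add D_mult zt_mult_left D_power)
  then show ?thesis by (simp add: algebra_simps)
qed

section \<open>Right degrees of the comultiplication\<close>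

lemma D_K: "i \<le> N \<Longrightarrow> x \<in> K i \<Longrightarrow> \<Delta> x \<in> TT UNIV (K i)"
  using TS_mono[OF K_coalgebra] by blast

lemma GG_subspace: "i < N \<Longrightarrow> subspace (GG i n)"
  unfolding GG_def using ore_step.G_subspace[OF ore] .

lemma D_degree_le:
  assumes i: "i < N" and q: "\<Delta> (X i) \<in> TT UNIV (GG i (Suc q))" "\<Delta> (X i) \<notin> TT UNIV (GG i q)"
    and "x \<in> GG i (Suc p)"
  shows "\<Delta> x \<in> TT UNIV (GG i (Suc (p * q)))"
  using assms(4)
proof (induction p arbitrary: x)
  case 0
  interpret d: degree_filtration "{0}" "K i" "GG i" "X i" by (rule degree_K[OF i])
  show ?case using 0 d.G_1 D_K[of i x] i by simp
next
  case (Suc p)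
  interpret d: degree_filtration "{0}" "K i" "GG i" "X i" by (rule degree_K[OF i])
  interpret t: degree_filtration Z "TT UNIV (K i)" "\<lambda>n. TT UNIV (GG i n)" "pu 1 (X i)" by (rule degree_TK[OF i])
  have one: "1 \<in> TT UNIV (K i)" "(1 :: 'h pmon \<Rightarrow>\<^sub>0 'k) \<notin> Z"
    using TS_pu[of 1 UNIV 1 "K i"] KD(3)[of i] i pu_in_zt[of 1] by auto
  obtain r where r: "r \<in> K i" "x - r * X i ^ Suc p \<in> GG i (Suc p)" using d.leading[OF Suc.prems] by blast
  have "\<Delta> r * \<Delta> (X i) ^ Suc p \<in> TT UNIV (GG i (Suc (Suc p * q)))"
    using t.R_G D_K[of i r] i r(1) t.degree_power[OF q one, of "Suc p"] by simp
  moreover have "\<Delta> (x - r * X i ^ Suc p) \<in> TT UNIV (GG i (Suc (Suc p * q)))"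
    using Suc.IH[OF r(2)] t.G_mono[of "Suc (p * q)" "Suc (Suc p * q)"] by auto
  ultimately have "\<Delta> r * \<Delta> (X i) ^ Suc p + \<Delta> (x - r * X i ^ Suc p) \<in> TT UNIV (GG i (Suc (Suc p * q)))"
    by (rule TS_add)
  then show ?case using TS_cong[OF _ D_expand[of r "X i" "Suc p" "x - r * X i ^ Suc p"]] by simp
qed

text \<open>The leading coefficient \<open>r\<close> is nonzero, so \<open>\<Delta> r\<close> has
  degree \<open>0\<close> and \<open>\<Delta> r * \<Delta> (X i) ^ p\<close> has degree exactly
  \<open>p * q\<close>. For \<open>p > 0\<close> the remaining terms have degree at most
  \<open>(p - 1) * q\<close>, which is smaller because of \<open>q0\<close>.\<close>

lemma D_degree:
  assumes i: "i < N" and q: "\<Delta> (X i) \<in> TT UNIV (GG i (Suc q))" "\<Delta> (X i) \<notin> TT UNIV (GG i q)"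
    and q0: "q \<ge> 1" and x: "x \<in> GG i (Suc p)" "x \<notin> GG i p"
  shows "\<Delta> x \<notin> TT UNIV (GG i (p * q))"
proof
  assume bad: "\<Delta> x \<in> TT UNIV (GG i (p * q))"
  interpret d: degree_filtration "{0}" "K i" "GG i" "X i" by (rule degree_K[OF i])
  interpret t: degree_filtration Z "TT UNIV (K i)" "\<lambda>n. TT UNIV (GG i n)" "pu 1 (X i)" by (rule degree_TK[OF i])
  have one: "1 \<in> TT UNIV (K i)" "(1 :: 'h pmon \<Rightarrow>\<^sub>0 'k) \<notin> Z"
    using TS_pu[of 1 UNIV 1 "K i"] KD(3)[of i] i pu_in_zt[of 1] by auto
  obtain r where r: "r \<in> K i" "x - r * X i ^ p \<in> GG i p" using d.leading[OF x(1)] by blast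
  have "r \<noteq> 0" using r x(2) by auto
  define y where "y = x - r * X i ^ p"
  have y: "\<Delta> y \<in> TT UNIV (GG i (p * q))"
  proof (cases p)
    case 0
    then have "y = 0" using r d.G_0 unfolding y_def by simp
    then show ?thesis using D_zero TS_zt by auto
  next
    case (Suc p')
    have "Suc (p' * q) \<le> p * q" using Suc q0 by simp
    then show ?thesis using D_degree_le[OF i q, of y p'] r(2) Suc t.G_mono unfolding y_def by blast
  qed
  have "\<Delta> r \<in> TT UNIV (GG i (Suc 0))" "\<Delta> r \<notin> TT UNIV (GG i 0)"
    using D_K[of i r] D_nonzero[OF \<open>r \<noteq> 0\<close>] t.G_0 t.G_1 i r(1) by auto
  then have "\<Delta> r * \<Delta> (X i) ^ p \<notin> TT UNIV (GG i (p * q))"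
    using t.degree_mult(2)[of "\<Delta> r" 0 "\<Delta> (X i) ^ p" "p * q"] t.degree_power[OF q one, of p] by simp
  moreover have "\<Delta> r * \<Delta> (X i) ^ p + \<Delta> y \<in> TT UNIV (GG i (p * q))"
    using TS_cong[OF bad, of "\<Delta> r * \<Delta> (X i) ^ p + \<Delta> y"] D_expand[of r "X i" p y]
    unfolding y_def using zt_uminus by fastforce
  ultimately show False using t.G_diff[OF _ y] by fastforce
qed

text \<open>If \<open>\<Delta> X\<close> has right degree \<open>q\<close>, some slice \<open>c\<close> of it has degree \<open>q\<close> and \<open>\<Delta> c\<close> has right
  degree \<open>q\<^sup>2\<close>; but slices of \<open>c\<close> are again slices of \<open>X\<close>, so \<open>q\<^sup>2 \<le> q\<close>.\<close>

lemma right_degree: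
  assumes i: "i < N"
  shows "\<Delta> (X i) \<in> TT UNIV (GG i (Suc 1))" "\<Delta> (X i) \<notin> TT UNIV (GG i 1)"
proof -
  interpret o: ore_step scale "K i" "K (Suc i)" "X i" "sg i" "dl i" by (rule ore[OF i])
  interpret d: degree_filtration "{0}" "K i" "GG i" "X i" by (rule degree_K[OF i])
  interpret t: degree_filtration Z "TT UNIV (K i)" "\<lambda>n. TT UNIV (GG i n)" "pu 1 (X i)" by (rule degree_TK[OF i])
  have X_K: "X i \<notin> K i"
  proof
    assume "X i \<in> K i"
    then have "1 * X i ^ 1 \<in> GG i 1" using d.G_1 by simp
    then show False using d.free[of 1 1] o.RD(3) by simp
  qed
  then have "X i \<noteq> 0" using o.RD(2) by metis
  moreover have "\<exists>n. \<Delta> (X i) \<in> TT UNIV (GG i n)"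
    using o.tensor_B_G D_K[of "Suc i" "X i"] o.XB i unfolding GG_def by simp
  ultimately obtain q where q: "\<Delta> (X i) \<in> TT UNIV (GG i (Suc q))" "\<Delta> (X i) \<notin> TT UNIV (GG i q)"
    using t.exists_degree D_nonzero by metis
  \<comment> \<open>Otherwise every left slice of \<open>\<Delta> (X i)\<close> would lie in
    \<open>K i\<close>, and the counit slice is \<open>X i\<close> itself.\<close>
  have q0: "q \<ge> 1"
  proof (rule ccontr)
    assume "\<not> q \<ge> 1"
    then have "\<Delta> (X i) \<in> TT UNIV (K i)" using q(1) d.G_1 by (simp add: not_le)
    then show False using X_K sl_in[OF o.RD(1) fnl_eps] eps_left by metis
  qed
  obtain f where f: "fnl f" "L f (X i) \<notin> GG i q"
    using q(2) TS_UNIV_iff[OF GG_subspace[OF i]] unfolding L_def by blast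
  have "L f (X i) \<in> GG i (Suc q)" unfolding L_def by (rule sl_in[OF GG_subspace[OF i] f(1) q(1)])
  then have "\<Delta> (L f (X i)) \<notin> TT UNIV (GG i (q * q))"
    by (rule D_degree[OF i q q0 _ f(2)])
  then obtain g where g: "fnl g" "L g (L f (X i)) \<notin> GG i (q * q)"
    using TS_UNIV_iff[OF GG_subspace[OF i]] unfolding L_def by blast
  have "L g (L f (X i)) \<in> GG i (Suc q)"
    unfolding L_L[OF f(1) g(1)] unfolding L_def[of "\<lambda>y. g (L f y)"]
    by (rule sl_in[OF GG_subspace[OF i] fnl_L[OF f(1) g(1)] q(1)])
  then have "\<not> Suc q \<le> q * q" using g(2) d.G_mono by blast
  then have "q = 1" using q0 by (cases q; cases "q - 1") auto
  then show "\<Delta> (X i) \<in> TT UNIV (GG i (Suc 1))" "\<Delta> (X i) \<notin> TT UNIV (GG i 1)" using q by auto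
qed

text \<open>By coassociativity the coefficient \<open>D\<close> of \<open>1 \<otimes> X\<close> in \<open>\<Delta> X\<close> satisfies
  \<open>(\<Delta> \<otimes> id) D = (id \<otimes> \<Delta>) D \<cdot> (1 \<otimes> D)\<close>. Comparing degrees in the lower variables gives
  \<open>D = u \<otimes> 1\<close>; then \<open>u\<close> is grouplike, hence a unit, hence a scalar, hence 1.\<close>

lemma D_X_right:
  assumes i: "i < N"
  shows "\<Delta> (X i) - pu 1 (X i) \<in> TT UNIV (K i)"
proof -
  interpret o: ore_step scale "K i" "K (Suc i)" "X i" "sg i" "dl i" by (rule ore[OF i])
  interpret d: degree_filtration "{0}" "K i" "GG i" "X i" by (rule degree_K[OF i])
  interpret t: degree_filtration Z "TT UNIV (K i)" "\<lambda>n. TT UNIV (GG i n)" "pu 1 (X i)" by (rule degree_TK[OF i])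
  obtain D where D: "D \<in> TT UNIV (K i)" "\<Delta> (X i) - D * pu 1 (X i) \<in> TT UNIV (K i)"
    using t.leading[OF right_degree(1)[OF i, unfolded One_nat_def]] t.G_1 by auto
  define D0 where "D0 = \<Delta> (X i) - D * pu 1 (X i)"
  have D_nz: "D \<notin> Z"
  proof
    assume "D \<in> Z"
    then have "D * pu 1 (X i) + D0 \<in> TT UNIV (K i)" using D(2) unfolding D0_def
      by (intro TS_add[OF TS_zt[OF zt_mult_right]])
    then show False using right_degree(2)[OF i] t.G_1 unfolding D0_def by simp
  qed
  \<comment> \<open>The announced identity, evaluated by \<open>f \<otimes> g \<otimes> id\<close>.
    Both sides are the coefficient of \<open>X i\<close> in \<open>L g (L f (X i))\<close>: the left
    one by \<open>L_L\<close>, the right one by expanding \<open>\<Delta>\<close> of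
    \<open>L f (X i)\<close>.\<close>
  have key: "SL (\<lambda>y. g (L f y)) D = SL g (\<Delta> (SL f D) * D)" if f: "fnl f" and g: "fnl g" for f g
  proof -
    have LX: "L h (X i) = SL h D * X i + SL h D0" for h
      unfolding L_def D0_def by (simp add: sl_mult_pu)
    define c where "c = SL f D"
    define e where "e = SL f D0"
    have c: "c \<in> K i" and e: "e \<in> K i"
      unfolding c_def e_def D0_def by (rule sl_in[OF o.RD(1) f D(1)], rule sl_in[OF o.RD(1) f D(2)])
    have "\<Delta> (c * X i + e) - (\<Delta> c * (D * pu 1 (X i) + D0) + \<Delta> e) \<in> Z"
      using D_expand[of c "X i" 1 e] unfolding D0_def by simp
    then have "L g (c * X i + e) = SL g (\<Delta> c * D * pu 1 (X i)) + SL g (\<Delta> c * D0 + \<Delta> e)"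
      using g unfolding L_def zt_def by (simp add: algebra_simps)
    then have 1: "L g (L f (X i)) = SL g (\<Delta> c * D) * X i + SL g (\<Delta> c * D0 + \<Delta> e)"
      unfolding LX[of f] c_def e_def by (simp add: sl_mult_pu)
    have 2: "L g (L f (X i)) = SL (\<lambda>y. g (L f y)) D * X i + SL (\<lambda>y. g (L f y)) D0"
      unfolding L_L[OF f g] by (rule LX)
    have cD: "\<Delta> c * D \<in> TT UNIV (K i)" "\<Delta> c * D0 + \<Delta> e \<in> TT UNIV (K i)"
      using TS_mult[OF D_K[of i c] D(1)] TS_mult[OF D_K[of i c] D(2)] D_K[of i e] c e i o.RD(6)
      unfolding D0_def by (auto intro!: TS_add)
    have in_K: "SL g (\<Delta> c * D) \<in> K i" "SL g (\<Delta> c * D0 + \<Delta> e) \<in> K i"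
      "SL (\<lambda>y. g (L f y)) D \<in> K i" "SL (\<lambda>y. g (L f y)) D0 \<in> K i"
      by (rule sl_in[OF o.RD(1)]; use g fnl_L[OF f g] cD D in \<open>simp only: D0_def\<close>)+
    have "(SL (\<lambda>y. g (L f y)) D - SL g (\<Delta> c * D)) * X i ^ 1
        = SL g (\<Delta> c * D0 + \<Delta> e) - SL (\<lambda>y. g (L f y)) D0"
      using trans[OF 1[symmetric] 2] by (simp only: left_coefficient_diff power_one_right)
    also have "\<dots> \<in> GG i 1" using d.G_1 in_K o.RD(5) by auto
    finally show ?thesis using d.free[of "SL (\<lambda>y. g (L f y)) D - SL g (\<Delta> c * D)" 1] in_K o.RD(5)
      unfolding c_def by auto
  qed
  have "D \<in> TT UNIV (K (i - j))" for j
  proof (induction j)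
    case 0
    then show ?case using D by simp
  next
    case (Suc j)
    show ?case
    proof (cases "j < i")
      case True
      define m where "m = i - Suc j"
      have m: "m < N" "i - j = Suc m" using True i unfolding m_def by auto
      interpret o': ore_step scale "K m" "K (Suc m)" "X m" "sg m" "dl m" by (rule ore[OF m(1)])
      interpret d': degree_filtration "{0}" "K m" "GG m" "X m" by (rule degree_K[OF m(1)])
      interpret t': degree_filtration Z "TT UNIV (K m)" "\<lambda>n. TT UNIV (GG m n)" "pu 1 (X m)" by (rule degree_TK[OF m(1)])
      have "\<exists>n. D \<in> TT UNIV (GG m n)" using o'.tensor_B_G Suc m(2) unfolding GG_def by simp
      then obtain p where p: "D \<in> TT UNIV (GG m (Suc p))" "D \<notin> TT UNIV (GG m p)"
        using t'.exists_degree D_nz by metis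
      \<comment> \<open>For \<open>p > 0\<close> the right side of \<open>key\<close> would have
        degree \<open>p + p\<close> for a suitable \<open>g\<close>: \<open>p\<close> from
        \<open>\<Delta>\<close> of a slice of degree \<open>p\<close>, because
        \<open>right_degree\<close> holds for \<open>X m\<close> too, and \<open>p\<close> from
        \<open>D\<close>. The left side is a slice of \<open>D\<close>, of degree at most
        \<open>p\<close>.\<close>
      have "p = 0"
      proof (rule ccontr)
        assume "p \<noteq> 0"
        obtain f where f: "fnl f" "SL f D \<notin> GG m p"
          using p(2) TS_UNIV_iff[OF GG_subspace[OF m(1)]] by blast
        have c: "SL f D \<in> GG m (Suc p)" by (rule sl_in[OF GG_subspace[OF m(1)] f(1) p(1)])
        have "\<Delta> (SL f D) \<in> TT UNIV (GG m (Suc p))" "\<Delta> (SL f D) \<notin> TT UNIV (GG m p)"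
          using D_degree_le[OF m(1) right_degree[OF m(1)] c] D_degree[OF m(1) right_degree[OF m(1)] _ c f(2)]
          by simp_all
        then have "\<Delta> (SL f D) * D \<notin> TT UNIV (GG m (p + p))"
          using t'.degree_mult(2) p by blast
        then obtain g where g: "fnl g" "SL g (\<Delta> (SL f D) * D) \<notin> GG m (p + p)"
          using TS_UNIV_iff[OF GG_subspace[OF m(1)]] by blast
        have "SL (\<lambda>y. g (L f y)) D \<in> GG m (Suc p)"
          by (rule sl_in[OF GG_subspace[OF m(1)] fnl_L[OF f(1) g(1)] p(1)])
        then have "SL g (\<Delta> (SL f D) * D) \<in> GG m (p + p)"
          using key[OF f(1) g(1)] d'.G_mono[of "Suc p" "p + p"] \<open>p \<noteq> 0\<close> by auto
        then show False using g(2) by simp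
      qed
      then show ?thesis using p(1) t'.G_1 unfolding m_def by simp
    next
      case False
      then show ?thesis using Suc by simp
    qed
  qed
  from this[of i] have "D \<in> TT UNIV (base_field scale)" using K_0 by simp
  then obtain u where u: "D - pu u 1 \<in> Z" using TS_base by blast
  have SL_D: "SL f D = scale (f u) 1" if "fnl f" for f
    using u that unfolding zt_def by simp
  have grp: "g (L f u) = f u * g u" if f: "fnl f" and g: "fnl g" for f g
  proof -
    have "\<Delta> (scale (f u) 1) * D - pu (scale (f u) 1) 1 * pu u 1 \<in> Z"
      by (rule zt_mult_cong[OF D_base u])
    then have "SL g (\<Delta> (SL f D) * D) = scale (f u * g u) 1"
      using g SL_D[OF f] functionalD(2)[OF g] unfolding zt_def by (simp add: scale_mult_left)
    then have "scale (g (L f u)) 1 = scale (f u * g u) 1"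
      using key[OF f g] SL_D[OF fnl_L[OF f g]] by simp
    then show ?thesis by simp
  qed
  have "\<Delta> u - pu u u \<in> Z"
    unfolding zt_def
  proof (intro CollectI allI impI)
    fix f assume f: "fnl f"
    have "SL f (\<Delta> u) = scale (f u) u"
      by (rule fnl_eqI) (use grp[OF f] in \<open>simp add: L_def functionalD(2)[of scale]\<close>)
    then show "SL f (\<Delta> u - pu u u) = 0" by simp
  qed
  moreover have "u \<noteq> 0" using u D_nz zt_pu_zero(2)[of 1] zt_add by fastforce
  ultimately have "u \<in> base_field scale" using grouplike_unit unit_in_base by blast
  then obtain c where c: "u = scale c 1" unfolding base_field_def by auto
  \<comment> \<open>A grouplike scalar is idempotent: evaluating \<open>grp\<close> at the counit
    gives \<open>c = c * c\<close>.\<close>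
  have "\<epsilon> u = c" unfolding c using functionalD(2)[OF fnl_eps] eps_one by simp
  then have "c = c * c" using grp[OF fnl_eps fnl_eps] by simp
  moreover have "c \<noteq> 0" using \<open>u \<noteq> 0\<close> c by auto
  ultimately have "u = 1" using c by simp
  have "D * pu 1 (X i) - pu 1 1 * pu 1 (X i) \<in> Z"
    using zt_mult_cong[OF u, of "pu 1 (X i)" "pu 1 (X i)"] \<open>u = 1\<close> by simp
  then have "(D * pu 1 (X i) - pu 1 (X i)) + D0 \<in> TT UNIV (K i)"
    using D(2) unfolding D0_def by (intro TS_add[OF TS_zt]) simp_all
  then show ?thesis unfolding D0_def by simp
qed

text \<open>\<open>D_X_right\<close> and its mirror image place the difference in
  \<open>H \<otimes> K i\<close> and in \<open>K i \<otimes> H\<close>, and \<open>TS_memI\<close>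
  intersects the two. In each half one of the two subtracted tensors already belongs to the space,
  as \<open>1\<close> is in \<open>K i\<close>.\<close>

lemma D_X:
  assumes i: "i < N"
  shows "\<Delta> (X i) - pu (X i) 1 - pu 1 (X i) \<in> TT (K i) (K i)"
proof -
  interpret c: ore_bialgebra scale N K X sg dl "\<lambda>x. swap (\<Delta> x)" \<epsilon> by (rule cop)
  have Ki: "subspace (K i)" "1 \<in> K i" using KD[of i] i by auto
  let ?w = "\<Delta> (X i) - pu (X i) 1 - pu 1 (X i)"
  have 1: "?w \<in> TT UNIV (K i)"
    using TS_diff[OF subspace_UNIV D_X_right[OF i] TS_pu[of "X i" UNIV 1 "K i"]] Ki
    by (simp add: algebra_simps)
  have "swap ?w \<in> TT UNIV (K i)"
    using TS_diff[OF subspace_UNIV c.D_X_right[OF i] TS_pu[of "X i" UNIV 1 "K i"]] Ki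
    by (simp add: algebra_simps)
  then have 2: "?w \<in> TT (K i) UNIV" using swap_TS[of "swap ?w"] by simp
  show ?thesis
    by (rule TS_memI[OF Ki(1)]) (use sr_in[OF Ki(1) _ 2] sl_in[OF Ki(1) _ 1] in auto)
qed

end

section \<open>One step of the chain of coideal subalgebras\<close>

text \<open>Expansions over an initial segment are easier to produce by induction on the degree than
  finitely supported families. Padding with zeros gives existence, and the difference of two
  families gives uniqueness.\<close>

lemma free_on_powersI:
  fixes R B :: "'h::ring_1 set"
  assumes R0: "0 \<in> R" and R_diff: "\<And>x y. x \<in> R \<Longrightarrow> y \<in> R \<Longrightarrow> x - y \<in> R"
    and ex: "\<And>b. b \<in> B \<Longrightarrow> \<exists>n c. (\<forall>j<n. c j \<in> R) \<and> b = (\<Sum>j<n. c j * X ^ j)"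
    and uniq: "\<And>n c. (\<And>j. j < n \<Longrightarrow> c j \<in> R) \<Longrightarrow> (\<Sum>j<n. c j * X ^ j) = 0 \<Longrightarrow> (\<And>j. j < n \<Longrightarrow> c j = 0)"
  shows "free_on_powers R B X"
  unfolding free_on_powers_def
proof
  fix b assume "b \<in> B"
  have sum_keys: "(\<Sum>i\<in>Poly_Mapping.keys q. Poly_Mapping.lookup q i * X ^ i) = (\<Sum>i<m. Poly_Mapping.lookup q i * X ^ i)"
    if "Poly_Mapping.keys q \<subseteq> {..<m}" for q :: "nat \<Rightarrow>\<^sub>0 'h" and m
    using that by (intro sum.mono_neutral_left) (auto simp: in_keys_iff)
  show "\<exists>!r. (\<forall>i. Poly_Mapping.lookup r i \<in> R) \<and> b = (\<Sum>i\<in>Poly_Mapping.keys r. Poly_Mapping.lookup r i * X ^ i)"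
  proof (rule ex_ex1I)
    obtain n c where c: "\<forall>j<n. c j \<in> R" "b = (\<Sum>j<n. c j * X ^ j)" using ex[OF \<open>b \<in> B\<close>] by blast
    define q where "q = Abs_poly_mapping (\<lambda>j. if j < n then c j else 0)"
    have lq: "Poly_Mapping.lookup q = (\<lambda>j. if j < n then c j else 0)"
      unfolding q_def by (rule Abs_poly_mapping_inverse) (auto intro: finite_subset[of _ "{..<n}"])
    have "Poly_Mapping.keys q \<subseteq> {..<n}" by (auto simp: in_keys_iff lq split: if_splits)
    from sum_keys[OF this] have "b = (\<Sum>i\<in>Poly_Mapping.keys q. Poly_Mapping.lookup q i * X ^ i)"
      using c(2) by (simp add: lq)
    then show "\<exists>r. (\<forall>i. Poly_Mapping.lookup r i \<in> R) \<and> b = (\<Sum>i\<in>Poly_Mapping.keys r. Poly_Mapping.lookup r i * X ^ i)"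
      using c(1) R0 lq by (intro exI[of _ q]) auto
  next
    fix q r :: "nat \<Rightarrow>\<^sub>0 'h"
    assume q: "(\<forall>i. Poly_Mapping.lookup q i \<in> R) \<and> b = (\<Sum>i\<in>Poly_Mapping.keys q. Poly_Mapping.lookup q i * X ^ i)"
      and r: "(\<forall>i. Poly_Mapping.lookup r i \<in> R) \<and> b = (\<Sum>i\<in>Poly_Mapping.keys r. Poly_Mapping.lookup r i * X ^ i)"
    obtain m where m: "Poly_Mapping.keys q \<union> Poly_Mapping.keys r \<subseteq> {..<m}"
      using finite_nat_iff_bounded[of "Poly_Mapping.keys q \<union> Poly_Mapping.keys r"] by auto
    have "(\<Sum>i<m. (Poly_Mapping.lookup q i - Poly_Mapping.lookup r i) * X ^ i) = b - b"
      using q r sum_keys[of q m] sum_keys[of r m] m by (simp add: left_diff_distrib sum_subtractf)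
    then have *: "Poly_Mapping.lookup q i - Poly_Mapping.lookup r i = 0" if "i < m" for i
      using uniq[of m "\<lambda>i. Poly_Mapping.lookup q i - Poly_Mapping.lookup r i" i] q r R_diff that by simp
    show "q = r"
    proof (rule poly_mapping_eqI)
      fix i
      show "Poly_Mapping.lookup q i = Poly_Mapping.lookup r i"
      proof (cases "i < m")
        case True
        then show ?thesis using *[of i] by simp
      next
        case False
        then have "i \<notin> Poly_Mapping.keys q" "i \<notin> Poly_Mapping.keys r" using m by auto
        then show ?thesis by (simp add: in_keys_iff)
      qed
    qed
  qed
qed

context k_algebra
begin

lemma sl_agree:
  assumes "fnl f" "fnl g" "\<And>a. a \<in> A \<Longrightarrow> f a = g a" "t \<in> TT A B"
  shows "SL f t = SL g t"
  using assms(4) by (induction rule: TS.induct) (use assms(1-3) in \<open>auto simp: zt_def\<close>)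

end

section \<open>Leading and subleading coefficients as slices\<close>

context ore_bialgebra
begin

text \<open>Stability under slices expresses \<open>\<Delta> A \<subseteq> H \<otimes> A\<close>;
  read with the flipped comultiplication it is the right-hand condition, so one notion serves
  both.\<close>

definition coideal :: "'h set \<Rightarrow> bool" where
  "coideal A \<longleftrightarrow> subalgebra scale A \<and> (\<forall>f x. fnl f \<longrightarrow> x \<in> A \<longrightarrow> L f x \<in> A)"

lemma D_left_degree:
  assumes i: "i < N" and "y \<in> GG i n"
  shows "\<Delta> y \<in> TT (GG i n) UNIV"
proof -
  interpret c: ore_bialgebra scale N K X sg dl "\<lambda>x. swap (\<Delta> x)" \<epsilon> by (rule cop)
  interpret d: degree_filtration "{0}" "K i" "GG i" "X i" by (rule degree_K[OF i])
  show ?thesis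
  proof (cases n)
    case 0
    then show ?thesis using D_zero TS_zt d.G_0 assms(2) by auto
  next
    case (Suc p)
    then have "swap (\<Delta> y) \<in> TT UNIV (GG i n)"
      using c.D_degree_le[OF i c.right_degree[OF i], of y p] assms(2) by simp
    from swap_TS[OF this] show ?thesis by simp
  qed
qed

text \<open>To a functional reading off the coefficient in left degree \<open>n\<close>, tensors
  such as \<open>v\<close> are invisible, and those such as \<open>u\<close> contribute elements of
  \<open>K i\<close>; so two terms of the power are kept exactly. The factor \<open>Suc n\<close>
  counts the positions of \<open>1 \<otimes> X\<close>.\<close>

lemma D_X_power:
  assumes i: "i < N"
  shows "\<exists>u v. u \<in> TT (GG i (Suc n)) (K i) \<and> v \<in> TT (GG i n) UNIV \<and>
    \<Delta> (X i) ^ Suc n = pu (X i ^ Suc n) 1 + pu (X i ^ n) (of_nat (Suc n) * X i) + u + v"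
proof (induction n)
  case 0
  interpret d: degree_filtration "{0}" "K i" "GG i" "X i" by (rule degree_K[OF i])
  show ?case
    using D_X[OF i] d.G_1 by (intro exI[of _ "\<Delta> (X i) - pu (X i) 1 - pu 1 (X i)"] exI[of _ 0]) simp
next
  case (Suc n)
  interpret o: ore_step scale "K i" "K (Suc i)" "X i" "sg i" "dl i" by (rule ore[OF i])
  interpret d: degree_filtration "{0}" "K i" "GG i" "X i" by (rule degree_K[OF i])
  define x where "x = X i"
  define c :: 'h where "c = of_nat (Suc n)"
  define w where "w = \<Delta> (X i) - pu (X i) 1 - pu 1 (X i)"
  have w: "w \<in> TT (K i) (K i)" unfolding w_def by (rule D_X[OF i])
  have Dx: "\<Delta> x = pu x 1 + pu 1 x + w" unfolding w_def x_def by simp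
  obtain u v where u: "u \<in> TT (GG i (Suc n)) (K i)" and v: "v \<in> TT (GG i n) UNIV"
    and eq: "\<Delta> x ^ Suc n = pu (x ^ Suc n) 1 + pu (x ^ n) (c * x) + u + v"
    using Suc.IH unfolding x_def c_def by blast
  have xG: "x ^ n \<in> GG i (Suc n)" "x ^ Suc n \<in> GG i (Suc (Suc n))"
    using d.R_X_power[OF o.RD(3), of n] d.R_X_power[OF o.RD(3), of "Suc n"] unfolding x_def by simp_all
  \<comment> \<open>\<open>pu\<close> is additive only modulo \<open>Z\<close>: \<open>z\<close> is
    the error in merging the two tensors with left factor \<open>x ^ Suc n\<close>, whose right
    factors \<open>c * x\<close> and \<open>x\<close> add up to the next multiple of
    \<open>x\<close>.\<close>
  define z :: "'h pmon \<Rightarrow>\<^sub>0 'k" where "z = pu (x ^ Suc n) (c * x) + pu (x ^ Suc n) x - pu (x ^ Suc n) (of_nat (Suc (Suc n)) * x)"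
  have "z = - (pu (x ^ Suc n) (c * x + x) - pu (x ^ Suc n) (c * x) - pu (x ^ Suc n) x)"
    unfolding z_def c_def by (simp add: algebra_simps)
  then have z: "z \<in> Z" using zt_uminus[OF zt_pu_add_right] by simp
  define u' where "u' = z + (pu x 1 * u + w * pu (x ^ Suc n) 1 + w * u)"
  define v' where "v' = pu x 1 * v + pu (x ^ n) (x * (c * x)) + pu 1 x * u + pu 1 x * v
    + w * pu (x ^ n) (c * x) + w * v"
  have R_G_Suc: "r * y \<in> GG i (Suc m)" if "r \<in> K i" "y \<in> GG i m" for r y m
    using d.R_G[OF that] d.G_Suc[of m] by (rule subsetD[rotated])
  have "u' \<in> TT (GG i (Suc (Suc n))) (K i)"
    unfolding u'_def
  proof (intro TS_add)
    show "z \<in> TT (GG i (Suc (Suc n))) (K i)" using z by (rule TS_zt)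
    show "pu x 1 * u \<in> TT (GG i (Suc (Suc n))) (K i)"
      by (rule TS_mult[OF TS_pu[of x "{x}" 1 "{1}"] u]) (auto simp: x_def d.X_G)
    show "w * pu (x ^ Suc n) 1 \<in> TT (GG i (Suc (Suc n))) (K i)"
      by (rule TS_mult[OF w TS_pu[of "x ^ Suc n" "GG i (Suc (Suc n))" 1 "{1}"]])
         (use xG d.R_G in auto)
    show "w * u \<in> TT (GG i (Suc (Suc n))) (K i)"
      by (rule TS_mult[OF w u]) (simp_all add: R_G_Suc o.RD(6))
  qed
  moreover have "v' \<in> TT (GG i (Suc n)) UNIV"
    unfolding v'_def
  proof (intro TS_add)
    show "pu x 1 * v \<in> TT (GG i (Suc n)) UNIV"
      by (rule TS_mult[OF TS_pu[of x "{x}" 1 UNIV] v]) (auto simp: x_def d.X_G)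
    show "pu (x ^ n) (x * (c * x)) \<in> TT (GG i (Suc n)) UNIV" using xG by (intro TS_pu) auto
    show "pu 1 x * u \<in> TT (GG i (Suc n)) UNIV"
      by (rule TS_mult[OF TS_pu[of 1 "{1}" x UNIV] u]) auto
    show "pu 1 x * v \<in> TT (GG i (Suc n)) UNIV"
      by (rule TS_mult[OF TS_pu[of 1 "{1}" x UNIV] v]) (use d.G_Suc in auto)
    show "w * pu (x ^ n) (c * x) \<in> TT (GG i (Suc n)) UNIV"
      by (rule TS_mult[OF w TS_pu[of "x ^ n" "GG i (Suc n)" "c * x" UNIV]]) (use xG d.R_G in auto)
    show "w * v \<in> TT (GG i (Suc n)) UNIV"
      by (rule TS_mult[OF w v]) (simp_all add: R_G_Suc)
  qed
  moreover have "\<Delta> x ^ Suc (Suc n) = (pu x 1 + pu 1 x + w) * (pu (x ^ Suc n) 1 + pu (x ^ n) (c * x) + u + v)"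
    using eq Dx by (metis power_Suc)
  moreover have "\<dots> = pu (x ^ Suc (Suc n)) 1 + pu (x ^ Suc n) (of_nat (Suc (Suc n)) * x) + u' + v'"
    unfolding u'_def v'_def z_def by (simp add: distrib_left distrib_right)
  ultimately show ?case unfolding x_def by metis
qed

text \<open>This is \<open>g\<close> applied to the coefficient of \<open>X i ^ n\<close>. The
  conditions fix \<open>f\<close> up to degree \<open>n\<close> and leave higher degrees open, so
  existence is a matter of extending a functional from a subspace.\<close>

definition coeff_fnl :: "nat \<Rightarrow> nat \<Rightarrow> ('h \<Rightarrow> 'k) \<Rightarrow> ('h \<Rightarrow> 'k) \<Rightarrow> bool" where
  "coeff_fnl i n g f \<longleftrightarrow> fnl f \<and> (\<forall>y\<in>GG i n. f y = 0) \<and> (\<forall>s\<in>K i. f (s * X i ^ n) = g s)"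

lemma coeff_fnl_exists:
  assumes i: "i < N" and g: "fnl g"
  shows "\<exists>f. coeff_fnl i n g f"
proof -
  interpret o: ore_step scale "K i" "K (Suc i)" "X i" "sg i" "dl i" by (rule ore[OF i])
  interpret d: degree_filtration "{0}" "K i" "GG i" "X i" by (rule degree_K[OF i])
  \<comment> \<open>By freeness at most one \<open>s\<close> fits; outside
    \<open>GG i (Suc n)\<close> none need exist, which \<open>fnl_extend\<close> tolerates.\<close>
  define h where "h y = g (THE s. s \<in> K i \<and> y - s * X i ^ n \<in> GG i n)" for y
  have h: "h y = g s" if s: "s \<in> K i" "y - s * X i ^ n \<in> GG i n" for y s
  proof -
    have "(THE s. s \<in> K i \<and> y - s * X i ^ n \<in> GG i n) = s"
    proof (rule the_equality)
      fix t assume t: "t \<in> K i \<and> y - t * X i ^ n \<in> GG i n"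
      have "(t - s) * X i ^ n = (y - s * X i ^ n) - (y - t * X i ^ n)" by (simp add: algebra_simps)
      also have "\<dots> \<in> GG i n" using s t d.G_diff by blast
      finally show "t = s" using d.free[of "t - s" n] s t o.RD(5) by auto
    qed (use s in blast)
    then show ?thesis unfolding h_def by simp
  qed
  have "\<exists>f. fnl f \<and> (\<forall>x\<in>GG i (Suc n). f x = h x)"
  proof (rule fnl_extend[OF GG_subspace[OF i]])
    fix x y assume "x \<in> GG i (Suc n)" "y \<in> GG i (Suc n)"
    then obtain s t where st: "s \<in> K i" "x - s * X i ^ n \<in> GG i n" "t \<in> K i" "y - t * X i ^ n \<in> GG i n"
      using d.leading by metis
    then have "x + y - (s + t) * X i ^ n \<in> GG i n"
      using d.G_add[OF st(2,4)] by (simp add: algebra_simps)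
    then show "h (x + y) = h x + h y"
      using h[of "s + t" "x + y"] h st o.RD(4) functionalD(1)[OF g] by simp
  next
    fix c x assume "x \<in> GG i (Suc n)"
    then obtain s where s: "s \<in> K i" "x - s * X i ^ n \<in> GG i n" using d.leading by metis
    have "scale c (x - s * X i ^ n) \<in> GG i n" by (rule subspace_scale[OF GG_subspace[OF i] s(2)])
    then have "scale c x - scale c s * X i ^ n \<in> GG i n"
      by (simp add: scale_right_diff_distrib scale_mult_left)
    then show "h (scale c x) = c * h x"
      using h[of "scale c s" "scale c x"] h s o.RD(7) functionalD(2)[OF g] by simp
  qed
  then obtain f where f: "fnl f" "\<And>x. x \<in> GG i (Suc n) \<Longrightarrow> f x = h x" by blast
  have "f y = 0" if "y \<in> GG i n" for y
    using f(2)[of y] h[of 0 y] that d.G_Suc o.RD(2) functionalD(3)[OF g] by auto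
  moreover have "f (s * X i ^ n) = g s" if "s \<in> K i" for s
    using f(2)[OF d.R_X_power[OF that]] h[OF that, of "s * X i ^ n"] d.G_zero by simp
  ultimately show ?thesis using f(1) unfolding coeff_fnl_def by blast
qed

lemma coeff_fnlD:
  assumes "coeff_fnl i n g f"
  shows "fnl f" "y \<in> GG i n \<Longrightarrow> f y = 0" "s \<in> K i \<Longrightarrow> f (s * X i ^ n) = g s"
  using assms unfolding coeff_fnl_def by auto

lemma sl_coeff:
  assumes i: "i < N" and g: "fnl g" and f: "coeff_fnl i n g f" and s: "s \<in> K i"
  shows "SL f (\<Delta> s * pu (X i ^ n) b) = L g s * b"
proof -
  have "SL (\<lambda>y. f (y * X i ^ n)) (\<Delta> s) = SL g (\<Delta> s)"
    by (rule sl_agree[OF fnl_mult_right[OF coeff_fnlD(1)[OF f]] g coeff_fnlD(3)[OF f] K_coalgebra])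
       (use i s in auto)
  then show ?thesis unfolding L_def by (simp add: sl_mult_pu)
qed

lemma L_leading:
  assumes i: "i < N" and g: "fnl g" and f: "coeff_fnl i n g f" and s: "s \<in> K i" and y: "y \<in> GG i n"
  shows "L f (s * X i ^ n + y) = L g s"
proof -
  interpret d: degree_filtration "{0}" "K i" "GG i" "X i" by (rule degree_K[OF i])
  note fD = coeff_fnlD[OF f]
  have Ds: "\<Delta> s \<in> TT (K i) UNIV" using TS_mono[OF K_coalgebra[of i s]] i s by simp
  have "SL f (\<Delta> s * \<Delta> (X i) ^ n) = L g s"
  proof (cases n)
    case 0
    then show ?thesis using sl_coeff[OF i g f s, of 1] by simp
  next
    case (Suc k)
    obtain u v where u: "u \<in> TT (GG i (Suc k)) (K i)" and v: "v \<in> TT (GG i k) UNIV"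
      and eq: "\<Delta> (X i) ^ n = pu (X i ^ n) 1 + pu (X i ^ k) (of_nat n * X i) + u + v"
      using D_X_power[OF i, of k] Suc by blast
    have "1 \<in> K i" using KD(3) i by simp
    then have "pu (X i ^ k) (of_nat n * X i) \<in> TT (GG i n) UNIV"
      using d.R_X_power[of 1 k] Suc by (intro TS_pu) auto
    moreover have "u \<in> TT (GG i n) UNIV" "v \<in> TT (GG i n) UNIV"
      using TS_mono[OF u] TS_mono[OF v] d.G_Suc[of k] Suc by auto
    ultimately have "pu (X i ^ k) (of_nat n * X i) + u + v \<in> TT (GG i n) UNIV" by (intro TS_add)
    then have "\<Delta> s * (pu (X i ^ k) (of_nat n * X i) + u + v) \<in> TT (GG i n) UNIV"
      by (rule TS_mult[OF Ds]) (auto intro: d.R_G)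
    then have "SL f (\<Delta> s * (pu (X i ^ k) (of_nat n * X i) + u + v)) = 0"
      using sl_eq_0[OF fD(1)] fD(2) by blast
    moreover have "\<Delta> s * \<Delta> (X i) ^ n = \<Delta> s * pu (X i ^ n) 1 + \<Delta> s * (pu (X i ^ k) (of_nat n * X i) + u + v)"
      unfolding eq by (simp add: algebra_simps)
    ultimately show ?thesis using sl_coeff[OF i g f s, of 1] by simp
  qed
  moreover have "SL f (\<Delta> y) = 0"
    using sl_eq_0[OF fD(1)] fD(2) D_left_degree[OF i y] by blast
  moreover have "L f (s * X i ^ n + y) = SL f (\<Delta> s * \<Delta> (X i) ^ n) + SL f (\<Delta> y)"
    using D_expand[of s "X i" n y] fD(1) unfolding L_def zt_def by simp
  ultimately show ?thesis by simp
qed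

text \<open>The term of the power with left factor \<open>X i ^ n\<close> supplies the multiple of
  \<open>X i\<close>; all other contributions are slices of tensors with right factors in
  \<open>K i\<close>, or vanish under \<open>f\<close>.\<close>

lemma L_subleading:
  assumes i: "i < N" and f: "coeff_fnl i n \<epsilon> f" and r: "r \<in> K i" and y: "y \<in> GG i (Suc n)"
  shows "L f (r * X i ^ Suc n + y) - r * (of_nat (Suc n) * X i) \<in> K i"
proof -
  interpret o: ore_step scale "K i" "K (Suc i)" "X i" "sg i" "dl i" by (rule ore[OF i])
  interpret d: degree_filtration "{0}" "K i" "GG i" "X i" by (rule degree_K[OF i])
  note fD = coeff_fnlD[OF f]
  obtain u v where u: "u \<in> TT (GG i (Suc n)) (K i)" and v: "v \<in> TT (GG i n) UNIV"
    and eq: "\<Delta> (X i) ^ Suc n = pu (X i ^ Suc n) 1 + pu (X i ^ n) (of_nat (Suc n) * X i) + u + v"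
    using D_X_power[OF i, of n] by blast
  obtain s where s: "s \<in> K i" "y - s * X i ^ n \<in> GG i n" using d.leading[OF y] by blast
  have "L f y = s"
    using L_leading[OF i fnl_eps f s] by simp
  have Dr: "\<Delta> r \<in> TT (K i) (K i)" using K_coalgebra i r by simp
  have "\<Delta> r * v \<in> TT (GG i n) UNIV"
    by (rule TS_mult[OF Dr v]) (auto intro: d.R_G)
  then have 1: "SL f (\<Delta> r * v) = 0" using sl_eq_0[OF fD(1)] fD(2) by blast
  have 2: "SL f (\<Delta> r * u) \<in> K i"
    by (rule sl_in[OF o.RD(1) fD(1) TS_mult[OF Dr u, where E = UNIV and F = "K i"]]) (auto intro: o.RD)
  \<comment> \<open>\<open>f\<close> is not controlled in degree \<open>Suc n\<close>, but whatever
    its values there, the right factors stay in \<open>K i\<close>.\<close>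
  have 3: "SL f (\<Delta> r * pu (X i ^ Suc n) 1) \<in> K i"
    by (rule sl_in[OF o.RD(1) fD(1) TS_mult[OF Dr TS_pu[of _ UNIV 1 "K i"], where E = UNIV and F = "K i"]]) (auto intro: o.RD)
  have "L f (r * X i ^ Suc n + y) = SL f (\<Delta> r * \<Delta> (X i) ^ Suc n) + L f y"
    using D_expand[of r "X i" "Suc n" y] fD(1) unfolding L_def zt_def by simp
  also have "\<dots> = SL f (\<Delta> r * pu (X i ^ Suc n) 1) + r * (of_nat (Suc n) * X i)
      + SL f (\<Delta> r * u) + SL f (\<Delta> r * v) + s"
    unfolding eq distrib_left sl_simps sl_coeff[OF i fnl_eps f r] L_eps \<open>L f y = s\<close> ..
  finally have "L f (r * X i ^ Suc n + y) - r * (of_nat (Suc n) * X i)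
      = SL f (\<Delta> r * pu (X i ^ Suc n) 1) + SL f (\<Delta> r * u) + s"
    using 1 by simp
  then show ?thesis using 2 3 s(1) o.RD(4) by simp
qed

text \<open>Compare the coefficients of \<open>X \<otimes> 1\<close> in \<open>\<Delta> (X r) = \<Delta> (\<sigma> r X + \<delta> r)\<close>.\<close>

lemma L_sigma:
  assumes i: "i < N" and g: "fnl g" and h: "fnl h" and gh: "\<And>y. y \<in> K i \<Longrightarrow> h y = g (sg i y)"
    and r: "r \<in> K i"
  shows "L g (sg i r) = L h r"
proof -
  interpret o: ore_step scale "K i" "K (Suc i)" "X i" "sg i" "dl i" by (rule ore[OF i])
  interpret d: degree_filtration "{0}" "K i" "GG i" "X i" by (rule degree_K[OF i])
  obtain f where f: "coeff_fnl i 1 g f" using coeff_fnl_exists[OF i g] by blast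
  note fD = coeff_fnlD[OF f]
  have f0: "f y = 0" if "y \<in> K i" for y using fD(2) that d.G_1 by simp
  define w where "w = \<Delta> (X i) - pu (X i) 1 - pu 1 (X i)"
  have w: "w \<in> TT (K i) (K i)" unfolding w_def by (rule D_X[OF i])
  have Dr: "\<Delta> r \<in> TT (K i) (K i)" using K_coalgebra i r by simp
  have "L f (X i * r) = L g (sg i r)"
    using L_leading[OF i g f o.sg_R[OF r], of "dl i r"] d.G_1 o.dl_R[OF r] o.comm[OF r] by simp
  moreover have "L f (X i * r) = L h r"
  proof -
    have "L f (X i * r) = SL f (\<Delta> (X i) * \<Delta> r)"
      using D_mult[of "X i" r] fD(1) unfolding L_def zt_def by simp
    also have "\<Delta> (X i) * \<Delta> r = pu (X i) 1 * \<Delta> r + pu 1 (X i) * \<Delta> r + w * \<Delta> r"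
      unfolding w_def by (simp add: algebra_simps)
    also have "SL f \<dots> = SL (\<lambda>y. f (X i * y)) (\<Delta> r) + X i * SL (\<lambda>y. f (1 * y)) (\<Delta> r) + SL f (w * \<Delta> r)"
      by (simp add: sl_pu_mult)
    also have "SL (\<lambda>y. f (1 * y)) (\<Delta> r) = 0"
      using sl_eq_0[OF fD(1) f0 Dr] by simp
    also have "SL f (w * \<Delta> r) = 0"
      by (rule sl_eq_0[OF fD(1) f0 TS_mult[OF w Dr, where E = "K i" and F = UNIV]]) (auto intro: o.RD)
    also have "SL (\<lambda>y. f (X i * y)) (\<Delta> r) = SL h (\<Delta> r)"
    proof (rule sl_agree[OF fnl_mult_left[OF fD(1)] h _ Dr])
      fix y assume y: "y \<in> K i"
      have "f (X i * y) = f (sg i y * X i ^ 1) + f (dl i y)"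
        unfolding o.comm[OF y] by (simp add: functionalD(1)[OF fD(1)])
      then show "f (X i * y) = h y" using fD(3) o.sg_R[OF y] gh[OF y] f0 o.dl_R[OF y] by simp
    qed
    finally show ?thesis unfolding L_def by simp
  qed
  ultimately show ?thesis by simp
qed

lemma fnl_on_K:
  assumes i: "i < N" and g: "fnl g"
    and \<tau>: "\<And>x y. x \<in> K i \<Longrightarrow> y \<in> K i \<Longrightarrow> \<tau> (x + y) = \<tau> x + \<tau> y"
      "\<And>c x. x \<in> K i \<Longrightarrow> \<tau> (scale c x) = scale c (\<tau> x)"
  shows "\<exists>h. fnl h \<and> (\<forall>y\<in>K i. h y = g (\<tau> y))"
  by (rule fnl_extend) (use KD(1) i \<tau> functionalD(1,2)[OF g] in auto)

lemma sigma_eq_L: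
  assumes i: "i < N"
  shows "\<exists>h. fnl h \<and> (\<forall>r\<in>K i. sg i r = L h r)"
proof -
  interpret o: ore_step scale "K i" "K (Suc i)" "X i" "sg i" "dl i" by (rule ore[OF i])
  obtain h where h: "fnl h" "\<forall>y\<in>K i. h y = \<epsilon> (sg i y)"
    using fnl_on_K[OF i fnl_eps, of "sg i"] o.sg_add o.sg_scale by blast
  then show ?thesis using L_sigma[OF i fnl_eps h(1)] by fastforce
qed

text \<open>\<open>L_sigma\<close> is applied with \<open>g\<close> an extension of
  \<open>\<epsilon>\<close> after the inverse twist and with \<open>\<epsilon>\<close> in the place
  of \<open>h\<close>; its right-hand side is then \<open>L \<epsilon> r = r\<close>.\<close>

lemma sigma_inverse_eq_L:
  assumes i: "i < N"
  shows "\<exists>h. fnl h \<and> (\<forall>r\<in>K i. r = L h (sg i r))"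
proof -
  interpret o: ore_step scale "K i" "K (Suc i)" "X i" "sg i" "dl i" by (rule ore[OF i])
  define \<tau> where "\<tau> = inv_into (K i) (sg i)"
  have \<tau>: "\<tau> (sg i y) = y" if "y \<in> K i" for y
    unfolding \<tau>_def using o.sg_bij that by (simp add: bij_betw_inv_into_left)
  have ex: "\<exists>z\<in>K i. y = sg i z" if "y \<in> K i" for y
    using o.sg_bij that unfolding bij_betw_def by auto
  have "\<exists>h. fnl h \<and> (\<forall>y\<in>K i. h y = \<epsilon> (\<tau> y))"
  proof (rule fnl_on_K[OF i fnl_eps])
    fix x y assume "x \<in> K i" "y \<in> K i"
    then show "\<tau> (x + y) = \<tau> x + \<tau> y"
      using ex[of x] ex[of y] by (metis \<tau> o.sg_add o.RD(4))
  next
    fix c x assume "x \<in> K i"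
    then show "\<tau> (scale c x) = scale c (\<tau> x)" using ex[of x] by (metis \<tau> o.sg_scale o.RD(7))
  qed
  then obtain h where h: "fnl h" "\<forall>y\<in>K i. h y = \<epsilon> (\<tau> y)" by blast
  have "r = L h (sg i r)" if "r \<in> K i" for r
    using L_sigma[OF i h(1) fnl_eps _ that] h(2) o.sg_R \<tau> by simp
  then show ?thesis using h(1) by blast
qed

lemma stable_contains_one:
  assumes J: "subspace J" and L_J: "\<And>f x. fnl f \<Longrightarrow> x \<in> J \<Longrightarrow> L f x \<in> J" and "y \<in> J" "y \<noteq> 0"
  shows "1 \<in> J"
proof -
  have "1 \<in> J" if "j \<le> N" "y \<in> J \<inter> K j" "y \<noteq> 0" for j y
    using that
  proof (induction j arbitrary: y)
    case 0
    then obtain c where "y = scale c 1" "c \<noteq> 0" using K_0 unfolding base_field_def by auto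
    then have "scale (1 / c) y = 1" by simp
    then show ?case using subspace_scale[OF J, of y "1 / c"] 0 by simp
  next
    case (Suc j)
    then have j: "j < N" by simp
    interpret o: ore_step scale "K j" "K (Suc j)" "X j" "sg j" "dl j" by (rule ore[OF j])
    interpret d: degree_filtration "{0}" "K j" "GG j" "X j" by (rule degree_K[OF j])
    obtain n where "y \<in> GG j n" using o.B_G Suc.prems(2) unfolding GG_def by auto
    then obtain p where p: "y \<in> GG j (Suc p)" "y \<notin> GG j p"
      using d.exists_degree Suc.prems(3) by (metis singletonD)
    obtain r where r: "r \<in> K j" "y - r * X j ^ p \<in> GG j p" using d.leading[OF p(1)] by blast
    have "r \<noteq> 0" using r p by auto
    obtain f where f: "coeff_fnl j p \<epsilon> f" using coeff_fnl_exists[OF j fnl_eps] by blast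
    have "L f y = r" using L_leading[OF j fnl_eps f r] by simp
    then have "r \<in> J" using L_J[OF coeff_fnlD(1)[OF f]] Suc.prems(2) by auto
    then show ?case using Suc.IH[of r] r(1) \<open>r \<noteq> 0\<close> j by simp
  qed
  from this[of N y] show ?thesis using assms K_N by simp
qed

end

section \<open>Finding a new variable inside a coideal subalgebra\<close>

locale ore_bialgebra_char_0 = ore_bialgebra scale N K X sg dl \<Delta> \<epsilon>
  for scale :: "'k::field_char_0 \<Rightarrow> 'h::ring_1 \<Rightarrow> 'h" and N K X sg dl \<Delta> \<epsilon>
begin

lemma coideal_variable:
  assumes i: "i < N" and A: "coideal A" and ne: "A \<inter> K (Suc i) \<noteq> A \<inter> K i"
  shows "\<exists>Y. Y \<in> A \<inter> K (Suc i) \<and> Y - X i \<in> K i"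
proof -
  interpret o: ore_step scale "K i" "K (Suc i)" "X i" "sg i" "dl i" by (rule ore[OF i])
  interpret d: degree_filtration "{0}" "K i" "GG i" "X i" by (rule degree_K[OF i])
  have A_sub: "subspace A" and A_L: "\<And>f x. fnl f \<Longrightarrow> x \<in> A \<Longrightarrow> L f x \<in> A"
    using A unfolding coideal_def subalgebra_def by auto
  define J where "J = {b \<in> K i. \<exists>s\<in>K i. b * X i + s \<in> A}"
  have J: "subspace J"
  proof (rule subspaceI)
    show "0 \<in> J" unfolding J_def using o.RD(2) subspace_0[OF A_sub] by auto
    show "x + y \<in> J" if xy: "x \<in> J" "y \<in> J" for x y
    proof -
      obtain s t where "s \<in> K i" "x * X i + s \<in> A" "t \<in> K i" "y * X i + t \<in> A"
        using xy unfolding J_def by auto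
      then have "s + t \<in> K i" "(x + y) * X i + (s + t) \<in> A"
        using subspace_add[OF A_sub, of "x * X i + s" "y * X i + t"] o.RD(4) by (auto simp: algebra_simps)
      then show ?thesis using xy o.RD(4) unfolding J_def by blast
    qed
    show "scale c x \<in> J" if x: "x \<in> J" for c x
    proof -
      obtain s where "s \<in> K i" "x * X i + s \<in> A" using x unfolding J_def by auto
      then have "scale c s \<in> K i" "scale c x * X i + scale c s \<in> A"
        using subspace_scale[OF A_sub, of "x * X i + s" c] o.RD(7)
        by (auto simp: scale_right_distrib scale_mult_left)
      then show ?thesis using x o.RD(7) unfolding J_def by blast
    qed
  qed
  \<comment> \<open>Modulo \<open>H \<otimes> K i\<close> the comultiplication of
    \<open>b * X i + s\<close> is \<open>\<Delta> b * pu 1 (X i)\<close>, so \<open>L f b\<close> is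
    the coefficient of \<open>X i\<close> in an element of \<open>A\<close>.\<close>
  have L_J: "L f b \<in> J" if f: "fnl f" and b: "b \<in> J" for f b
  proof -
    obtain s where s: "s \<in> K i" "b * X i + s \<in> A" and bK: "b \<in> K i" using b unfolding J_def by auto
    define w where "w = \<Delta> (X i) - pu 1 (X i)"
    have w: "w \<in> TT UNIV (K i)" unfolding w_def by (rule D_X_right[OF i])
    have Db: "\<Delta> b \<in> TT UNIV (K i)" "\<Delta> s \<in> TT UNIV (K i)" using D_K[of i] i bK s by auto
    have "\<Delta> b * w \<in> TT UNIV (K i)" by (rule TS_mult[OF Db(1) w]) (auto intro: o.RD)
    then have in_K: "SL f (\<Delta> b * w) + SL f (\<Delta> s) \<in> K i"
      using sl_in[OF o.RD(1) f] Db(2) o.RD(4) by blast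
    have "L f (b * X i + s) = SL f (\<Delta> b * \<Delta> (X i)) + SL f (\<Delta> s)"
      using D_expand[of b "X i" 1 s] f unfolding L_def zt_def by simp
    also have "\<Delta> b * \<Delta> (X i) = \<Delta> b * pu 1 (X i) + \<Delta> b * w"
      unfolding w_def by (simp add: algebra_simps)
    finally have "L f b * X i + (SL f (\<Delta> b * w) + SL f (\<Delta> s)) \<in> A"
      using A_L[OF f s(2)] unfolding L_def[of f b] by (simp add: sl_mult_pu add.assoc)
    moreover have "L f b \<in> K i" unfolding L_def by (rule sl_in[OF o.RD(1) f Db(1)])
    ultimately show ?thesis using in_K unfolding J_def by blast
  qed
  obtain a where a: "a \<in> A" "a \<in> K (Suc i)" "a \<notin> K i" using ne o.RB by auto
  obtain n where "a \<in> GG i n" using o.B_G a unfolding GG_def by auto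
  moreover have "a \<noteq> 0" using a o.RD(2) by metis
  ultimately obtain p where p: "a \<in> GG i (Suc p)" "a \<notin> GG i p" using d.exists_degree by (metis singletonD)
  have "p \<noteq> 0" using p a(3) d.G_1 by metis
  then obtain m where m: "p = Suc m" using not0_implies_Suc by blast
  obtain r where r: "r \<in> K i" "a - r * X i ^ p \<in> GG i p" using d.leading[OF p(1)] by blast
  have "r \<noteq> 0" using r p by auto
  obtain f where f: "coeff_fnl i m \<epsilon> f" using coeff_fnl_exists[OF i fnl_eps] by blast
  \<comment> \<open>The multiplicity produced by \<open>L_subleading\<close>; it can be divided out
    in characteristic zero.\<close>
  define c :: 'k where "c = of_nat (Suc m)"
  have "c \<noteq> 0" unfolding c_def using of_nat_neq_0 by blast
  have of_nat_scale: "of_nat k * x = scale (of_nat k) x" for k and x :: 'h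
    by (induction k) (simp_all add: distrib_right scale_left_distrib)
  have "L f a - r * (of_nat (Suc m) * X i) \<in> K i"
    using L_subleading[OF i f r(1), of "a - r * X i ^ p"] r(2) m by simp
  moreover have "r * (of_nat (Suc m) * X i) = scale c (r * X i)"
    unfolding c_def of_nat_scale by (simp only: scale_mult_right)
  ultimately have s: "L f a - scale c (r * X i) \<in> K i" by simp
  have "scale (1 / c) (L f a) = r * X i + scale (1 / c) (L f a - scale c (r * X i))"
    using \<open>c \<noteq> 0\<close> by (simp add: scale_right_diff_distrib)
  moreover have "scale (1 / c) (L f a) \<in> A"
    by (rule subspace_scale[OF A_sub A_L[OF coeff_fnlD(1)[OF f] a(1)]])
  moreover have "scale (1 / c) (L f a - scale c (r * X i)) \<in> K i" by (rule o.RD(7)[OF s])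
  ultimately have "r \<in> J" using r(1) unfolding J_def by (metis (mono_tags, lifting) mem_Collect_eq)
  then have "1 \<in> J" using stable_contains_one[OF J L_J] \<open>r \<noteq> 0\<close> by blast
  then obtain s where s: "s \<in> K i" "X i + s \<in> A" unfolding J_def by auto
  moreover have "X i + s \<in> K (Suc i)" using o.BD(4)[OF o.XB] s o.RB by auto
  ultimately show ?thesis by (intro exI[of _ "X i + s"]) auto
qed

end

section \<open>Intersecting a coideal subalgebra with one Ore extension of the chain\<close>

locale coideal_step = ore_bialgebra scale N K X sg dl \<Delta> \<epsilon>
  for scale :: "'k::field \<Rightarrow> 'h::ring_1 \<Rightarrow> 'h" and N K X sg dl \<Delta> \<epsilon> +
  fixes A :: "'h set" and i :: nat and Y :: 'h
  assumes i: "i < N" and A: "coideal A" and Y: "Y \<in> A" "Y - X i \<in> K i"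
begin

sublocale o: ore_step scale "K i" "K (Suc i)" "X i" "sg i" "dl i" by (rule ore[OF i])
sublocale d: degree_filtration "{0}" "K i" "GG i" "X i" by (rule degree_K[OF i])

lemma A_sub: "subalgebra scale A" and A_L: "fnl f \<Longrightarrow> x \<in> A \<Longrightarrow> L f x \<in> A"
  using A unfolding coideal_def by auto

lemmas AD = subalgebraD[OF A_sub]

lemma Y_K: "Y \<in> K (Suc i)"
proof -
  have "Y = X i + (Y - X i)" by simp
  then show ?thesis using o.BD(4)[OF o.XB] Y(2) o.RB by (metis subsetD)
qed

text \<open>Replacing \<open>X i\<close> by \<open>Y = X i + s\<close> with \<open>s\<close> in
  \<open>K i\<close> keeps the twist and changes the skew derivation by the inner one sending
  \<open>r\<close> to \<open>s * r - sg i r * s\<close>.\<close>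

definition "\<delta>' r = Y * r - sg i r * Y"

lemma Y_comm: "Y * r = sg i r * Y + \<delta>' r"
  by (simp add: \<delta>'_def)

lemma \<delta>'_K: assumes r: "r \<in> K i" shows "\<delta>' r \<in> K i"
proof -
  define s where "s = Y - X i"
  have "Y = X i + s" unfolding s_def by simp
  then have "\<delta>' r = dl i r + s * r - sg i r * s"
    unfolding \<delta>'_def using o.comm[OF r] by (simp add: algebra_simps)
  then show ?thesis using o.dl_R[OF r] o.sg_R[OF r] Y(2) r o.RD(4,5,6) unfolding s_def by simp
qed

lemma Y_G: assumes "y \<in> GG i n" shows "Y * y \<in> GG i (Suc n)"
proof -
  have "X i * y + (Y - X i) * y \<in> GG i (Suc n)"
    using d.X_G[OF assms] d.R_G[OF Y(2) assms] d.G_Suc by (intro d.G_add) auto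
  then show ?thesis by (simp add: algebra_simps)
qed

lemma Y_power: "Y ^ n - X i ^ n \<in> GG i n"
proof (induction n)
  case 0
  then show ?case by (simp add: d.G_zero)
next
  case (Suc n)
  have "Y * (Y ^ n - X i ^ n) + (Y - X i) * X i ^ n \<in> GG i (Suc n)"
    by (intro d.G_add Y_G Suc d.R_X_power Y(2))
  then show ?case by (simp add: algebra_simps)
qed

text \<open>The coefficient \<open>r\<close> is a slice of \<open>a\<close>, hence in
  \<open>A\<close>, and \<open>Y\<close> is in \<open>A\<close>; so top terms can be split off
  without leaving \<open>A\<close>.\<close>

lemma A_leading:
  assumes "a \<in> A" "a \<in> GG i (Suc n)"
  shows "\<exists>r\<in>A \<inter> K i. a - r * Y ^ n \<in> A \<inter> GG i n"
proof -
  obtain r where r: "r \<in> K i" "a - r * X i ^ n \<in> GG i n" using d.leading[OF assms(2)] by blast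
  obtain f where f: "coeff_fnl i n \<epsilon> f" using coeff_fnl_exists[OF i fnl_eps] by blast
  have "L f a = r" using L_leading[OF i fnl_eps f r] by simp
  then have "r \<in> A" using A_L[OF coeff_fnlD(1)[OF f] assms(1)] by simp
  have "a - r * Y ^ n = (a - r * X i ^ n) - r * (Y ^ n - X i ^ n)" by (simp add: algebra_simps)
  also have "\<dots> \<in> GG i n" using r d.R_G[OF r(1) Y_power] d.G_diff by blast
  finally show ?thesis using \<open>r \<in> A\<close> r(1) assms(1) AD(5,6) subalgebra_power[OF A_sub Y(1)] by blast
qed

lemma A_expand: "a \<in> A \<Longrightarrow> a \<in> GG i n \<Longrightarrow> \<exists>c. (\<forall>j<n. c j \<in> A \<inter> K i) \<and> a = (\<Sum>j<n. c j * Y ^ j)"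
proof (induction n arbitrary: a)
  case 0
  then show ?case using d.G_0 by simp
next
  case (Suc n)
  obtain r where r: "r \<in> A \<inter> K i" "a - r * Y ^ n \<in> A \<inter> GG i n" using A_leading[OF Suc.prems] by blast
  obtain c where c: "\<forall>j<n. c j \<in> A \<inter> K i" "a - r * Y ^ n = (\<Sum>j<n. c j * Y ^ j)"
    using Suc.IH r(2) by (metis IntE)
  have "a = (\<Sum>j<n. c j * Y ^ j) + r * Y ^ n" using c(2) by (simp add: algebra_simps)
  then show ?case using c(1) r(1)
    by (intro exI[of _ "c(n := r)"]) (auto simp: less_Suc_eq)
qed

lemma A_span_powers:
  assumes "a \<in> A \<inter> K (Suc i)"
  shows "\<exists>n c. (\<forall>j<n. c j \<in> A \<inter> K i) \<and> a = (\<Sum>j<n. c j * Y ^ j)"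
  using A_expand o.B_G assms unfolding GG_def by blast

lemma Y_sum_G: assumes "\<And>j. j < n \<Longrightarrow> c j \<in> K i" shows "(\<Sum>j<n. c j * Y ^ j) \<in> GG i n"
  using assms
proof (induction n)
  case 0
  then show ?case by (simp add: d.G_zero)
next
  case (Suc n)
  have "c n * (Y ^ n - X i ^ n) + c n * X i ^ n \<in> GG i (Suc n)"
    using d.R_G[OF Suc.prems[of n] Y_power] d.R_X_power[OF Suc.prems[of n]] d.G_Suc by (intro d.G_add) auto
  then have "c n * Y ^ n \<in> GG i (Suc n)" by (simp add: algebra_simps)
  then show ?case using Suc d.G_Suc by (auto intro!: d.G_add)
qed

text \<open>\<open>Y ^ n\<close> and \<open>X i ^ n\<close> differ in lower degree, so freeness in
  terms of \<open>X i\<close> forces the top coefficient to vanish.\<close>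

lemma Y_independent:
  assumes "\<And>j. j < n \<Longrightarrow> c j \<in> K i" "(\<Sum>j<n. c j * Y ^ j) = 0" "j < n"
  shows "c j = 0"
  using assms
proof (induction n)
  case (Suc n)
  have "c n * X i ^ n = - (\<Sum>j<n. c j * Y ^ j) - c n * (Y ^ n - X i ^ n)"
    using Suc.prems(2) by (simp add: algebra_simps add_eq_0_iff)
  also have "\<dots> = 0 - (\<Sum>j<n. c j * Y ^ j) - c n * (Y ^ n - X i ^ n)" by simp
  also have "\<dots> \<in> GG i n"
    using Suc.prems(1) by (intro d.G_diff d.G_zero Y_sum_G d.R_G Y_power) auto
  finally have "c n = 0" using d.free[of "c n" n] Suc.prems(1)[of n] by simp
  then show ?case using Suc by (cases "j = n") auto
qed simp

lemma sg_A: assumes r: "r \<in> A \<inter> K i" shows "sg i r \<in> A \<inter> K i"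
proof -
  obtain h where "fnl h" "\<forall>r\<in>K i. sg i r = L h r" using sigma_eq_L[OF i] by blast
  then show ?thesis using A_L r o.sg_R by auto
qed

lemma \<delta>'_A: assumes r: "r \<in> A \<inter> K i" shows "\<delta>' r \<in> A \<inter> K i"
  using r sg_A[OF r] \<delta>'_K[of r] AD(5,6) Y(1) unfolding \<delta>'_def by auto

lemma \<delta>'_add: "r \<in> K i \<Longrightarrow> s \<in> K i \<Longrightarrow> \<delta>' (r + s) = \<delta>' r + \<delta>' s"
  by (simp add: \<delta>'_def o.sg_add algebra_simps)

lemma \<delta>'_scale: "r \<in> K i \<Longrightarrow> \<delta>' (scale c r) = scale c (\<delta>' r)"
  by (simp add: \<delta>'_def o.sg_scale scale_mult_left scale_mult_right scale_right_diff_distrib)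

lemma \<delta>'_mult: assumes "r \<in> K i" "s \<in> K i" shows "\<delta>' (r * s) = sg i r * \<delta>' s + \<delta>' r * s"
  using assms by (simp add: \<delta>'_def o.sg_mult algebra_simps)

lemma int_subalgebra: "j \<le> N \<Longrightarrow> subalgebra scale (A \<inter> K j)"
  using A_sub K_subalgebra[of j] unfolding subalgebra_def by (auto intro: subspace_inter)

lemma ore_A: "ore_extension scale (A \<inter> K i) (A \<inter> K (Suc i))"
proof -
  have sub: "subalgebra scale (A \<inter> K i)" "subalgebra scale (A \<inter> K (Suc i))"
    using int_subalgebra i by auto
  have "sg i ` (A \<inter> K i) = A \<inter> K i"
  proof
    show "sg i ` (A \<inter> K i) \<subseteq> A \<inter> K i" using sg_A by blast
    show "A \<inter> K i \<subseteq> sg i ` (A \<inter> K i)"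
    proof
      fix u assume u: "u \<in> A \<inter> K i"
      obtain h where h: "fnl h" "\<forall>r\<in>K i. r = L h (sg i r)" using sigma_inverse_eq_L[OF i] by blast
      obtain r where r: "r \<in> K i" "u = sg i r" using o.sg_bij u unfolding bij_betw_def by auto
      then have "r \<in> A" using h A_L[OF h(1), of u] u by (metis IntE)
      then show "u \<in> sg i ` (A \<inter> K i)" using r by auto
    qed
  qed
  then have "bij_betw (sg i) (A \<inter> K i) (A \<inter> K i)"
    using o.sg_bij unfolding bij_betw_def by (auto intro: inj_on_subset)
  then have aut: "algebra_automorphism_on scale (A \<inter> K i) (sg i)"
    unfolding algebra_automorphism_on_def
    using o.sg_add o.sg_mult o.sg_scale o.sg_one by auto
  have der: "skew_derivation_on scale (A \<inter> K i) (sg i) \<delta>'"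
    unfolding skew_derivation_on_def using \<delta>'_A \<delta>'_add \<delta>'_mult \<delta>'_scale by auto
  have "free_on_powers (A \<inter> K i) (A \<inter> K (Suc i)) Y"
  proof (rule free_on_powersI)
    show "c j = 0" if "\<And>j. j < n \<Longrightarrow> c j \<in> A \<inter> K i" "(\<Sum>j<n. c j * Y ^ j) = 0" "j < n" for n c j
      using Y_independent[of n c j] that by blast
  qed (use AD(2,5) o.RD(2,5) A_span_powers in auto)
  then show ?thesis
    unfolding ore_extension_def using sub aut der Y_comm Y(1) Y_K o.RB by blast
qed

text \<open>Slices lie in \<open>A\<close> because \<open>A\<close> is stable and contains
  \<open>Y\<close> and \<open>1\<close>, and in \<open>K i\<close> by \<open>D_X\<close>. The growth
  argument uses this to choose a weight for \<open>Y\<close> that keeps the filtration stable under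
  slices.\<close>

lemma D_Y: "\<Delta> Y - pu Y 1 - pu 1 Y \<in> TT UNIV (A \<inter> K i)"
proof -
  have sub: "subspace (A \<inter> K i)" using int_subalgebra[of i] i subalgebraD(1) by simp
  define s where "s = Y - X i"
  define w where "w = \<Delta> (X i) - pu (X i) 1 - pu 1 (X i)"
  have w: "w \<in> TT UNIV (K i)" unfolding w_def using TS_mono[OF D_X[OF i]] by blast
  have Ds: "\<Delta> s \<in> TT UNIV (K i)" using D_K[of i s] i Y(2) unfolding s_def by simp
  have "SL f (\<Delta> Y - pu Y 1 - pu 1 Y) \<in> A \<inter> K i" if f: "fnl f" for f
  proof
    show "SL f (\<Delta> Y - pu Y 1 - pu 1 Y) \<in> A"
      using A_L[OF f Y(1)] AD Y(1) unfolding L_def by simp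
    have "L f Y = L f (X i) + L f s" using L_add[OF f, of "X i" s] unfolding s_def by simp
    then have "SL f (\<Delta> Y - pu Y 1 - pu 1 Y) = SL f w + L f s + scale (f (X i) - f Y) 1 - scale (f 1) s"
      unfolding w_def s_def L_def by (simp add: algebra_simps scale_left_diff_distrib scale_right_diff_distrib)
    moreover have "SL f w \<in> K i" "L f s \<in> K i"
      unfolding L_def by (rule sl_in[OF o.RD(1) f w], rule sl_in[OF o.RD(1) f Ds])
    moreover have "s \<in> K i" using Y(2) unfolding s_def .
    ultimately show "SL f (\<Delta> Y - pu Y 1 - pu 1 Y) \<in> K i" using o.RD by simp
  qed
  then show ?thesis using TS_UNIV_iff[OF sub] by blast
qed

end

section \<open>Growth\<close>

text \<open>The filtration is stable under slices, so that every \<open>\<sigma>\<close>, being a slice itself, preserves it.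
  Generation by low degrees makes it possible to bound the degree of \<open>\<delta>\<close> and to give the next
  variable a weight that absorbs it.\<close>

locale growth_filtration = ore_bialgebra scale N K X sg dl \<Delta> \<epsilon>
  for scale :: "'k::field \<Rightarrow> 'h::ring_1 \<Rightarrow> 'h" and N K X sg dl \<Delta> \<epsilon> +
  fixes F :: "nat \<Rightarrow> 'h set" and A :: "'h set" and m :: nat
  assumes F_subspace: "subspace (F n)" and F_one: "1 \<in> F 0" and F_Suc: "F n \<subseteq> F (Suc n)"
    and F_union: "(\<Union>n. F n) = A"
    and F_mult: "x \<in> F p \<Longrightarrow> y \<in> F q \<Longrightarrow> x * y \<in> F (p + q)"
    and F_L: "fnl f \<Longrightarrow> x \<in> F n \<Longrightarrow> L f x \<in> F n"
    and F_dim: "\<exists>S. finite S \<and> card S \<le> (n + 1) ^ m \<and> F n \<subseteq> span S"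
    and F_generated: "\<exists>D. \<forall>n>D. F n \<subseteq> span {x * y | x y p q. x \<in> F p \<and> y \<in> F q \<and> p + q = n \<and> p < n \<and> q < n}"
begin

lemma F_mono: "p \<le> q \<Longrightarrow> F p \<subseteq> F q"
  by (rule lift_Suc_mono_le[of F]) (use F_Suc in auto)

lemma F_sub: "F n \<subseteq> A"
  using F_union by blast

lemma F_D: "x \<in> F n \<Longrightarrow> \<Delta> x \<in> TT UNIV (F n)"
  using F_L TS_UNIV_iff[OF F_subspace] unfolding L_def by blast

lemma finite_in_F: "finite B \<Longrightarrow> B \<subseteq> A \<Longrightarrow> \<exists>n. B \<subseteq> F n"
proof (induction B rule: finite_induct)
  case (insert b B)
  then obtain n where "B \<subseteq> F n" by auto
  moreover obtain k where "b \<in> F k" using insert F_union by auto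
  ultimately have "insert b B \<subseteq> F (max n k)"
    using F_mono[of n "max n k"] F_mono[of k "max n k"] by auto
  then show ?case by blast
qed simp

lemma tensor_in_F: "t \<in> TT UNIV A \<Longrightarrow> \<exists>n. t \<in> TT UNIV (F n)"
proof (induction rule: TS.induct)
  case (TS_zt t) then show ?case by (auto intro: TS.TS_zt)
next
  case (TS_step a b t)
  then obtain n k where "t \<in> TT UNIV (F n)" "b \<in> F k" using F_union by blast
  then have "t \<in> TT UNIV (F (max n k))" "b \<in> F (max n k)"
    using TS_mono[of t UNIV "F n" UNIV "F (max n k)"] F_mono[of n "max n k"] F_mono[of k "max n k"] by auto
  then show ?case by (auto intro: TS.TS_step)
qed

end

text \<open>\<open>w\<close> is the weight given to \<open>Y\<close>. It has to dominate the rise of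
  degree under \<open>\<delta>'\<close>, for multiplicativity, and the mixed part of
  \<open>\<Delta> Y\<close>, for stability under slices; \<open>w_pos\<close> bounds exponents of
  \<open>Y\<close> by the degree.\<close>

locale growth_step = coideal_step scale N K X sg dl \<Delta> \<epsilon> A i Y +
    f: growth_filtration scale N K X sg dl \<Delta> \<epsilon> F "A \<inter> K i" m
  for scale :: "'k::field \<Rightarrow> 'h::ring_1 \<Rightarrow> 'h" and N K X sg dl \<Delta> \<epsilon> A i Y F m +
  fixes w :: nat
  assumes w_pos: "w \<ge> 1" and \<delta>'_F: "x \<in> F n \<Longrightarrow> \<delta>' x \<in> F (n + w)"
    and D_Y_F: "\<Delta> Y - pu Y 1 - pu 1 Y \<in> TT UNIV (F w)"
begin

text \<open>The guard \<open>w * a \<le> n\<close> matters: without it truncated subtraction would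
  admit \<open>F 0 * Y ^ a\<close> for every \<open>a\<close>.\<close>

definition "F' n = span {r * Y ^ a | r a. w * a \<le> n \<and> r \<in> F (n - w * a)}"

lemma F'I: "r \<in> F p \<Longrightarrow> p + w * a \<le> n \<Longrightarrow> r * Y ^ a \<in> F' n"
  unfolding F'_def using f.F_mono[of p "n - w * a"] by (intro span_base) force

lemma F'_subspace: "subspace (F' n)"
  unfolding F'_def by (rule subspace_span)

lemma F'_induct:
  assumes "x \<in> F' n" and "subspace W" and "\<And>r a p. r \<in> F p \<Longrightarrow> p + w * a = n \<Longrightarrow> r * Y ^ a \<in> W"
  shows "x \<in> W"
proof -
  have "{r * Y ^ a | r a. w * a \<le> n \<and> r \<in> F (n - w * a)} \<subseteq> W"
    using assms(3) by fastforce
  then show ?thesis using span_minimal[OF _ assms(2)] assms(1) unfolding F'_def by blast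
qed

lemma F_F': "F n \<subseteq> F' n"
  using F'I[of _ n 0 n] by auto

lemma F'_mono: assumes "p \<le> q" shows "F' p \<subseteq> F' q"
proof
  fix x assume "x \<in> F' p"
  then show "x \<in> F' q"
    by (rule F'_induct[OF _ F'_subspace]) (use assms in \<open>auto intro: F'I\<close>)
qed

lemma subspace_vimage_left: "subspace W \<Longrightarrow> subspace {x. a * x \<in> W}"
  by (rule subspaceI) (auto simp: subspace_0 subspace_add subspace_scale distrib_left scale_mult_right)

lemma subspace_vimage_right: "subspace W \<Longrightarrow> subspace {x. x * a \<in> W}"
  by (rule subspaceI) (auto simp: subspace_0 subspace_add subspace_scale distrib_right scale_mult_left)

lemma F_F'_mult: assumes "r \<in> F p" "x \<in> F' n" shows "r * x \<in> F' (n + p)"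
proof -
  have "r * (s * Y ^ a) \<in> F' (n + p)" if "s \<in> F q" "q + w * a = n" for s q a
    using F'I[OF f.F_mult[OF assms(1) that(1)], of a "n + p"] that(2) by (simp add: mult.assoc)
  then show ?thesis
    using F'_induct[OF assms(2) subspace_vimage_left[OF F'_subspace]] by blast
qed

lemma sg_F: assumes "r \<in> F p" shows "sg i r \<in> F p"
proof -
  obtain h where "fnl h" "\<forall>r\<in>K i. sg i r = L h r" using sigma_eq_L[OF i] by blast
  then show ?thesis using assms f.F_L f.F_sub by fastforce
qed

text \<open>Moving \<open>Y\<close> past \<open>r\<close> yields \<open>sg i r * Y\<close>, where
  the twist keeps the degree of \<open>r\<close>, and \<open>\<delta>' r\<close>, where the
  allowance \<open>w\<close> pays for the rise.\<close>

lemma Y_F': assumes "x \<in> F' n" shows "Y * x \<in> F' (n + w)"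
proof -
  have "Y * (r * Y ^ a) \<in> F' (n + w)" if r: "r \<in> F p" and p: "p + w * a = n" for r p a
  proof -
    have "sg i r * Y ^ Suc a \<in> F' (n + w)" by (rule F'I[OF sg_F[OF r]]) (use p in auto)
    moreover have "\<delta>' r * Y ^ a \<in> F' (n + w)" by (rule F'I[OF \<delta>'_F[OF r]]) (use p in auto)
    ultimately have "sg i r * Y ^ Suc a + \<delta>' r * Y ^ a \<in> F' (n + w)" by (rule subspace_add[OF F'_subspace])
    then show ?thesis by (simp add: \<delta>'_def algebra_simps)
  qed
  then show ?thesis
    using F'_induct[OF assms subspace_vimage_left[OF F'_subspace]] by blast
qed

lemma Y_power_F': "x \<in> F' n \<Longrightarrow> Y ^ a * x \<in> F' (n + w * a)"
proof (induction a)
  case (Suc a)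
  then show ?case using Y_F'[of "Y ^ a * x" "n + w * a"] by (simp add: mult.assoc add_ac)
qed simp

lemma F'_mult: assumes "x \<in> F' p" "y \<in> F' q" shows "x * y \<in> F' (p + q)"
proof -
  have "r * Y ^ a * y \<in> F' (p + q)" if "r \<in> F k" "k + w * a = p" for r k a
    using F_F'_mult[OF that(1) Y_power_F'[OF assms(2), of a]] that(2) by (simp add: mult.assoc add_ac flip: that(2))
  then show ?thesis
    using F'_induct[OF assms(1) subspace_vimage_right[OF F'_subspace]] by blast
qed

lemma Y_in_F': "Y \<in> F' w"
  using F'I[OF f.F_one, of 1 w] by simp

lemma D_Y_F': "\<Delta> Y \<in> TT UNIV (F' w)"
proof -
  have "pu Y 1 + pu 1 Y + (\<Delta> Y - pu Y 1 - pu 1 Y) \<in> TT UNIV (F' w)"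
    using Y_in_F' f.F_one F_F'[of 0] F'_mono[of 0 w] TS_mono[OF D_Y_F, of UNIV "F' w"] F_F'[of w]
    by (intro TS_add TS_pu) auto
  then show ?thesis by simp
qed

lemma D_Y_power_F': "\<Delta> Y ^ a \<in> TT UNIV (F' (w * a))"
proof (induction a)
  case 0
  have "pu 1 1 \<in> TT UNIV (F' 0)" using F_F'[of 0] f.F_one by (intro TS_pu) auto
  then show ?case by simp
next
  case (Suc a)
  show ?case using TS_mult[OF D_Y_F' Suc, where E = UNIV and F = "F' (w * Suc a)"] F'_mult
    by simp
qed

lemma F'_L: assumes f: "fnl f" and "x \<in> F' n" shows "L f x \<in> F' n"
proof -
  have "L f (r * Y ^ a) \<in> F' n" if r: "r \<in> F p" and p: "p + w * a = n" for r p a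
  proof -
    have "\<Delta> r * \<Delta> Y ^ a \<in> TT UNIV (F' n)"
      using TS_mult[OF f.F_D[OF r] D_Y_power_F', where E = UNIV and F = "F' n"] F'_mult[of _ p _ "w * a"] F_F'[of p] p
      by blast
    then have "SL f (\<Delta> r * \<Delta> Y ^ a) \<in> F' n" by (rule sl_in[OF F'_subspace f])
    moreover have "L f (r * Y ^ a) = SL f (\<Delta> r * \<Delta> Y ^ a)"
      using D_expand[of r Y a 0] D_zero f unfolding L_def zt_def by simp
    ultimately show ?thesis by simp
  qed
  moreover have "subspace {x. L f x \<in> F' n}"
    using L_zero[OF f] L_add[OF f] L_scale[OF f] F'_subspace
    by (auto intro!: subspaceI simp: subspace_0 subspace_add subspace_scale)
  ultimately show ?thesis using F'_induct[OF assms(2)] by blast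
qed

lemma F'_dim: "\<exists>S. finite S \<and> card S \<le> (n + 1) ^ Suc m \<and> F' n \<subseteq> span S"
proof -
  obtain S where S: "\<And>n. finite (S n)" "\<And>n. card (S n) \<le> (n + 1) ^ m" "\<And>n. F n \<subseteq> span (S n)"
    using f.F_dim by metis
  \<comment> \<open>Since \<open>w \<ge> 1\<close>, exponents up to \<open>n\<close> suffice; their
    number is the new factor \<open>n + 1\<close>.\<close>
  define T where "T = (\<Union>a\<le>n. (\<lambda>s. s * Y ^ a) ` S (n - w * a))"
  have "card T \<le> (\<Sum>a\<le>n. card ((\<lambda>s. s * Y ^ a) ` S (n - w * a)))"
    unfolding T_def by (rule card_UN_le) simp
  also have "\<dots> \<le> (\<Sum>a\<le>n. (n + 1) ^ m)"
  proof (rule sum_mono)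
    fix a
    have "card ((\<lambda>s. s * Y ^ a) ` S (n - w * a)) \<le> (n - w * a + 1) ^ m"
      using card_image_le[OF S(1), of "\<lambda>s. s * Y ^ a" "n - w * a"] S(2)[of "n - w * a"] by linarith
    also have "\<dots> \<le> (n + 1) ^ m" by (intro power_mono) auto
    finally show "card ((\<lambda>s. s * Y ^ a) ` S (n - w * a)) \<le> (n + 1) ^ m" .
  qed
  finally have "card T \<le> (n + 1) ^ Suc m" by simp
  moreover have "finite T" unfolding T_def using S(1) by auto
  moreover have "F' n \<subseteq> span T"
  proof
    fix x assume "x \<in> F' n"
    then show "x \<in> span T"
    proof (rule F'_induct[OF _ subspace_span])
      fix r a p assume r: "r \<in> F p" and p: "p + w * a = n"
      have "1 * a \<le> w * a" using w_pos by (rule mult_right_mono) simp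
      then have "a \<le> n" using p by linarith
      have "S p \<subseteq> {x. x * Y ^ a \<in> span T}"
        using \<open>a \<le> n\<close> p unfolding T_def by (force intro: span_base)
      then have "span (S p) \<subseteq> {x. x * Y ^ a \<in> span T}"
        by (rule span_minimal[OF _ subspace_vimage_right[OF subspace_span]])
      then show "r * Y ^ a \<in> span T" using S(3) r by blast
    qed
  qed
  ultimately show ?thesis by blast
qed

text \<open>A product with a power of \<open>Y\<close> splits off one \<open>Y\<close>, of weight
  \<open>w\<close>, and both parts have degree below \<open>n\<close> once \<open>n > w\<close>.
  Elements of \<open>F n\<close> are split by the old filtration once \<open>n > D\<close>.\<close>

lemma F'_generated:
  "\<exists>D. \<forall>n>D. F' n \<subseteq> span {x * y | x y p q. x \<in> F' p \<and> y \<in> F' q \<and> p + q = n \<and> p < n \<and> q < n}"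
proof -
  obtain D where D: "\<And>n. n > D \<Longrightarrow> F n \<subseteq> span {x * y | x y p q. x \<in> F p \<and> y \<in> F q \<and> p + q = n \<and> p < n \<and> q < n}"
    using f.F_generated by blast
  have "F' n \<subseteq> span {x * y | x y p q. x \<in> F' p \<and> y \<in> F' q \<and> p + q = n \<and> p < n \<and> q < n}" (is "_ \<subseteq> span ?P")
    if n: "n > max D w" for n
  proof
    fix x assume "x \<in> F' n"
    then show "x \<in> span ?P"
    proof (rule F'_induct[OF _ subspace_span])
      fix r a p assume r: "r \<in> F p" and p: "p + w * a = n"
      show "r * Y ^ a \<in> span ?P"
      proof (cases a)
        case 0
        have "{x * y | x y p q. x \<in> F p \<and> y \<in> F q \<and> p + q = n \<and> p < n \<and> q < n} \<subseteq> ?P"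
          using F_F' by blast
        then have "F n \<subseteq> span ?P" using D[of n] n span_mono by (meson max.strict_boundedE order_trans)
        then show ?thesis using r p 0 by auto
      next
        case (Suc b)
        have "r * Y ^ b \<in> F' (n - w)" by (rule F'I[OF r]) (use p Suc in auto)
        moreover have "(n - w) + w = n" "n - w < n" "w < n" using n w_pos by auto
        ultimately have "r * Y ^ b * Y \<in> ?P" using Y_in_F' by blast
        then have "r * Y ^ b * Y \<in> span ?P" by (rule span_base)
        then show ?thesis using Suc by (simp add: mult.assoc flip: power_Suc2)
      qed
    qed
  qed
  then show ?thesis by blast
qed

lemma F'_union: "(\<Union>n. F' n) = A \<inter> K (Suc i)"
proof
  show "(\<Union>n. F' n) \<subseteq> A \<inter> K (Suc i)"
  proof
    fix x assume "x \<in> (\<Union>n. F' n)"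
    then obtain n where "x \<in> F' n" by blast
    moreover have sub: "subalgebra scale (A \<inter> K (Suc i))" using int_subalgebra i by simp
    moreover have "Y \<in> A \<inter> K (Suc i)" using Y(1) Y_K by simp
    moreover have "F p \<subseteq> A \<inter> K (Suc i)" for p using f.F_sub o.RB by blast
    ultimately show "x \<in> A \<inter> K (Suc i)"
      using F'_induct[OF _ subalgebraD(1)[OF sub]] subalgebraD(6)[OF sub] subalgebra_power[OF sub]
      by (meson subsetD)
  qed
  show "A \<inter> K (Suc i) \<subseteq> (\<Union>n. F' n)"
  proof
    fix x assume "x \<in> A \<inter> K (Suc i)"
    then obtain n c where c: "\<forall>j<n. c j \<in> A \<inter> K i" "x = (\<Sum>j<n. c j * Y ^ j)"
      using A_span_powers by blast
    obtain p where p: "c ` {..<n} \<subseteq> F p" using f.finite_in_F[of "c ` {..<n}"] c(1) by auto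
    have "x \<in> F' (p + w * n)" unfolding c(2)
    proof (rule subspace_sum[OF F'_subspace])
      fix j assume "j \<in> {..<n}"
      then show "c j * Y ^ j \<in> F' (p + w * n)" using p by (intro F'I[of _ p]) auto
    qed
    then show "x \<in> (\<Union>n. F' n)" by blast
  qed
qed

lemma growth_F': "growth_filtration scale N K X sg dl \<Delta> \<epsilon> F' (A \<inter> K (Suc i)) (Suc m)"
proof unfold_locales
  show "1 \<in> F' 0" using F_F' f.F_one by blast
  show "F' n \<subseteq> F' (Suc n)" for n by (rule F'_mono) simp
  show "x * y \<in> F' (p + q)" if "x \<in> F' p" "y \<in> F' q" for x y p q using F'_mult[OF that] .
  show "L f x \<in> F' n" if "fnl f" "x \<in> F' n" for f x n using F'_L[OF that] .
qed (rule F'_subspace F'_union F'_dim F'_generated)+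

end

section \<open>Choosing the weight of the new variable\<close>

context coideal_step
begin

lemma growth_extend:
  assumes "growth_filtration scale N K X sg dl \<Delta> \<epsilon> F (A \<inter> K i) m"
  shows "\<exists>F'. growth_filtration scale N K X sg dl \<Delta> \<epsilon> F' (A \<inter> K (Suc i)) (Suc m)"
proof -
  interpret f: growth_filtration scale N K X sg dl \<Delta> \<epsilon> F "A \<inter> K i" m by (rule assms)
  obtain D where D: "\<And>n. n > D \<Longrightarrow> F n \<subseteq> span {x * y | x y p q. x \<in> F p \<and> y \<in> F q \<and> p + q = n \<and> p < n \<and> q < n}"
    using f.F_generated by blast
  have sub: "subspace {x \<in> K i. \<delta>' x \<in> F q}" for q
    using o.RD \<delta>'_add \<delta>'_scale f.F_subspace[of q] \<delta>'_scale[of 0 0]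
    by (intro subspaceI) (auto simp: subspace_0 subspace_add subspace_scale)
  obtain B where B: "B \<subseteq> F D" "independent B" "F D \<subseteq> span B"
    using basis_exists[of "F D"] by metis
  obtain S where "finite S" "F D \<subseteq> span S" using f.F_dim by metis
  then have "finite B" using independent_span_bound[OF _ B(2)] B(1) by blast
  moreover have "\<delta>' ` B \<subseteq> A \<inter> K i" using B(1) f.F_sub \<delta>'_A by blast
  \<comment> \<open>On the finite-dimensional space \<open>F D\<close> the map
    \<open>\<delta>'\<close> is bounded by its values on a basis.\<close>
  ultimately obtain w1 where w1: "\<delta>' ` B \<subseteq> F w1" using f.finite_in_F by blast
  obtain w2 where w2: "\<Delta> Y - pu Y 1 - pu 1 Y \<in> TT UNIV (F w2)" using f.tensor_in_F[OF D_Y] by blast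
  define w where "w = max 1 (max w1 w2)"
  have w: "w \<ge> 1" "F w1 \<subseteq> F w" "F w2 \<subseteq> F w" unfolding w_def by (auto intro!: f.F_mono)
  have "B \<subseteq> {x \<in> K i. \<delta>' x \<in> F w}" using B(1) f.F_sub w1 w(2) by blast
  from span_minimal[OF this sub] have base: "\<delta>' x \<in> F w" if "x \<in> F D" for x using that B(3) by blast
  have \<delta>'_F: "\<delta>' x \<in> F (n + w)" if "x \<in> F n" for x n
    using that
  proof (induction n arbitrary: x rule: less_induct)
    case (less n)
    show ?case
    proof (cases "n \<le> D")
      case True
      then have "x \<in> F D" using less.prems f.F_mono by blast
      then show ?thesis using base f.F_mono[of w "n + w"] by auto
    next
      case False
      \<comment> \<open>The Leibniz rule spreads the bound upwards from the generating degrees: in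
        each of its two terms \<open>\<delta>'\<close> hits one factor, and \<open>sg i\<close>
        costs nothing, being a slice.\<close>
      have "x * y \<in> {x \<in> K i. \<delta>' x \<in> F (n + w)}"
        if xy: "x \<in> F p" "y \<in> F q" "p + q = n" "p < n" "q < n" for x y p q
      proof -
        obtain h where h: "fnl h" "\<forall>r\<in>K i. sg i r = L h r" using sigma_eq_L[OF i] by blast
        have K: "x \<in> K i" "y \<in> K i" using xy f.F_sub by auto
        then have "sg i x \<in> F p" using h f.F_L[OF h(1) xy(1)] by simp
        then have "sg i x * \<delta>' y \<in> F (p + (q + w))" by (rule f.F_mult[OF _ less.IH[OF xy(5,2)]])
        moreover have "\<delta>' x * y \<in> F ((p + w) + q)" by (rule f.F_mult[OF less.IH[OF xy(4,1)] xy(2)])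
        ultimately have "sg i x * \<delta>' y + \<delta>' x * y \<in> F (n + w)"
          using xy(3) by (intro subspace_add[OF f.F_subspace]) (simp_all add: add_ac flip: xy(3))
        then show ?thesis using K \<delta>'_mult o.RD(6) by simp
      qed
      then have "{x * y | x y p q. x \<in> F p \<and> y \<in> F q \<and> p + q = n \<and> p < n \<and> q < n} \<subseteq> {x \<in> K i. \<delta>' x \<in> F (n + w)}"
        by blast
      from span_minimal[OF this sub] show ?thesis using D[of n] False less.prems by auto
    qed
  qed
  interpret g: growth_step scale N K X sg dl \<Delta> \<epsilon> A i Y F m w
    by unfold_locales (use w \<delta>'_F TS_mono[OF w2, of UNIV "F w"] in auto)
  show ?thesis using g.growth_F' by blast
qed

end

context ore_bialgebra
begin

lemma growth_base: "growth_filtration scale N K X sg dl \<Delta> \<epsilon> (\<lambda>_. base_field scale) (base_field scale) 0"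
proof unfold_locales
  note bD = subalgebraD[OF base_subalgebra]
  show "subspace (base_field scale)" "1 \<in> base_field scale" by (rule bD)+
  show "x * y \<in> base_field scale" if "x \<in> base_field scale" "y \<in> base_field scale" for x y
    using that by (rule bD)
  show "L f x \<in> base_field scale" if "fnl f" "x \<in> base_field scale" for f x
  proof -
    obtain c where "x = scale c 1" using \<open>x \<in> base_field scale\<close> unfolding base_field_def by auto
    then have "L f x = scale (f (scale c 1)) 1" using D_base[of c] \<open>fnl f\<close> unfolding L_def zt_def by simp
    then show ?thesis unfolding base_field_def by blast
  qed
  show "\<exists>S. finite S \<and> card S \<le> (n + 1) ^ 0 \<and> base_field scale \<subseteq> span S" for n :: nat
    by (rule exI[of _ "{1}"]) (auto simp: base_field_def intro: span_scale span_base)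
  show "\<exists>D::nat. \<forall>n>D. base_field scale \<subseteq> span {x * y | x y p q. x \<in> base_field scale \<and>
      y \<in> base_field scale \<and> p + q = n \<and> p < n \<and> q < n}"
  \<comment> \<open>For \<open>n > 1\<close> an element splits as \<open>c * 1\<close> with degrees
    \<open>1\<close> and \<open>n - 1\<close>, both below \<open>n\<close>.\<close>
  proof (intro exI[of _ 1] allI impI subsetI)
    fix n :: nat and c assume n: "1 < n" and c: "c \<in> base_field scale"
    have "c * 1 \<in> {x * y | x y p q. x \<in> base_field scale \<and> y \<in> base_field scale \<and> p + q = n \<and> p < n \<and> q < n}"
      by (intro CollectI exI[of _ c] exI[of _ "1::'h"] exI[of _ "1::nat"] exI[of _ "n - 1"] conjI) (use n c bD(3) in auto)
    from span_base[OF this] show "c \<in> span {x * y | x y p q. x \<in> base_field scale \<and> y \<in> base_field scale \<and> p + q = n \<and> p < n \<and> q < n}"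
      by simp
  qed
qed auto

end

section \<open>Dimension bounds for powers of a generating space\<close>

context k_algebra
begin

lemma power_span_subset:
  assumes sub: "\<And>n. subspace (F n)" and "1 \<in> F 0" and mono: "\<And>p q. p \<le> q \<Longrightarrow> F p \<subseteq> F q"
    and mult: "\<And>x y p q. x \<in> F p \<Longrightarrow> y \<in> F q \<Longrightarrow> x * y \<in> F (p + q)" and V: "V \<subseteq> F p"
  shows "power_span scale V n \<subseteq> F (p * n)"
proof -
  have *: "prod_list ws \<in> F (p * length ws)" if "set ws \<subseteq> V" for ws
    using that
  proof (induction ws)
    case (Cons a ws)
    then show ?case using mult[of a p "prod_list ws" "p * length ws"] V by auto
  qed (use assms in simp)
  have "prod_list ws \<in> F (p * n)" if "set ws \<subseteq> V" "length ws \<le> n" for ws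
    using *[OF that(1)] mono[of "p * length ws" "p * n"] that(2) by auto
  then have "{prod_list ws | ws. set ws \<subseteq> V \<and> length ws \<le> n} \<subseteq> F (p * n)" by auto
  then show ?thesis unfolding power_span_def by (rule span_minimal[OF _ sub])
qed

text \<open>The lower bound is obtained from monomials: after adjoining \<open>Y\<close> to \<open>V\<close>, the products of
  independent elements of \<open>V\<^sup>m\<^sup>n\<close> with \<open>1, Y, \<dots>, Y\<^sup>n\<close> stay independent.\<close>

definition grows_like :: "'h set \<Rightarrow> nat \<Rightarrow> bool" where
  "grows_like A m \<longleftrightarrow> (\<exists>V. finite V \<and> V \<subseteq> A \<and>
     (\<forall>n. \<exists>E. finite E \<and> independent E \<and> card E = (n + 1) ^ m \<and> E \<subseteq> power_span scale V (m * n)))"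

lemma power_span_mult_power:
  assumes "x \<in> power_span scale V p" and "Y \<in> V" and "j \<le> n"
  shows "x * Y ^ j \<in> power_span scale V (p + n)"
proof -
  have "prod_list ws * Y ^ j \<in> power_span scale V (p + n)" if "set ws \<subseteq> V" "length ws \<le> p" for ws
  proof -
    have "prod_list (ws @ replicate j Y) = prod_list ws * Y ^ j" by simp
    moreover have "set (ws @ replicate j Y) \<subseteq> V" "length (ws @ replicate j Y) \<le> p + n"
      using that assms(2,3) by auto
    ultimately show ?thesis unfolding power_span_def
      by (intro span_base CollectI) (metis (no_types, lifting))
  qed
  then have "{prod_list ws | ws. set ws \<subseteq> V \<and> length ws \<le> p} \<subseteq> {x. x * Y ^ j \<in> power_span scale V (p + n)}"
    by auto
  moreover have "subspace {x. x * Y ^ j \<in> power_span scale V (p + n)}"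
    unfolding power_span_def
    by (rule subspaceI) (auto simp: subspace_0 span_zero span_add span_scale distrib_right scale_mult_left)
  ultimately have "span {prod_list ws | ws. set ws \<subseteq> V \<and> length ws \<le> p} \<subseteq> {x. x * Y ^ j \<in> power_span scale V (p + n)}"
    by (rule span_minimal)
  then show ?thesis using assms(1) unfolding power_span_def by blast
qed

lemma power_span_mono: "V \<subseteq> W \<Longrightarrow> power_span scale V n \<subseteq> power_span scale W n"
  unfolding power_span_def by (intro span_mono) blast

lemma grows_like_extend:
  assumes A: "grows_like A m" and sub: "subspace A" and "A \<subseteq> B" "Y \<in> B"
    and free: "\<And>n c j. (\<And>j. j < n \<Longrightarrow> c j \<in> A) \<Longrightarrow> (\<Sum>j<n. c j * Y ^ j) = 0 \<Longrightarrow> j < n \<Longrightarrow> c j = 0"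
    and alg: "subalgebra scale A"
  shows "grows_like B (Suc m)"
proof -
  obtain V where V: "finite V" "V \<subseteq> A"
    "\<And>n. \<exists>E. finite E \<and> independent E \<and> card E = (n + 1) ^ m \<and> E \<subseteq> power_span scale V (m * n)"
    using A unfolding grows_like_def by blast
  have VA: "power_span scale V n \<subseteq> A" for n
    using power_span_subset[of "\<lambda>_. A" V 0 n] alg V(2) unfolding subalgebra_def by auto
  have "\<exists>E. finite E \<and> independent E \<and> card E = (n + 1) ^ Suc m \<and> E \<subseteq> power_span scale (insert Y V) (Suc m * n)" for n
  proof -
    obtain E where E: "finite E" "independent E" "card E = (n + 1) ^ m" "E \<subseteq> power_span scale V (m * n)"
      using V(3) by blast
    have EA: "E \<subseteq> A" using E(4) VA by blast
    define g where "g = (\<lambda>(e, j). e * Y ^ j)"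
    define P where "P = E \<times> {..<Suc n}"
    have finP: "finite P" unfolding P_def using E by auto
    \<comment> \<open>Grouped by powers of \<open>Y\<close>, a linear relation has coefficients in
      \<open>A\<close>; these vanish by \<open>free\<close>, and then the independence of
      \<open>E\<close> applies.\<close>
    have indep: "u q = 0" if "(\<Sum>p\<in>P. scale (u p) (g p)) = 0" "q \<in> P" for u q
    proof -
      obtain e j where q: "q = (e, j)" "e \<in> E" "j < Suc n" using \<open>q \<in> P\<close> unfolding P_def by auto
      have "(\<Sum>p\<in>P. scale (u p) (g p)) = (\<Sum>e\<in>E. \<Sum>j<Suc n. scale (u (e, j)) (e * Y ^ j))"
        unfolding P_def g_def by (simp only: sum.cartesian_product) (auto intro!: sum.cong)
      also have "\<dots> = (\<Sum>j<Suc n. (\<Sum>e\<in>E. scale (u (e, j)) e) * Y ^ j)"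
        by (subst sum.swap) (simp only: sum_distrib_right scale_mult_left)
      finally have "(\<Sum>j<Suc n. (\<Sum>e\<in>E. scale (u (e, j)) e) * Y ^ j) = 0" using that(1) by simp
      moreover have "(\<Sum>e\<in>E. scale (u (e, j)) e) \<in> A" for j
        using EA sub by (intro subspace_sum subspace_scale) auto
      ultimately have "(\<Sum>e\<in>E. scale (u (e, j)) e) = 0"
        using free[of "Suc n" "\<lambda>j. \<Sum>e\<in>E. scale (u (e, j)) e" j] q(3) by blast
      then show ?thesis using independentD[OF E(2,1) order_refl, of "\<lambda>e. u (e, j)" e] q by simp
    qed
    have inj: "inj_on g P"
    proof (rule inj_onI, rule ccontr)
      fix p q assume pq: "p \<in> P" "q \<in> P" "g p = g q" "p \<noteq> q"
      \<comment> \<open>A coincidence \<open>g p = g q\<close> is read as a linear relation with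
        coefficients \<open>1\<close> and \<open>-1\<close>.\<close>
      define u :: "'h \<times> nat \<Rightarrow> 'k" where "u r = (if r = p then 1 else 0) - (if r = q then 1 else 0)" for r
      have "(\<Sum>r\<in>P. scale (u r) (g r)) = (\<Sum>r\<in>P. if r = p then g r else 0) - (\<Sum>r\<in>P. if r = q then g r else 0)"
        unfolding sum_subtractf[symmetric] u_def by (intro sum.cong) (auto simp: scale_left_diff_distrib)
      also have "\<dots> = 0" using pq finP by simp
      finally have "u p = 0" using indep pq(1) by blast
      then show False using pq(4) unfolding u_def by simp
    qed
    have "independent (g ` P)"
    proof (rule independent_if_scalars_zero)
      show "finite (g ` P)" using finP by simp
      fix f x assume f: "(\<Sum>x\<in>g ` P. scale (f x) x) = 0" and x: "x \<in> g ` P"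
      obtain p where p: "p \<in> P" "x = g p" using x by blast
      have "(\<Sum>p\<in>P. scale (f (g p)) (g p)) = 0" using f sum.reindex[OF inj, of "\<lambda>x. scale (f x) x"] by simp
      then show "f x = 0" using indep[of "\<lambda>p. f (g p)"] p by simp
    qed
    moreover have "card (g ` P) = (n + 1) ^ Suc m"
      using card_image[OF inj] E(3) unfolding P_def by (simp add: card_cartesian_product)
    moreover have "g ` P \<subseteq> power_span scale (insert Y V) (Suc m * n)"
    proof
      fix x assume "x \<in> g ` P"
      then obtain e j where x: "x = e * Y ^ j" "e \<in> E" "j \<le> n" unfolding P_def g_def by auto
      have "e \<in> power_span scale (insert Y V) (m * n)"
        using x(2) E(4) power_span_mono[of V "insert Y V"] by blast
      from power_span_mult_power[OF this _ x(3), of Y] show "x \<in> power_span scale (insert Y V) (Suc m * n)"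
        using x(1) by (simp add: add.commute)
    qed
    ultimately show ?thesis using finP by blast
  qed
  moreover have "finite (insert Y V)" "insert Y V \<subseteq> B" using V assms by auto
  ultimately show ?thesis unfolding grows_like_def by blast
qed

lemma grows_like_base: "1 \<in> A \<Longrightarrow> grows_like A 0"
proof -
  assume "1 \<in> A"
  have "independent {1::'h}" by (simp add: dependent_single)
  moreover have "1 \<in> power_span scale {} 0"
    unfolding power_span_def by (intro span_base) auto
  ultimately show ?thesis unfolding grows_like_def
    by (intro exI[of _ "{}"]) (auto intro!: exI[of _ "{1::'h}"])
qed

end

section \<open>The Gelfand-Kirillov dimension from the two growth bounds\<close>

context growth_filtration
begin

text \<open>With \<open>V\<close> inside \<open>F p\<close>, products of at most \<open>n\<close>
  elements of \<open>V\<close> lie in \<open>F (p * n)\<close>, which is spanned by at most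
  \<open>(p * n + 1) ^ m\<close> elements.\<close>

lemma GKdim_le: "GKdim scale A \<le> ereal (real m)"
  unfolding GKdim_def
proof (rule SUP_least)
  fix V assume "V \<in> {V. V \<subseteq> A \<and> (\<exists>B. finite B \<and> V = span B)}"
  then obtain B where V: "V \<subseteq> A" "finite B" "V = span B" by blast
  obtain p where "B \<subseteq> F p" using finite_in_F[OF V(2)] V(1,3) span_superset by blast
  then have "V \<subseteq> F p" using span_minimal[OF _ F_subspace] V(3) by blast
  then have sub: "power_span scale V n \<subseteq> F (p * n)" for n
    using power_span_subset[of F V p n] F_subspace F_one F_mono F_mult by blast
  have dim: "vector_space.dim scale (power_span scale V n) \<le> (p * n + 1) ^ m" for n
  proof -
    obtain S where "finite S" "card S \<le> (p * n + 1) ^ m" "F (p * n) \<subseteq> span S" using F_dim by blast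
    moreover from this have "power_span scale V n \<subseteq> span S" using sub[of n] by blast
    ultimately show ?thesis using dim_le_card[of "power_span scale V n" S] by linarith
  qed
  \<comment> \<open>For \<open>n \<ge> 2\<close> this is the logarithm to base \<open>n\<close> of
    \<open>((p + 1) * n) ^ m\<close>, which bounds the dimension.\<close>
  define g where "g n = real m * (1 + ln (real (p + 1)) / ln (real n))" for n
  have bound: "log (real n) (real (vector_space.dim scale (power_span scale V n))) \<le> g n" if "n \<ge> 2" for n
  proof -
    let ?d = "vector_space.dim scale (power_span scale V n)"
    have lnn: "ln (real n) > 0" using that by simp
    have le: "real ?d \<le> (real (p + 1) * real n) ^ m"
    proof -
      have "(p * n + 1) ^ m \<le> ((p + 1) * n) ^ m" using that by (intro power_mono) auto
      then have "?d \<le> ((p + 1) * n) ^ m" using dim[of n] by linarith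
      then have "real ?d \<le> real (((p + 1) * n) ^ m)" by linarith
      then show ?thesis by (simp only: of_nat_mult of_nat_power)
    qed
    have "ln (real ?d) \<le> real m * (ln (real (p + 1)) + ln (real n))"
    proof (cases "?d = 0")
      case True
      have "0 \<le> ln (real (p + 1))" by simp
      then show ?thesis using True lnn by simp
    next
      case False
      have "ln (real ?d) \<le> ln ((real (p + 1) * real n) ^ m)"
        using le False by (intro ln_mono) auto
      also have "\<dots> = real m * ln (real (p + 1) * real n)"
        using that by (subst ln_realpow) auto
      also have "\<dots> = real m * (ln (real (p + 1)) + ln (real n))"
        using that by (subst ln_mult) auto
      finally show ?thesis .
    qed
    then have "ln (real ?d) / ln (real n) \<le> real m * (ln (real (p + 1)) + ln (real n)) / ln (real n)"
      using lnn by (intro divide_right_mono) auto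
    also have "\<dots> = g n" unfolding g_def using lnn by (simp add: field_simps)
    finally show ?thesis by (simp add: log_def)
  qed
  have "filterlim (\<lambda>n. ln (real n)) at_top sequentially"
    by (rule filterlim_compose[OF ln_at_top filterlim_real_sequentially])
  then have "(\<lambda>n. ln (real (p + 1)) / ln (real n)) \<longlonglongrightarrow> 0"
    by (intro tendsto_divide_0[OF tendsto_const] filterlim_at_top_imp_at_infinity)
  then have "g \<longlonglongrightarrow> real m * (1 + 0)" unfolding g_def by (intro tendsto_intros)
  then have lim: "(\<lambda>n. ereal (g n)) \<longlonglongrightarrow> ereal (real m)" by simp
  have "limsup (\<lambda>n. ereal (log (real n) (real (vector_space.dim scale (power_span scale V n)))))
      \<le> limsup (\<lambda>n. ereal (g n))"
    by (rule Limsup_mono) (use bound in \<open>auto intro!: eventually_sequentiallyI[of 2]\<close>)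
  also have "\<dots> = ereal (real m)" using lim_imp_Limsup[OF _ lim] by simp
  finally show "limsup (\<lambda>n. ereal (log (real n) (real (vector_space.dim scale (power_span scale V n)))))
      \<le> ereal (real m)" .
qed

text \<open>Products of up to \<open>m * (n div m)\<close> factors are among those of up to
  \<open>n\<close> factors, so the dimension is at least \<open>(n / m) ^ m\<close> for positive
  \<open>m\<close>; the constant \<open>m\<close> in the denominator disappears in the limit of
  logarithms.\<close>

lemma GKdim_ge:
  assumes A: "subspace A" and grows: "grows_like A m"
  shows "ereal (real m) \<le> GKdim scale A"
proof -
  obtain V where V: "finite V" "V \<subseteq> A"
    "\<And>n. \<exists>E. finite E \<and> independent E \<and> card E = (n + 1) ^ m \<and> E \<subseteq> power_span scale V (m * n)"
    using grows unfolding grows_like_def by blast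
  define W where "W = span V"
  have W: "W \<subseteq> A" unfolding W_def using V(2) A by (rule span_minimal)
  obtain p where "V \<subseteq> F p" using finite_in_F[OF V(1,2)] by blast
  then have "W \<subseteq> F p" unfolding W_def using F_subspace by (rule span_minimal)
  then have sub: "power_span scale W n \<subseteq> F (p * n)" for n
    using power_span_subset[of F W p n] F_subspace F_one F_mono F_mult by blast
  have dim: "(n div m + 1) ^ m \<le> vector_space.dim scale (power_span scale W n)" for n
  proof -
    obtain S where S: "finite S" "F (p * n) \<subseteq> span S" using F_dim by blast
    obtain E where E: "finite E" "independent E" "card E = (n div m + 1) ^ m"
      "E \<subseteq> power_span scale V (m * (n div m))" using V(3) by blast
    have "power_span scale V (m * (n div m)) \<subseteq> power_span scale V n"
      unfolding power_span_def
      by (intro span_mono) (use times_div_less_eq_dividend[of m n] in \<open>blast intro: order_trans\<close>)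
    also have "\<dots> \<subseteq> power_span scale W n"
      by (rule power_span_mono) (simp add: W_def span_superset)
    finally have EW: "E \<subseteq> power_span scale W n" using E(4) by blast
    obtain B where B: "B \<subseteq> power_span scale W n" "independent B" "power_span scale W n \<subseteq> span B"
      "card B = dim (power_span scale W n)"
      using basis_exists[of "power_span scale W n"] by metis
    \<comment> \<open>Finiteness matters here: an infinite basis has cardinality \<open>0\<close> by
      convention, and no lower bound on \<open>dim\<close> would follow.\<close>
    have "B \<subseteq> span S" using B(1) sub[of n] S(2) by blast
    then have "finite B" using independent_span_bound[OF S(1) B(2)] by blast
    moreover have "E \<subseteq> span B" using EW B(3) by blast
    ultimately have "card E \<le> card B" using independent_span_bound[OF _ E(2)] by blast
    then show ?thesis using E(3) B(4) by simp
  qed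
  \<comment> \<open>For positive \<open>m\<close> and \<open>n \<ge> 2\<close> this is the logarithm
    to base \<open>n\<close> of \<open>(n / m) ^ m\<close>.\<close>
  define g where "g n = real m * (1 - ln (real m) / ln (real n))" for n
  have bound: "g n \<le> log (real n) (real (vector_space.dim scale (power_span scale W n)))" if "n \<ge> 2" for n
  proof -
    let ?d = "vector_space.dim scale (power_span scale W n)"
    have lnn: "ln (real n) > 0" using that by simp
    have d1: "1 \<le> ?d" using dim[of n] by (meson le_trans one_le_power le_add2)
    have "real m * (ln (real n) - ln (real m)) \<le> ln (real ?d)"
    proof (cases "m = 0")
      case True
      then show ?thesis using d1 by simp
    next
      case False
      have "n < (n div m + 1) * m" using False dividend_less_times_div[of m n] by (simp add: algebra_simps)
      then have "real n < real ((n div m + 1) * m)" by linarith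
      then have "real n / real m \<le> real (n div m + 1)" using False by (simp add: field_simps)
      then have "(real n / real m) ^ m \<le> real (n div m + 1) ^ m" by (intro power_mono) auto
      also have "\<dots> = real ((n div m + 1) ^ m)" by simp
      also have "\<dots> \<le> real ?d" using dim[of n] by (intro of_nat_mono)
      finally have "ln ((real n / real m) ^ m) \<le> ln (real ?d)"
        using False that by (intro ln_mono) auto
      moreover have "ln ((real n / real m) ^ m) = real m * (ln (real n) - ln (real m))"
        using False that by (subst ln_realpow) (auto simp: ln_div)
      ultimately show ?thesis by simp
    qed
    then have "real m * (ln (real n) - ln (real m)) / ln (real n) \<le> ln (real ?d) / ln (real n)"
      using lnn by (intro divide_right_mono) auto
    moreover have "real m * (ln (real n) - ln (real m)) / ln (real n) = g n"
      unfolding g_def using lnn by (simp add: field_simps)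
    ultimately show ?thesis by (simp add: log_def)
  qed
  have "filterlim (\<lambda>n. ln (real n)) at_top sequentially"
    by (rule filterlim_compose[OF ln_at_top filterlim_real_sequentially])
  then have "(\<lambda>n. ln (real m) / ln (real n)) \<longlonglongrightarrow> 0"
    by (intro tendsto_divide_0[OF tendsto_const] filterlim_at_top_imp_at_infinity)
  then have "g \<longlonglongrightarrow> real m * (1 - 0)" unfolding g_def by (intro tendsto_intros)
  then have lim: "(\<lambda>n. ereal (g n)) \<longlonglongrightarrow> ereal (real m)" by simp
  have "ereal (real m) = limsup (\<lambda>n. ereal (g n))" using lim_imp_Limsup[OF _ lim] by simp
  also have "\<dots> \<le> limsup (\<lambda>n. ereal (log (real n) (real (vector_space.dim scale (power_span scale W n)))))"
    by (rule Limsup_mono) (use bound in \<open>auto intro!: eventually_sequentiallyI[of 2]\<close>)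
  also have "\<dots> \<le> GKdim scale A"
    unfolding GKdim_def by (rule SUP_upper) (use W V(1) W_def in auto)
  finally show ?thesis .
qed

end

section \<open>Assembling the chain of coideal subalgebras\<close>

context ore_bialgebra_char_0
begin

lemma coideal_int:
  assumes "coideal A" "i \<le> N" shows "coideal (A \<inter> K i)"
proof -
  have "subalgebra scale (A \<inter> K i)"
    using assms K_subalgebra[of i] unfolding coideal_def subalgebra_def by (auto intro: subspace_inter)
  moreover have "L f x \<in> K i" if "fnl f" "x \<in> K i" for f x
    using sl_in[OF KD(1)[OF assms(2)] that(1) D_K[OF assms(2) that(2)]] unfolding L_def .
  ultimately show ?thesis using assms unfolding coideal_def by blast
qed

text \<open>\<open>i\<close> runs along the given chain, while \<open>m\<close> counts the steps at
  which the intersection with \<open>A\<close> really grows; equal intersections are merged, which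
  makes the inclusions strict. Both growth bounds travel in the same induction, so that this
  \<open>m\<close> can be recognized as the dimension.\<close>

lemma coideal_chain_upto:
  assumes A: "coideal A" and "i \<le> N"
  shows "\<exists>m C. C 0 = base_field scale \<and> C m = A \<inter> K i \<and> (\<forall>j\<le>m. coideal (C j)) \<and>
    (\<forall>j<m. C j \<subset> C (Suc j) \<and> ore_extension scale (C j) (C (Suc j))) \<and>
    (\<exists>F. growth_filtration scale N K X sg dl \<Delta> \<epsilon> F (A \<inter> K i) m) \<and> grows_like (A \<inter> K i) m"
  using assms(2)
proof (induction i)
  case 0
  have subA: "subalgebra scale A" using A unfolding coideal_def by blast
  have "base_field scale \<subseteq> A" using subalgebraD(3,7)[OF subA] unfolding base_field_def by auto
  then have "A \<inter> K 0 = base_field scale" using K_0 by auto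
  moreover have "grows_like (base_field scale) 0"
    by (rule grows_like_base) (rule subalgebraD(3)[OF base_subalgebra])
  ultimately show ?case
    using coideal_int[OF A, of 0] growth_base
    by (intro exI[of _ 0] exI[of _ "\<lambda>_. base_field scale"]) auto
next
  case (Suc i)
  then obtain m C F where C: "C 0 = base_field scale" "C m = A \<inter> K i" "\<forall>j\<le>m. coideal (C j)"
    "\<forall>j<m. C j \<subset> C (Suc j) \<and> ore_extension scale (C j) (C (Suc j))"
    and F: "growth_filtration scale N K X sg dl \<Delta> \<epsilon> F (A \<inter> K i) m" and gr: "grows_like (A \<inter> K i) m"
    by (metis Suc_leD)
  have i: "i < N" using Suc.prems by simp
  show ?case
  proof (cases "A \<inter> K (Suc i) = A \<inter> K i")
    case True
    then show ?thesis using C F gr by auto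
  next
    case False
    obtain Y where Y: "Y \<in> A \<inter> K (Suc i)" "Y - X i \<in> K i" using coideal_variable[OF i A False] by blast
    interpret s: coideal_step scale N K X sg dl \<Delta> \<epsilon> A i Y
      by unfold_locales (use i A Y in auto)
    define C' where "C' = C(Suc m := A \<inter> K (Suc i))"
    have sub: "subalgebra scale (A \<inter> K i)" using s.int_subalgebra i by simp
    have "A \<inter> K i \<subset> A \<inter> K (Suc i)" using False s.o.RB by blast
    moreover have "grows_like (A \<inter> K (Suc i)) (Suc m)"
    proof (rule grows_like_extend[OF gr subalgebraD(1)[OF sub] _ Y(1) _ sub])
      show "A \<inter> K i \<subseteq> A \<inter> K (Suc i)" using s.o.RB by blast
      show "c j = 0" if "\<And>j. j < n \<Longrightarrow> c j \<in> A \<inter> K i" "(\<Sum>j<n. c j * Y ^ j) = 0" "j < n" for n c j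
        using s.Y_independent[of n c j] that by blast
    qed
    moreover have "\<exists>F. growth_filtration scale N K X sg dl \<Delta> \<epsilon> F (A \<inter> K (Suc i)) (Suc m)"
      by (rule s.growth_extend[OF F])
    moreover have "coideal (A \<inter> K (Suc i))" by (rule coideal_int[OF A Suc.prems])
    ultimately show ?thesis
      using C s.ore_A unfolding C'_def[symmetric]
      by (intro exI[of _ "Suc m"] exI[of _ C']) (auto simp: C'_def less_Suc_eq le_Suc_eq)
  qed
qed

theorem coideal_chain:
  assumes A: "coideal A"
  shows "\<exists>m C. C 0 = base_field scale \<and> C m = A \<and> GKdim scale A = ereal (real m) \<and>
    (\<forall>j\<le>m. coideal (C j)) \<and> (\<forall>j<m. C j \<subset> C (Suc j) \<and> ore_extension scale (C j) (C (Suc j)))"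
proof -
  obtain m C F where C: "C 0 = base_field scale" "C m = A" "\<forall>j\<le>m. coideal (C j)"
    "\<forall>j<m. C j \<subset> C (Suc j) \<and> ore_extension scale (C j) (C (Suc j))"
    and F: "growth_filtration scale N K X sg dl \<Delta> \<epsilon> F A m" and gr: "grows_like A m"
    using coideal_chain_upto[OF A order_refl] K_N by auto
  interpret f: growth_filtration scale N K X sg dl \<Delta> \<epsilon> F A m by (rule F)
  have "subspace A" using A unfolding coideal_def subalgebra_def by blast
  then have "GKdim scale A = ereal (real m)" using f.GKdim_le f.GKdim_ge[OF _ gr] by (intro antisym) auto
  then show ?thesis using C by blast
qed

end

section \<open>Hopf algebras as bialgebras over the tensor ring\<close>

interpretation free: vector_space "free_scale :: 'k::field \<Rightarrow> ('b \<Rightarrow>\<^sub>0 'k) \<Rightarrow> ('b \<Rightarrow>\<^sub>0 'k)"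
  by (rule vector_space_free_scale)

text \<open>Passes from pairs, where the tensor product is given by relations, to
  \<open>pmon\<close>, where it is a ring modulo an ideal. That the relations match \<open>Z\<close>
  exactly is \<open>tensor_rel_zt\<close> together with \<open>zt_tensor_rel\<close>.\<close>

definition tensor_ring_of :: "(('h::ring_1 \<times> 'h) \<Rightarrow>\<^sub>0 'k::field) \<Rightarrow> ('h pmon \<Rightarrow>\<^sub>0 'k)" where
  "tensor_ring_of u = lin_ext free_scale (\<lambda>(a, b). pu a b) u"

lemma tensor_ring_of_simps [simp]:
  "tensor_ring_of 0 = 0" "tensor_ring_of (u + v) = tensor_ring_of u + tensor_ring_of v"
  "tensor_ring_of (u - v) = tensor_ring_of u - tensor_ring_of v"
  "tensor_ring_of (free_scale c u) = free_scale c (tensor_ring_of u)"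
  "tensor_ring_of (Poly_Mapping.single (a, b) c) = Poly_Mapping.single (PM a b) c"
  by (simp_all add: tensor_ring_of_def pu_def)

lemma free_scale_mult_left: "free_scale c s * t = free_scale c (s * (t :: 'h::ring_1 pmon \<Rightarrow>\<^sub>0 'k::field))"
proof -
  have "free_scale c (u :: 'h pmon \<Rightarrow>\<^sub>0 'k) = Poly_Mapping.single 0 c * u" for u
  proof (induction u rule: poly_mapping_add_induct)
    case (add p d u)
    then show ?case by (simp add: distrib_left mult_single)
  qed simp
  then show ?thesis by (simp add: mult.assoc)
qed

lemma tensor_ring_of_mult: "tensor_ring_of (tensor_mult u v) = tensor_ring_of u * tensor_ring_of v"
proof (induction u rule: poly_mapping_add_induct)
  case zero
  then show ?case by (simp add: tensor_mult_def)
next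
  case (add p c u)
  obtain a b where p: "p = (a, b)" by fastforce
  have "tensor_ring_of (lin_ext free_scale (\<lambda>(c, d). pure (a * c, b * d)) v) = pu a b * tensor_ring_of v"
  proof (induction v rule: poly_mapping_add_induct)
    case (add q d v)
    then show ?case by (cases q) (simp add: pu_def mult_single distrib_left)
  qed simp
  moreover have "Poly_Mapping.single (PM a b) c = free_scale c (pu a b)" by (simp add: pu_def)
  ultimately show ?case using add by (simp add: tensor_mult_def p distrib_right free_scale_mult_left)
qed

context vector_space
begin

lemma lin_ext_lin_ext:
  "lin_ext scale \<phi> (lin_ext free_scale \<psi> t) = lin_ext scale (\<lambda>p. lin_ext scale \<phi> (\<psi> p)) t"
  by (induction t rule: poly_mapping_add_induct) simp_all

lemma linear_lin_ext:
  assumes "\<And>x y. h (x + y) = h x + h y" "\<And>c x. h (scale c x) = scale c (h x)"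
  shows "h (lin_ext scale \<phi> t) = lin_ext scale (\<lambda>p. h (\<phi> p)) t"
proof -
  have "h 0 = 0" using assms(2)[of 0 0] by simp
  then show ?thesis using assms by (induction t rule: poly_mapping_add_induct) simp_all
qed

end

section \<open>Comparison of the two models of the tensor square\<close>

context k_algebra
begin

lemma SL_tensor_ring_of: "SL f (tensor_ring_of u) = lin_ext scale (\<lambda>(a, b). scale (f a) b) u"
  by (induction u rule: poly_mapping_add_induct) auto

lemma SR_tensor_ring_of: "SR f (tensor_ring_of u) = lin_ext scale (\<lambda>(a, b). scale (f b) a) u"
  by (induction u rule: poly_mapping_add_induct) auto

lemma SL_free_scale [simp]: "SL f (free_scale c t) = scale c (SL f t)"
  by (simp add: sl_def)

text \<open>The universal property of the tensor product: a bilinear \<open>\<phi>\<close> kills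
  each generator of the relations.\<close>

lemma lin_ext_tensor_rel:
  assumes "u \<in> tensor_rel scale"
    and "\<And>x x' y. \<phi> (x + x', y) = \<phi> (x, y) + \<phi> (x', y)" "\<And>x y y'. \<phi> (x, y + y') = \<phi> (x, y) + \<phi> (x, y')"
    and "\<And>c x y. \<phi> (scale c x, y) = scale c (\<phi> (x, y))" "\<And>c x y. \<phi> (x, scale c y) = scale c (\<phi> (x, y))"
  shows "lin_ext scale \<phi> u = 0"
proof -
  have "tensor_rel scale \<subseteq> {u. lin_ext scale \<phi> u = 0}"
    unfolding tensor_rel_def
    by (rule free.span_minimal) (auto simp: assms(2-) intro!: free.subspaceI)
  then show ?thesis using assms(1) by blast
qed

lemma lin_ext_tensor3_rel:
  assumes "u \<in> tensor3_rel scale"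
    and "\<And>x x' y z. \<phi> (x + x', y, z) = \<phi> (x, y, z) + \<phi> (x', y, z)"
      "\<And>x y y' z. \<phi> (x, y + y', z) = \<phi> (x, y, z) + \<phi> (x, y', z)"
      "\<And>x y z z'. \<phi> (x, y, z + z') = \<phi> (x, y, z) + \<phi> (x, y, z')"
      "\<And>c x y z. \<phi> (scale c x, y, z) = scale c (\<phi> (x, y, z))"
      "\<And>c x y z. \<phi> (x, scale c y, z) = scale c (\<phi> (x, y, z))"
      "\<And>c x y z. \<phi> (x, y, scale c z) = scale c (\<phi> (x, y, z))"
  shows "lin_ext scale \<phi> u = 0"
proof -
  have "tensor3_rel scale \<subseteq> {u. lin_ext scale \<phi> u = 0}"
    unfolding tensor3_rel_def
    by (rule free.span_minimal) (auto simp: assms(2-) intro!: free.subspaceI)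
  then show ?thesis using assms(1) by blast
qed

lemma tensor_rel_zt: "u \<in> tensor_rel scale \<Longrightarrow> tensor_ring_of u \<in> Z"
  unfolding zt_def
proof (intro CollectI allI impI)
  fix f assume "u \<in> tensor_rel scale" and f: "fnl f"
  then show "SL f (tensor_ring_of u) = 0"
    unfolding SL_tensor_ring_of
    by (elim lin_ext_tensor_rel)
       (simp_all add: functionalD(1,2)[OF f] scale_left_distrib scale_right_distrib mult.commute)
qed

lemma tensor_eq_zt: "tensor_eq scale u v \<Longrightarrow> tensor_ring_of u - tensor_ring_of v \<in> Z"
  unfolding tensor_eq_def using tensor_rel_zt[of "u - v"] by simp

text \<open>Modulo the relations, \<open>w\<close> is a sum of tensors \<open>b \<otimes> y\<close>
  with \<open>b\<close> in a basis and \<open>y\<close> the slice of \<open>w\<close> along the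
  coordinate of \<open>b\<close>; all these slices vanish. Thus functionals separate the points of
  \<open>H \<otimes> H\<close>.\<close>

lemma zt_tensor_rel:
  assumes "tensor_ring_of w \<in> Z" shows "w \<in> tensor_rel scale"
proof -
  let ?R = "tensor_rel scale"
  have R: "free.subspace ?R" unfolding tensor_rel_def by (rule free.subspace_span)
  note R_diff = free.subspace_diff[OF R] and R_add = free.subspace_add[OF R] and R_sum = free.subspace_sum[OF R]
  have add_l: "pure (x + x', y) - pure (x, y) - pure (x', y) \<in> ?R" for x x' y
    unfolding tensor_rel_def by (rule free.span_base) blast
  have add_r: "pure (x, y + y') - pure (x, y) - pure (x, y') \<in> ?R" for x y y'
    unfolding tensor_rel_def by (rule free.span_base) blast
  have scale_l: "pure (scale c x, y) - free_scale c (pure (x, y)) \<in> ?R" for c x y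
    unfolding tensor_rel_def by (rule free.span_base) blast
  have scale_r: "pure (x, scale c y) - free_scale c (pure (x, y)) \<in> ?R" for c x y
    unfolding tensor_rel_def by (rule free.span_base) blast
  have zero_l: "pure (0, y) \<in> ?R" for y using scale_l[of 0 0 y] by simp
  have zero_r: "pure (x, 0) \<in> ?R" for x using scale_r[of x 0 0] by simp
  have sum_l: "pure (\<Sum>e\<in>E. h e, y) - (\<Sum>e\<in>E. pure (h e, y)) \<in> ?R" if "finite E" for E :: "'h set" and h y
    using that
  proof (induction E)
    case (insert e E)
    have "(pure (h e + sum h E, y) - pure (h e, y) - pure (sum h E, y)) + (pure (sum h E, y) - (\<Sum>e\<in>E. pure (h e, y))) \<in> ?R"
      by (rule R_add[OF add_l insert.IH])
    then show ?case using insert by (simp add: algebra_simps)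
  qed (simp add: zero_l)
  have sum_r: "pure (x, \<Sum>e\<in>E. h e) - (\<Sum>e\<in>E. pure (x, h e)) \<in> ?R" if "finite E" for E :: "('h \<times> 'h) set" and h x
    using that
  proof (induction E)
    case (insert e E)
    have "(pure (x, h e + sum h E) - pure (x, h e) - pure (x, sum h E)) + (pure (x, sum h E) - (\<Sum>e\<in>E. pure (x, h e))) \<in> ?R"
      by (rule R_add[OF add_r insert.IH])
    then show ?case using insert by (simp add: algebra_simps)
  qed (simp add: zero_r)
  define B where "B = extend_basis ({} :: 'h set)"
  have B: "independent B" "span B = UNIV"
    unfolding B_def using independent_extend_basis[OF independent_empty] span_extend_basis[OF independent_empty] by simp_all
  define e where "e b x = representation B x b" for b x
  have e: "fnl (e b)" for b unfolding e_def using fnl_representation[OF B] .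
  define E where "E = (\<Union>p\<in>Poly_Mapping.keys w. {b. representation B (fst p) b \<noteq> 0})"
  have finE: "finite E" unfolding E_def using finite_representation by auto
  have expand: "fst p = (\<Sum>b\<in>E. scale (e b (fst p)) b)" if "p \<in> Poly_Mapping.keys w" for p
  proof -
    have "fst p = (\<Sum>b | representation B (fst p) b \<noteq> 0. scale (representation B (fst p) b) b)"
      using sum_nonzero_representation_eq[OF B(1), of "fst p"] B(2) by simp
    also have "\<dots> = (\<Sum>b\<in>E. scale (e b (fst p)) b)"
      using that finE unfolding e_def E_def by (intro sum.mono_neutral_left) auto
    finally show ?thesis .
  qed
  let ?c = "Poly_Mapping.lookup w"
  let ?term = "\<lambda>p b. pure (b, scale (?c p * e b (fst p)) (snd p))"
  have w_sum: "w = (\<Sum>p\<in>Poly_Mapping.keys w. free_scale (?c p) (pure p))"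
  proof -
    have "lin_ext free_scale pure w = w" by (induction w rule: poly_mapping_add_induct) simp_all
    then show ?thesis by (simp add: lin_ext_def)
  qed
  have 1: "free_scale (?c p) (pure p) - (\<Sum>b\<in>E. ?term p b) \<in> ?R" if p: "p \<in> Poly_Mapping.keys w" for p
  proof -
    obtain a y where ay: "p = (a, y)" by fastforce
    have "free_scale (?c p) (pure p) - pure (a, scale (?c p) y) \<in> ?R"
      using free.subspace_neg[OF R scale_r[of a "?c p" y]] ay by simp
    moreover have "pure (\<Sum>b\<in>E. scale (e b a) b, scale (?c p) y) - (\<Sum>b\<in>E. pure (scale (e b a) b, scale (?c p) y)) \<in> ?R"
      by (rule sum_l[OF finE])
    moreover have "(\<Sum>b\<in>E. pure (scale (e b a) b, scale (?c p) y) - ?term p b) \<in> ?R"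
    proof (rule R_sum)
      fix b
      show "pure (scale (e b a) b, scale (?c p) y) - ?term p b \<in> ?R"
        using R_diff[OF scale_l[of "e b a" b "scale (?c p) y"] scale_r[of b "e b a" "scale (?c p) y"]] ay
        by (simp add: mult.commute)
    qed
    ultimately have "(free_scale (?c p) (pure p) - pure (a, scale (?c p) y))
      + (pure (\<Sum>b\<in>E. scale (e b a) b, scale (?c p) y) - (\<Sum>b\<in>E. pure (scale (e b a) b, scale (?c p) y)))
      + (\<Sum>b\<in>E. pure (scale (e b a) b, scale (?c p) y) - ?term p b) \<in> ?R"
      by (intro R_add)
    then show ?thesis using expand[OF p] ay by (simp add: sum_subtractf)
  qed
  have 2: "(\<Sum>p\<in>Poly_Mapping.keys w. ?term p b) \<in> ?R" for b
  proof -
    have "(\<Sum>p\<in>Poly_Mapping.keys w. scale (?c p * e b (fst p)) (snd p)) = SL (e b) (tensor_ring_of w)"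
      unfolding SL_tensor_ring_of lin_ext_def by (simp add: case_prod_beta)
    also have "\<dots> = 0" using assms e unfolding zt_def by blast
    finally show ?thesis
      using sum_r[OF finite_keys, of b "\<lambda>p. scale (?c p * e b (fst p)) (snd p)" w] zero_r[of b]
        R_diff[of "pure (b, 0)" "pure (b, 0) - (\<Sum>p\<in>Poly_Mapping.keys w. ?term p b)"] by simp
  qed
  have "(\<Sum>p\<in>Poly_Mapping.keys w. free_scale (?c p) (pure p) - (\<Sum>b\<in>E. ?term p b)) \<in> ?R"
    by (rule R_sum) (rule 1)
  then have "w - (\<Sum>p\<in>Poly_Mapping.keys w. \<Sum>b\<in>E. ?term p b) \<in> ?R"
    unfolding sum_subtractf using w_sum by simp
  moreover have "(\<Sum>p\<in>Poly_Mapping.keys w. \<Sum>b\<in>E. ?term p b) \<in> ?R"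
    by (subst sum.swap) (rule R_sum, rule 2)
  ultimately have "w - (\<Sum>p\<in>Poly_Mapping.keys w. \<Sum>b\<in>E. ?term p b)
      + (\<Sum>p\<in>Poly_Mapping.keys w. \<Sum>b\<in>E. ?term p b) \<in> ?R"
    by (rule R_add)
  then show ?thesis by (simp only: diff_add_cancel)
qed

text \<open>\<open>TS\<close> adds pure tensors with coefficient \<open>1\<close>; the scalars of a
  formal combination are absorbed into the left factors, for which \<open>A\<close> is taken to be a
  subspace.\<close>

lemma in_tensor_iff:
  assumes A: "subspace A"
  shows "in_tensor scale A B t \<longleftrightarrow> tensor_ring_of t \<in> TT A B"
proof
  assume "in_tensor scale A B t"
  then obtain u where u: "Poly_Mapping.keys u \<subseteq> A \<times> B" "tensor_eq scale u t" unfolding in_tensor_def by blast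
  have "tensor_ring_of u = (\<Sum>p\<in>Poly_Mapping.keys u. Poly_Mapping.single (PM (fst p) (snd p)) (Poly_Mapping.lookup u p))"
    unfolding tensor_ring_of_def lin_ext_def by (simp add: case_prod_beta pu_def)
  also have "\<dots> \<in> TT A B" using u(1) by (intro TS_sum TS_single[OF A]) auto
  finally show "tensor_ring_of t \<in> TT A B"
    using TS_cong[of "tensor_ring_of u" A B "tensor_ring_of t"] zt_uminus[OF tensor_eq_zt[OF u(2)]] by simp
next
  have "\<exists>u. Poly_Mapping.keys u \<subseteq> A \<times> B \<and> tensor_ring_of u - s \<in> Z" if "s \<in> TT A B" for s
    using that
  proof (induction rule: TS.induct)
    case (TS_zt s)
    then show ?case using zt_uminus[of s] by (intro exI[of _ 0]) simp
  next
    case (TS_step a b s)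
    then obtain u where u: "Poly_Mapping.keys u \<subseteq> A \<times> B" "tensor_ring_of u - s \<in> Z" by blast
    have "Poly_Mapping.keys (pure (a, b) + u) \<subseteq> A \<times> B"
      using Poly_Mapping.keys_add[of "pure (a, b)" u] u(1) TS_step by auto
    moreover have "tensor_ring_of (pure (a, b) + u) - (pu a b + s) \<in> Z" using u(2) by (simp add: pu_def)
    ultimately show ?case by blast
  qed
  moreover assume "tensor_ring_of t \<in> TT A B"
  ultimately obtain u where "Poly_Mapping.keys u \<subseteq> A \<times> B" "tensor_ring_of (u - t) \<in> Z" by fastforce
  then show "in_tensor scale A B t" unfolding in_tensor_def tensor_eq_def using zt_tensor_rel by blast
qed

end

section \<open>From a Hopf algebra to a bialgebra over an Ore chain\<close>

context hopf_algebra
begin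

definition "D x = tensor_ring_of (\<Delta> x)"

lemma fnl_counit: "fnl \<epsilon>"
proof -
  interpret e: Vector_Spaces.linear scale "(*)" \<epsilon> by (rule counit_linear)
  show ?thesis unfolding functional_def by (simp add: e.add e.scale)
qed

lemma D_add: "D (x + y) - (D x + D y) \<in> Z"
  unfolding D_def using tensor_eq_zt[OF comult_add[of x y]] by simp

lemma D_scale: "D (scale c x) - free_scale c (D x) \<in> Z"
  unfolding D_def using tensor_eq_zt[OF comult_scale[of c x]] by simp

lemma SL_D_linear: "fnl f \<Longrightarrow> SL f (D (x + y)) = SL f (D x) + SL f (D y)"
    "fnl f \<Longrightarrow> SL f (D (scale c x)) = scale c (SL f (D x))"
  using D_add[of x y] D_scale[of c x] unfolding zt_def by (simp_all add: algebra_simps)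

lemma SR_free_scale: "SR f (free_scale c t) = scale c (SR f t)"
  by (simp add: sr_def)

lemma SR_D_linear: "fnl f \<Longrightarrow> SR f (D (x + y)) = SR f (D x) + SR f (D y)"
    "fnl f \<Longrightarrow> SR f (D (scale c x)) = scale c (SR f (D x))"
  using D_add[of x y] D_scale[of c x] unfolding zt_iff_sr by (simp_all add: algebra_simps SR_free_scale)

text \<open>Coassociativity evaluated at \<open>f\<close> in the first and \<open>g\<close> in the
  third factor; what remains of the middle factor is the common value.\<close>

lemma D_slices_commute:
  assumes f: "fnl f" and g: "fnl g"
  shows "SL f (D (SR g (D x))) = SR g (D (SL f (D x)))"
proof -
  let ?\<phi> = "\<lambda>(a, b, c). scale (f a * g c) b"
  let ?l = "lin_ext free_scale (\<lambda>(a, b). lin_ext free_scale (\<lambda>(c, d). pure (c, d, b)) (\<Delta> a)) (\<Delta> x)"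
  let ?r = "lin_ext free_scale (\<lambda>(a, b). lin_ext free_scale (\<lambda>(c, d). pure (a, c, d)) (\<Delta> b)) (\<Delta> x)"
  have "lin_ext scale ?\<phi> (?l - ?r) = 0"
    by (rule lin_ext_tensor3_rel[OF coassoc[of x, unfolded tensor3_eq_def]])
       (auto simp: functionalD(1,2)[OF f] functionalD(1,2)[OF g] algebra_simps scale_left_distrib scale_right_distrib)
  then have eq: "lin_ext scale ?\<phi> ?l = lin_ext scale ?\<phi> ?r" by simp
  have "SL f (D (SR g (D x))) = lin_ext scale (\<lambda>(a, b). scale (g b) (SL f (D a))) (\<Delta> x)"
    unfolding D_def[of x] SR_tensor_ring_of
    by (subst linear_lin_ext[where h = "\<lambda>y. SL f (D y)"]) (auto simp: SL_D_linear[OF f] case_prod_unfold)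
  also have "\<dots> = lin_ext scale ?\<phi> ?l"
    unfolding lin_ext_lin_ext
    by (intro arg_cong2[where f = "lin_ext scale"] ext)
       (auto simp: D_def SL_tensor_ring_of lin_ext_lin_ext case_prod_beta mult.commute simp flip: lin_ext_fun_scale)
  also note eq
  also have "lin_ext scale ?\<phi> ?r = lin_ext scale (\<lambda>(a, b). scale (f a) (SR g (D b))) (\<Delta> x)"
    unfolding lin_ext_lin_ext
    by (intro arg_cong2[where f = "lin_ext scale"] ext)
       (auto simp: D_def SR_tensor_ring_of lin_ext_lin_ext case_prod_beta mult.commute simp flip: lin_ext_fun_scale)
  also have "\<dots> = SR g (D (SL f (D x)))"
    unfolding D_def[of x] SL_tensor_ring_of
    by (subst linear_lin_ext[where h = "\<lambda>y. SR g (D y)"]) (auto simp: SR_D_linear[OF g] case_prod_unfold)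
  finally show ?thesis .
qed

text \<open>The counit gives \<open>scale (\<epsilon> d) d = d\<close>, hence
  \<open>\<epsilon> d = 1\<close>; the antipode identity at a grouplike element then says that
  \<open>d * S d\<close> is \<open>1\<close>.\<close>

lemma grouplike_invertible:
  assumes "D d - pu d d \<in> Z" "d \<noteq> 0"
  shows "d * S d = 1"
proof -
  interpret s: Vector_Spaces.linear scale scale S by (rule antipode_linear)
  have "SL \<epsilon> (D d) = d" unfolding D_def SL_tensor_ring_of by (rule counit_left)
  then have "scale (\<epsilon> d) d = scale 1 d" using assms(1) fnl_counit unfolding zt_def by simp
  then have "\<epsilon> d = 1" using assms(2) by (metis scale_cancel_right)
  have "\<Delta> d - pure (d, d) \<in> tensor_rel scale"
    by (rule zt_tensor_rel) (use assms(1) in \<open>simp add: D_def pu_def\<close>)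
  then have "lin_ext scale (\<lambda>(a, b). a * S b) (\<Delta> d - pure (d, d)) = 0"
    by (rule lin_ext_tensor_rel) (auto simp: distrib_left distrib_right s.add s.scale scale_mult_left scale_mult_right)
  then show ?thesis using antipode_right[of d] \<open>\<epsilon> d = 1\<close> by simp
qed

lemma ihoe_ore_bialgebra:
  assumes "ihoe_of scale \<Delta> S (base_field scale)"
  shows "\<exists>N K X sg dl. ore_bialgebra scale N K X sg dl D \<epsilon>"
proof -
  obtain N K where K: "K 0 = base_field scale" "K N = UNIV"
    "\<And>i. i \<le> N \<Longrightarrow> hopf_subalgebra scale \<Delta> S (K i)"
    "\<And>i. i < N \<Longrightarrow> ore_extension scale (K i) (K (Suc i))"
    using assms unfolding ihoe_of_def by blast
  have "\<exists>X \<sigma> \<delta>. ore_step scale (K i) (K (Suc i)) X \<sigma> \<delta>" if "i < N" for i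
  proof -
    obtain X \<sigma> \<delta> where "X \<in> K (Suc i)" "algebra_automorphism_on scale (K i) \<sigma>"
      "skew_derivation_on scale (K i) \<sigma> \<delta>" "free_on_powers (K i) (K (Suc i)) X"
      "\<forall>r\<in>K i. X * r = \<sigma> r * X + \<delta> r"
      using K(4)[OF \<open>i < N\<close>] unfolding ore_extension_def by blast
    then have "ore_step scale (K i) (K (Suc i)) X \<sigma> \<delta>"
      using K(4)[OF \<open>i < N\<close>] unfolding ore_extension_def by unfold_locales auto
    then show ?thesis by blast
  qed
  then obtain X sg dl where ore: "\<And>i. i < N \<Longrightarrow> ore_step scale (K i) (K (Suc i)) (X i) (sg i) (dl i)"
    by metis
  have "ore_chain scale N K X sg dl"
    by (intro ore_chain.intro ore_chain_axioms.intro k_algebra_axioms K ore)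
  moreover have "ore_bialgebra_axioms scale N K D \<epsilon>"
  proof
    show "D (x + y) - (D x + D y) \<in> Z" for x y by (rule D_add)
    show "D (scale c 1) - pu (scale c 1) 1 \<in> Z" for c
    proof -
      have "D 1 - pu 1 1 \<in> Z"
        using tensor_eq_zt[OF comult_one] unfolding D_def by (simp add: pu_def)
      then have "SL f (D (scale c 1)) = SL f (pu (scale c 1) 1)" if "fnl f" for f
        using that SL_D_linear(2)[OF that, of c 1] functionalD(2)[OF that] sl_simps(5)[of f 1 1]
        unfolding zt_def by (simp del: sl_simps(5)) simp
      then show ?thesis unfolding zt_def by simp
    qed
    show "D (x * y) - D x * D y \<in> Z" for x y
      using tensor_eq_zt[OF comult_mult[of x y]] unfolding D_def by (simp add: tensor_ring_of_mult)
    show "SL \<epsilon> (D x) = x" for x unfolding D_def SL_tensor_ring_of by (rule counit_left)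
    show "SR \<epsilon> (D x) = x" for x unfolding D_def SR_tensor_ring_of by (rule counit_right)
    show "D x \<in> TT (K i) (K i)" if "i \<le> N" "x \<in> K i" for i x
      using K(3)[OF that(1)] that(2) in_tensor_iff[of "K i"]
      unfolding D_def hopf_subalgebra_def subalgebra_def by blast
    show "\<exists>d'. d * d' = 1" if "D d - pu d d \<in> Z" "d \<noteq> 0" for d
      using grouplike_invertible[OF that] by blast
  qed (use fnl_counit counit_mult counit_one D_slices_commute in auto)
  ultimately show ?thesis by (blast intro: ore_bialgebra.intro)
qed

lemma left_coideal_iff:
  "left_coideal_subalgebra scale \<Delta> A \<longleftrightarrow>
    subalgebra scale A \<and> (\<forall>f x. fnl f \<longrightarrow> x \<in> A \<longrightarrow> SL f (D x) \<in> A)"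
proof -
  have "in_tensor scale UNIV A (\<Delta> x) \<longleftrightarrow> (\<forall>f. fnl f \<longrightarrow> SL f (D x) \<in> A)" if "subalgebra scale A" for x
    using in_tensor_iff[of UNIV A "\<Delta> x"] TS_UNIV_iff[OF subalgebraD(1)[OF that]] subspace_UNIV
    unfolding D_def by blast
  then show ?thesis unfolding left_coideal_subalgebra_def by blast
qed

lemma right_coideal_iff:
  "right_coideal_subalgebra scale \<Delta> A \<longleftrightarrow>
    subalgebra scale A \<and> (\<forall>f x. fnl f \<longrightarrow> x \<in> A \<longrightarrow> SR f (D x) \<in> A)"
proof -
  have "in_tensor scale A UNIV (\<Delta> x) \<longleftrightarrow> (\<forall>f. fnl f \<longrightarrow> SR f (D x) \<in> A)" if "subalgebra scale A" for x
    using in_tensor_iff[OF subalgebraD(1)[OF that], of UNIV "\<Delta> x"]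
      TS_memI[OF subalgebraD(1)[OF that], of "D x" UNIV] sr_in[OF subalgebraD(1)[OF that]]
    unfolding D_def by blast
  then show ?thesis unfolding right_coideal_subalgebra_def by blast
qed

end

theorem theorem1p3:
  fixes scale :: "'k::field_char_0 \<Rightarrow> 'h::ring_1 \<Rightarrow> 'h"
    and \<Delta> :: "'h \<Rightarrow> (('h \<times> 'h) \<Rightarrow>\<^sub>0 'k)"
    and \<epsilon> :: "'h \<Rightarrow> 'k"
    and S :: "'h \<Rightarrow> 'h"
    and A :: "'h set"
  assumes "hopf_algebra scale \<Delta> \<epsilon> S"
    and "ihoe_of scale \<Delta> S (base_field scale)"
  shows "(left_coideal_subalgebra scale \<Delta> A \<longrightarrow>
            iterated_ore_extension scale (base_field scale) A \<and>
            (\<exists>(m::nat) C. C 0 = base_field scale \<and> C m = A \<and>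
               GKdim scale A = ereal (real m) \<and>
               (\<forall>i\<le>m. left_coideal_subalgebra scale \<Delta> (C i)) \<and>
               (\<forall>i<m. C i \<subset> C (Suc i) \<and> ore_extension scale (C i) (C (Suc i))))) \<and>
         (right_coideal_subalgebra scale \<Delta> A \<longrightarrow>
            iterated_ore_extension scale (base_field scale) A \<and>
            (\<exists>(m::nat) C. C 0 = base_field scale \<and> C m = A \<and>
               GKdim scale A = ereal (real m) \<and>
               (\<forall>i\<le>m. right_coideal_subalgebra scale \<Delta> (C i)) \<and>
               (\<forall>i<m. C i \<subset> C (Suc i) \<and> ore_extension scale (C i) (C (Suc i)))))"
proof -
  interpret h: hopf_algebra scale \<Delta> \<epsilon> S by (rule assms(1))
  obtain N K X sg dl where bialg: "ore_bialgebra scale N K X sg dl h.D \<epsilon>"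
    using h.ihoe_ore_bialgebra[OF assms(2)] by blast
  interpret l: ore_bialgebra_char_0 scale N K X sg dl h.D \<epsilon>
    using bialg by (rule ore_bialgebra_char_0.intro)
  \<comment> \<open>The chain \<open>K\<close> with its variables and twists stays the same;
    flipping the comultiplication exchanges left and right slices.\<close>
  interpret r: ore_bialgebra_char_0 scale N K X sg dl "\<lambda>x. swap (h.D x)" \<epsilon>
    using l.cop by (rule ore_bialgebra_char_0.intro)
  have left: "left_coideal_subalgebra scale \<Delta> B \<longleftrightarrow> l.coideal B" for B
    unfolding h.left_coideal_iff l.coideal_def l.L_def ..
  have right: "right_coideal_subalgebra scale \<Delta> B \<longleftrightarrow> r.coideal B" for B
    unfolding h.right_coideal_iff r.coideal_def r.L_def h.sl_swap ..
  have iter: "iterated_ore_extension scale (base_field scale) A"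
    if "C 0 = base_field scale" "C m = A" "\<forall>j<m. C j \<subset> C (Suc j) \<and> ore_extension scale (C j) (C (Suc j))"
    for m :: nat and C
    using that unfolding iterated_ore_extension_def by blast
  show ?thesis
    unfolding left right
  proof (intro conjI impI)
    assume "l.coideal A"
    note chain = l.coideal_chain[OF this]
    show "iterated_ore_extension scale (base_field scale) A" using chain iter by metis
    show "\<exists>(m::nat) C. C 0 = base_field scale \<and> C m = A \<and> GKdim scale A = ereal (real m) \<and>
        (\<forall>i\<le>m. l.coideal (C i)) \<and> (\<forall>i<m. C i \<subset> C (Suc i) \<and> ore_extension scale (C i) (C (Suc i)))"
      by (rule chain)
  next
    assume "r.coideal A"
    note chain = r.coideal_chain[OF this]
    show "iterated_ore_extension scale (base_field scale) A" using chain iter by metis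
    show "\<exists>(m::nat) C. C 0 = base_field scale \<and> C m = A \<and> GKdim scale A = ereal (real m) \<and>
        (\<forall>i\<le>m. r.coideal (C i)) \<and> (\<forall>i<m. C i \<subset> C (Suc i) \<and> ore_extension scale (C i) (C (Suc i)))"
      by (rule chain)
  qed
qed

end
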